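(* Let $N\ge1$ be an integer with $\lambda_{N+1}>0$, let $\mu_i,\varphi_i$ ($i=1,\dots,N$), $B$, $g=\{g_{i,m}\}=-B^{-1}$, $F$, $\bar L$ be as in the context, and let $\sigma>0$. Suppose that there exists a constant $\kappa>0$ such that $$\mu_i^2>2N\bar L^2\Big(1+\frac1\kappa\Big)\|\varphi_i\|^2\sum_{m=1}^Ng_{i,m}^2,\quad i=1,\dots,N,$$ $$\lambda_{N+1}^2>\bar L^2(1+\kappa N)\Big(1+2N\sum_{i=1}^N\sum_{m=1}^N\|\varphi_i\|^2g_{i,m}^2\Big).$$ Then there exist constants $\omega_1,\dots,\omega_N,\gamma,R>0$ such that the functional $$V(w,y):=\frac R2\sum_{m=1}^N\langle\phi_m,w\rangle^2+\frac\gamma2\|w-Pw\|^2+\frac12\sum_{i=1}^N\omega_iy_i^2$$ is a Control Lyapunov Functional for the system $$\frac{\partial w}{\partial t}(t,x)+(Aw[t])(x)=\Big(F\Big(w[t]+\sum_{i=1}^N\varphi_iy_i(t)\Big)\Big)(x)-\sum_{i=1}^N\varphi_i(x)v_i(t),\quad x\in(0,1),\qquad(\mathrm{i})$$ $$b_1w(t,0)+b_2\frac{\partial w}{\partial x}(t,0)=a_1w(t,1)+a_2\frac{\partial w}{\partial x}(t,1)=0,\qquad(\mathrm{ii})$$ $$\dot y_i(t)=-\mu_iy_i(t)+v_i(t),\quad i=1,\dots,N.\qquad(\mathrm{iii})$$ More specifically, there exists a constant $\theta>0$ such that for all $(w,y)\in D\times\mathbb{R}^N$ $$\dot V\le-\theta\Big(\|w\|^2+\sum_{i=1}^Ny_i^2\Big),$$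 where $$\dot V=R\sum_{n=1}^N\langle\phi_n,w\rangle\langle\phi_n,\dot w\rangle+\sum_{i=1}^N\omega_iy_iv_i-\sum_{i=1}^N\mu_i\omega_iy_i^2+\gamma\langle w-Pw,\dot w-P\dot w\rangle,$$ $\dot w=-Aw-\sum_{i=1}^Nv_i\varphi_i+F(u)$, $u=w+\sum_{i=1}^N\varphi_iy_i$, and the control inputs are given by $$v_i=\sum_{m=1}^Ng_{i,m}(\sigma-\lambda_m)\langle\phi_m,w\rangle+\sum_{m=1}^Ng_{i,m}\langle\phi_m,F(u)\rangle,\quad i=1,\dots,N.\qquad(\mathrm{iv})$$ Furthermore, there exist constants $\bar K,\bar\sigma>0$ such that every solution $w\in C^0([0,+\infty);L_r^2(0,1))\cap C^1((0,+\infty);L_r^2(0,1))$, $y\in C^1([0,+\infty);\mathbb{R}^N)$ with $w[t]\in D$ for all $t>0$, which satisfies (i), (ii), (iii), (iv) for all $t>0$, also satisfies, with $w_0=w[0]$ and $y_0=y(0)$, $$\|w[t]\|+|y(t)|\le\bar K\exp(-\bar\sigma t)\left(\|w_0\|+|y_0|\right),\quad\text{for all }t\ge0.$$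
   Context: $L_r^2(0,1)$ is the Hilbert space of measurable functions on $[0,1]$ with inner product $\langle u,v\rangle=\int_0^1 r(x)u(x)v(x)\,dx$ and induced norm $\|\cdot\|$; $|\cdot|$ is the Euclidean norm; $w[t]$ denotes the profile $x\mapsto w(t,x)$; $y=(y_1,\dots,y_N)^T$. Let $p\in C^1([0,1];(0,+\infty))$, $r\in C^0([0,1];(0,+\infty))$, $q\in C^0([0,1];\mathbb{R})$, and $a_1,a_2,b_1,b_2\in\mathbb{R}$ with $a_1^2+a_2^2=1$, $b_1^2+b_2^2=1$. Let $D\subseteq H^2(0,1)$ be the set of all $f$ with $b_1f(0)+b_2f'(0)=a_1f(1)+a_2f'(1)=0$. The Sturm-Liouville operator $A:D\to L_r^2(0,1)$ is $$(Af)(x)=-\frac{1}{r(x)}\frac{d}{dx}\left(p(x)\frac{df}{dx}(x)\right)+\frac{q(x)}{r(x)}f(x).$$ Its eigenvalues are real and form a strictly increasing sequence $\lambda_1<\lambda_2<\cdots$ with $\lambda_n\to+\infty$; to each $\lambda_n$ corresponds exactly one (up to sign) normalized eigenfunction $\phi_n\in C^2([0,1])\cap D$, $A\phi_n=\lambda_n\phi_n$, $\|\phi_n\|=1$, and $\{\phi_n\}_{n\ge1}$ is an orthonormal basis of $L_r^2(0,1)$. Standing assumption: $\sum_{n=N'+1}^{\infty}\lambda_n^{-1}\max_{0\le x\le1}|\phi_n(x)|<+\infty$ for some $N'>0$ with $\lambda_{N'+1}>0$. Let $Pw=\sum_{n=1}^N\langle\phi_n,w\rangle\phi_n$ for $w\in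 L_r^2(0,1)$. Constants $\mu_i>0$ and functions $\varphi_i\in C^2([0,1])$, $i=1,\dots,N$, satisfy $(p\varphi_i')'-q\varphi_i=-\mu_ir\varphi_i$ on $[0,1]$ with $b_1\varphi_i(0)+b_2\varphi_i'(0)=0$, $a_1\varphi_i(1)+a_2\varphi_i'(1)=1$. It is assumed that $\langle\varphi_i,\varphi_m\rangle=0$ whenever $i\ne m$, and that the $N\times N$ matrix $B=[B_1\ \cdots\ B_N]$ with columns $B_i=-(\langle\varphi_i,\phi_1\rangle,\dots,\langle\varphi_i,\phi_N\rangle)^T$ satisfies $\det(B)\ne0$. Put $g=\{g_{i,m}:i,m=1,\dots,N\}=-B^{-1}$. $F:L_r^2(0,1)\to L_r^2(0,1)$ is a continuous (possibly nonlinear) mapping with $F(0)=0$ and $\|F(u)\|\le\bar L\|u\|$ for all $u\in L_r^2(0,1)$, where $\bar L\ge0$ is a constant. *)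

theory Defs
  imports "HOL-Analysis.Analysis" "Jordan_Normal_Form.Determinant" "Jordan_Normal_Form.Gauss_Jordan_Elimination"
begin

text \<open>Conventions. Elements of function spaces on \<open>[0,1]\<close> are represented by total functions
  \<open>real \<Rightarrow> real\<close> whose values outside \<open>[0,1]\<close> are irrelevant; elements of the weighted \<open>L\<^sup>2\<close> space
  are equal iff they agree almost everywhere on \<open>[0,1]\<close>, i.e. iff \<open>L2norm\<close> of the difference is 0.
  Finite and infinite families are indexed from 1, and \<open>y :: nat \<Rightarrow> real\<close> represents the
  vector \<open>(y 1, \<dots>, y N)\<close>.\<close>

subsection \<open>Function spaces\<close>

definition L2w :: "(real \<Rightarrow> real) \<Rightarrow> (real \<Rightarrow> real) set" where
  "L2w r = {u. set_borel_measurable lebesgue {0..1} u \<and>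
               set_integrable lebesgue {0..1} (\<lambda>x. r x * (u x)\<^sup>2)}"

definition L2ip :: "(real \<Rightarrow> real) \<Rightarrow> (real \<Rightarrow> real) \<Rightarrow> (real \<Rightarrow> real) \<Rightarrow> real" where
  "L2ip r u v = (LINT x:{0..1}|lebesgue. r x * u x * v x)"

definition L2norm :: "(real \<Rightarrow> real) \<Rightarrow> (real \<Rightarrow> real) \<Rightarrow> real" where
  "L2norm r u = sqrt (L2ip r u u)"

text \<open>Derivative relative to \<open>S\<close>; one-sided at the end points of an interval.\<close>

definition deriv_in :: "real set \<Rightarrow> (real \<Rightarrow> real) \<Rightarrow> real \<Rightarrow> real" where
  "deriv_in S f x = vector_derivative f (at x within S)"

fun Ck_on :: "nat \<Rightarrow> real set \<Rightarrow> (real \<Rightarrow> real) \<Rightarrow> bool" where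
  "Ck_on 0 S f \<longleftrightarrow> continuous_on S f"
| "Ck_on (Suc k) S f \<longleftrightarrow> f differentiable_on S \<and> Ck_on k S (deriv_in S f)"

abbreviation D1 :: "(real \<Rightarrow> real) \<Rightarrow> real \<Rightarrow> real" where
  "D1 \<equiv> deriv_in {0..1}"

text \<open>In one dimension a continuous function has the weak derivative \<open>g \<in> L\<^sup>1(0,1)\<close> iff it is the
  indefinite integral of \<open>g\<close>. Hence \<open>H\<^sup>2(0,1)\<close> consists of the \<open>C\<^sup>1\<close> functions
  on \<open>[0,1]\<close> whose derivative has a square integrable weak derivative; using the \<open>C\<^sup>1\<close>
  representative gives the boundary values of \<open>f\<close> and \<open>f'\<close> their meaning. A weak derivative is
  unique up to null sets only, so \<open>weak_deriv\<close> picks a representative.\<close>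

definition has_weak_deriv :: "(real \<Rightarrow> real) \<Rightarrow> (real \<Rightarrow> real) \<Rightarrow> bool" where
  "has_weak_deriv h g \<longleftrightarrow> set_integrable lebesgue {0..1} g \<and>
     (\<forall>x\<in>{0..1}. h x = h 0 + (LINT s:{0..x}|lebesgue. g s))"

definition weak_deriv :: "(real \<Rightarrow> real) \<Rightarrow> real \<Rightarrow> real" where
  "weak_deriv h = (SOME g. has_weak_deriv h g)"

definition H2 :: "(real \<Rightarrow> real) set" where
  "H2 = {f. Ck_on 1 {0..1} f \<and> (\<exists>g\<in>L2w (\<lambda>_. 1). has_weak_deriv (D1 f) g)}"

text \<open>For mappings on the weighted \<open>L\<^sup>2\<close> space. As \<open>L2norm\<close> is only a seminorm on representatives,
  continuity includes that almost everywhere equal arguments have almost everywhere equal images.\<close>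

definition L2_continuous :: "(real \<Rightarrow> real) \<Rightarrow> ((real \<Rightarrow> real) \<Rightarrow> (real \<Rightarrow> real)) \<Rightarrow> bool" where
  "L2_continuous r F \<longleftrightarrow> (\<forall>u\<in>L2w r. \<forall>\<epsilon>>0. \<exists>\<delta>>0. \<forall>v\<in>L2w r.
     L2norm r (\<lambda>x. v x - u x) < \<delta> \<longrightarrow> L2norm r (\<lambda>x. F v x - F u x) < \<epsilon>)"

text \<open>For curves in the weighted \<open>L\<^sup>2\<close> space.\<close>

definition L2_C0_on :: "(real \<Rightarrow> real) \<Rightarrow> real set \<Rightarrow> (real \<Rightarrow> real \<Rightarrow> real) \<Rightarrow> bool" where
  "L2_C0_on r T w \<longleftrightarrow> (\<forall>t\<in>T. w t \<in> L2w r) \<and>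
     (\<forall>t\<in>T. ((\<lambda>s. L2norm r (\<lambda>x. w s x - w t x)) \<longlongrightarrow> 0) (at t within T))"

definition L2_has_deriv_on ::
  "(real \<Rightarrow> real) \<Rightarrow> real set \<Rightarrow> (real \<Rightarrow> real \<Rightarrow> real) \<Rightarrow> (real \<Rightarrow> real \<Rightarrow> real) \<Rightarrow> bool" where
  "L2_has_deriv_on r T w wt \<longleftrightarrow> (\<forall>t\<in>T.
     ((\<lambda>s. L2norm r (\<lambda>x. (w s x - w t x) / (s - t) - wt t x)) \<longlongrightarrow> 0) (at t within T))"

subsection \<open>The Sturm-Liouville operator\<close>

definition SL_dom :: "real \<Rightarrow> real \<Rightarrow> real \<Rightarrow> real \<Rightarrow> (real \<Rightarrow> real) set" where
  "SL_dom a1 a2 b1 b2 =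
     {f\<in>H2. b1 * f 0 + b2 * D1 f 0 = 0 \<and> a1 * f 1 + a2 * D1 f 1 = 0}"

definition SL_op ::
  "(real \<Rightarrow> real) \<Rightarrow> (real \<Rightarrow> real) \<Rightarrow> (real \<Rightarrow> real) \<Rightarrow> (real \<Rightarrow> real) \<Rightarrow> real \<Rightarrow> real" where
  "SL_op p q r f x =
     - (1 / r x) * weak_deriv (\<lambda>s. p s * D1 f s) x + q x / r x * f x"

definition SL_eigenpair where
  "SL_eigenpair p q r a1 a2 b1 b2 l f \<longleftrightarrow> f \<in> SL_dom a1 a2 b1 b2 \<and> L2norm r f \<noteq> 0 \<and>
     (AE x in lebesgue. x \<in> {0..1} \<longrightarrow> SL_op p q r f x = l * f x)"

text \<open>The facts from Sturm-Liouville theory which fix the meaning of the eigenvalues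
  \<open>lam 1 < lam 2 < \<dots>\<close> and normalized eigenfunctions \<open>\<phi> 1, \<phi> 2, \<dots>\<close>. The values \<open>lam 0\<close> and \<open>\<phi> 0\<close>
  are irrelevant.\<close>

definition SL_eigensystem ::
  "(real \<Rightarrow> real) \<Rightarrow> (real \<Rightarrow> real) \<Rightarrow> (real \<Rightarrow> real) \<Rightarrow> real \<Rightarrow> real \<Rightarrow> real \<Rightarrow> real \<Rightarrow>
   (nat \<Rightarrow> real) \<Rightarrow> (nat \<Rightarrow> real \<Rightarrow> real) \<Rightarrow> bool" where
  "SL_eigensystem p q r a1 a2 b1 b2 lam \<phi> \<longleftrightarrow>
     strict_mono_on {1..} lam \<and> filterlim lam at_top sequentially \<and>
     lam ` {1..} = {l. \<exists>f. SL_eigenpair p q r a1 a2 b1 b2 l f} \<and>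
     (\<forall>n\<ge>1. SL_eigenpair p q r a1 a2 b1 b2 (lam n) (\<phi> n) \<and>
            Ck_on 2 {0..1} (\<phi> n) \<and> L2norm r (\<phi> n) = 1 \<and>
            (\<forall>f. SL_eigenpair p q r a1 a2 b1 b2 (lam n) f \<and> L2norm r f = 1 \<longrightarrow>
               (\<forall>x\<in>{0..1}. f x = \<phi> n x) \<or> (\<forall>x\<in>{0..1}. f x = - \<phi> n x))) \<and>
     (\<forall>n\<ge>1. \<forall>m\<ge>1. n \<noteq> m \<longrightarrow> L2ip r (\<phi> n) (\<phi> m) = 0) \<and>
     (\<forall>f\<in>L2w r. (\<lambda>k. L2norm r (\<lambda>x. f x - (\<Sum>n=1..k. L2ip r (\<phi> n) f * \<phi> n x))) \<longlonglongrightarrow> 0)"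

definition proj :: "(real \<Rightarrow> real) \<Rightarrow> (nat \<Rightarrow> real \<Rightarrow> real) \<Rightarrow> nat \<Rightarrow> (real \<Rightarrow> real) \<Rightarrow> real \<Rightarrow> real" where
  "proj r \<phi> N w x = (\<Sum>n=1..N. L2ip r (\<phi> n) w * \<phi> n x)"

text \<open>Column \<open>i\<close> is the vector \<open>B\<^sub>i\<close>. Matrix entries are indexed from 0, hence the shifts.\<close>

definition Bmat ::
  "(real \<Rightarrow> real) \<Rightarrow> (nat \<Rightarrow> real \<Rightarrow> real) \<Rightarrow> (nat \<Rightarrow> real \<Rightarrow> real) \<Rightarrow> nat \<Rightarrow> real mat" where
  "Bmat r \<phi> vphi N = Matrix.mat N N (\<lambda>(m, i). - L2ip r (vphi (i + 1)) (\<phi> (m + 1)))"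

subsection \<open>The control system\<close>

definition lift :: "nat \<Rightarrow> (nat \<Rightarrow> real \<Rightarrow> real) \<Rightarrow> (real \<Rightarrow> real) \<Rightarrow> (nat \<Rightarrow> real) \<Rightarrow> real \<Rightarrow> real" where
  "lift N vphi w y x = w x + (\<Sum>i=1..N. vphi i x * y i)"

text \<open>The right-hand sides of the system, solved for the time derivatives of \<open>w\<close> and \<open>y i\<close>.\<close>

definition w_rate where
  "w_rate p q r N vphi F w y v x =
     - SL_op p q r w x - (\<Sum>i=1..N. v i * vphi i x) + F (lift N vphi w y) x"

definition y_rate :: "(nat \<Rightarrow> real) \<Rightarrow> (nat \<Rightarrow> real) \<Rightarrow> (nat \<Rightarrow> real) \<Rightarrow> nat \<Rightarrow> real" where
  "y_rate \<mu> y v i = - \<mu> i * y i + v i"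

definition is_solution ::
  "(real \<Rightarrow> real) \<Rightarrow> (real \<Rightarrow> real) \<Rightarrow> (real \<Rightarrow> real) \<Rightarrow> real \<Rightarrow> real \<Rightarrow> real \<Rightarrow> real \<Rightarrow>
   nat \<Rightarrow> (nat \<Rightarrow> real) \<Rightarrow> (nat \<Rightarrow> real \<Rightarrow> real) \<Rightarrow> ((real \<Rightarrow> real) \<Rightarrow> (real \<Rightarrow> real)) \<Rightarrow>
   (real \<Rightarrow> real \<Rightarrow> real) \<Rightarrow> (real \<Rightarrow> nat \<Rightarrow> real) \<Rightarrow> (real \<Rightarrow> nat \<Rightarrow> real) \<Rightarrow> bool" where
  "is_solution p q r a1 a2 b1 b2 N \<mu> vphi F w y v \<longleftrightarrow>
     L2_C0_on r {0..} w \<and>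
     (\<forall>i\<in>{1..N}. Ck_on 1 {0..} (\<lambda>t. y t i)) \<and>
     (\<forall>t>0. w t \<in> SL_dom a1 a2 b1 b2) \<and>
     (\<exists>wt. L2_C0_on r {0<..} wt \<and> L2_has_deriv_on r {0<..} w wt \<and>
        (\<forall>t>0. AE x in lebesgue. x \<in> {0<..<1} \<longrightarrow>
           wt t x + SL_op p q r (w t) x
             = F (lift N vphi (w t) (y t)) x - (\<Sum>i=1..N. vphi i x * v t i))) \<and>
     (\<forall>t>0. b1 * w t 0 + b2 * D1 (w t) 0 = 0 \<and> a1 * w t 1 + a2 * D1 (w t) 1 = 0) \<and>
     (\<forall>t>0. \<forall>i\<in>{1..N}.
        ((\<lambda>s. y s i) has_real_derivative (- \<mu> i * y t i + v t i)) (at t))"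

definition feedback where
  "feedback r \<phi> lam N vphi F g \<sigma> w y i =
     (\<Sum>m=1..N. g i m * (\<sigma> - lam m) * L2ip r (\<phi> m) w)
     + (\<Sum>m=1..N. g i m * L2ip r (\<phi> m) (F (lift N vphi w y)))"

subsection \<open>Control Lyapunov Functionals\<close>

definition class_Kinf :: "(real \<Rightarrow> real) \<Rightarrow> bool" where
  "class_Kinf \<alpha> \<longleftrightarrow> continuous_on {0..} \<alpha> \<and> strict_mono_on {0..} \<alpha> \<and> \<alpha> 0 = 0 \<and>
     filterlim \<alpha> at_top at_top"

definition state_norm :: "(real \<Rightarrow> real) \<Rightarrow> nat \<Rightarrow> (real \<Rightarrow> real) \<Rightarrow> (nat \<Rightarrow> real) \<Rightarrow> real" where
  "state_norm r N w y = sqrt ((L2norm r w)\<^sup>2 + (\<Sum>i=1..N. (y i)\<^sup>2))"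

text \<open>A continuous, positive definite and proper functional such that in each state of the domain
  some value of the input makes its derivative along the system negative, with a bound that is
  positive definite in the norm of the state. The derivative is the directional derivative of
  \<open>V\<close> in the direction given by the right-hand sides.\<close>

definition control_Lyapunov_functional ::
  "(real \<Rightarrow> real) \<Rightarrow> (real \<Rightarrow> real) \<Rightarrow> (real \<Rightarrow> real) \<Rightarrow> real \<Rightarrow> real \<Rightarrow> real \<Rightarrow> real \<Rightarrow>
   nat \<Rightarrow> (nat \<Rightarrow> real) \<Rightarrow> (nat \<Rightarrow> real \<Rightarrow> real) \<Rightarrow> ((real \<Rightarrow> real) \<Rightarrow> (real \<Rightarrow> real)) \<Rightarrow>
   ((real \<Rightarrow> real) \<Rightarrow> (nat \<Rightarrow> real) \<Rightarrow> real) \<Rightarrow> bool" where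
  "control_Lyapunov_functional p q r a1 a2 b1 b2 N \<mu> vphi F V \<longleftrightarrow>
     (\<forall>w\<in>L2w r. \<forall>y. \<forall>\<epsilon>>0. \<exists>\<delta>>0. \<forall>w'\<in>L2w r. \<forall>y'.
        state_norm r N (\<lambda>x. w' x - w x) (\<lambda>i. y' i - y i) < \<delta> \<longrightarrow> \<bar>V w' y' - V w y\<bar> < \<epsilon>) \<and>
     (\<exists>\<alpha>1 \<alpha>2. class_Kinf \<alpha>1 \<and> class_Kinf \<alpha>2 \<and>
        (\<forall>w\<in>L2w r. \<forall>y. \<alpha>1 (state_norm r N w y) \<le> V w y \<and> V w y \<le> \<alpha>2 (state_norm r N w y))) \<and>
     (\<exists>\<alpha>3. continuous_on {0..} \<alpha>3 \<and> \<alpha>3 0 = 0 \<and> (\<forall>s>0. \<alpha>3 s > 0) \<and>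
        (\<forall>w\<in>SL_dom a1 a2 b1 b2. \<forall>y. \<exists>v. \<exists>d.
           ((\<lambda>h. V (\<lambda>x. w x + h * w_rate p q r N vphi F w y v x)
                   (\<lambda>i. y i + h * y_rate \<mu> y v i)) has_real_derivative d) (at 0) \<and>
           d \<le> - \<alpha>3 (state_norm r N w y)))"

definition Vfun where
  "Vfun r \<phi> N R \<gamma> \<omega> w y =
     R / 2 * (\<Sum>m=1..N. (L2ip r (\<phi> m) w)\<^sup>2)
     + \<gamma> / 2 * (L2norm r (\<lambda>x. w x - proj r \<phi> N w x))\<^sup>2
     + 1 / 2 * (\<Sum>i=1..N. \<omega> i * (y i)\<^sup>2)"

text \<open>The explicit expression for the derivative of \<open>Vfun\<close>, with \<open>wd\<close> the time derivative of \<open>w\<close>.\<close>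

definition Vdot where
  "Vdot r \<phi> N \<mu> R \<gamma> \<omega> w y wd v =
     R * (\<Sum>n=1..N. L2ip r (\<phi> n) w * L2ip r (\<phi> n) wd)
     + (\<Sum>i=1..N. \<omega> i * y i * v i) - (\<Sum>i=1..N. \<mu> i * \<omega> i * (y i)\<^sup>2)
     + \<gamma> * L2ip r (\<lambda>x. w x - proj r \<phi> N w x) (\<lambda>x. wd x - proj r \<phi> N wd x)"

end

theory Submission
  imports Defs
begin

text \<open>
  Write \<open>w = P w + T\<close> with \<open>T = w - P w\<close>, let \<open>\<lambda>\<close> be the eigenvalue with index \<open>N + 1\<close>, and let
  \<open>A\<close> be the Sturm-Liouville operator. Since \<open>B g = - I\<close>, the feedback replaces the dynamics of the
  first \<open>N\<close> modes by \<open>c' = - \<sigma> c\<close> exactly: it cancels \<open>\<lambda>\<^sub>m c\<^sub>m\<close> as well as the projection of the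
  nonlinear term (\<open>closed_loop_modes\<close>). The rest of the state dissipates by itself: symmetry of \<open>A\<close>
  and completeness of the eigenfunctions give \<open>\<langle>T, A w\<rangle> \<ge> \<lambda> \<parallel>T\<parallel>\<^sup>2\<close> (\<open>L2ip_tail_SL_op\<close>), and each
  \<open>y\<^sub>i\<close> decays at the rate \<open>\<mu>\<^sub>i\<close>. What has to be controlled is the coupling of \<open>T\<close> and \<open>y\<close> through
  \<open>F(u)\<close>, which acts on \<open>T\<close> directly and acts on both \<open>T\<close> and \<open>y\<close> through the feedback.

  With \<open>\<alpha> = 1 + \<kappa> N\<close> and \<open>\<beta> = 1 + 1 / \<kappa>\<close>, the energy
  \<open>E = \<parallel>T\<parallel>\<^sup>2 + (\<beta> / \<alpha>) \<Sum>\<^sub>i \<parallel>vphi\<^sub>i\<parallel>\<^sup>2 y\<^sub>i\<^sup>2\<close> is adapted to \<open>F\<close> in the sense that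
  \<open>\<parallel>F(u)\<parallel>\<^sup>2 \<le> L\<^sup>2 \<alpha> (E + \<parallel>P w\<parallel>\<^sup>2)\<close>. Taking \<open>\<gamma> = 1\<close> and \<open>\<omega>\<^sub>i = \<lambda> \<beta> \<parallel>vphi\<^sub>i\<parallel>\<^sup>2 / (\<alpha> \<mu>\<^sub>i)\<close> makes the
  dissipation of \<open>T\<close> and \<open>y\<close> at least \<open>\<lambda> E\<close>. By the Cauchy-Schwarz inequality the nonlinear coupling
  is at most \<open>\<parallel>F(u)\<parallel> Y\<close>, where \<open>Y\<^sup>2\<close> is bounded by a quadratic form in \<open>\<parallel>T\<parallel>\<close> and \<open>y\<close>; the two strict
  inequalities between \<open>\<lambda>, \<mu>\<^sub>i\<close> and \<open>L\<close> are what yields \<open>L\<^sup>2 \<alpha> Y\<^sup>2 \<le> \<nu>\<^sup>2 \<lambda>\<^sup>2 E\<close> for some \<open>\<nu> < 1\<close>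
  (\<open>uniform_gap\<close>, \<open>coupling_estimate\<close>). Hence the coupling consumes
  only the fraction \<open>\<nu>\<close> of the dissipation, up to a multiple of \<open>\<parallel>P w\<parallel>\<^sup>2\<close>. All other cross terms
  contain a factor \<open>\<parallel>P w\<parallel>\<close> and are absorbed by choosing \<open>R\<close> large (\<open>Vdot_negative\<close>).

  The functional is a polynomial in finitely many inner products, one squared norm and the \<open>y\<^sub>i\<close>, so
  it can be differentiated along every curve that is differentiable in the weighted \<open>L\<^sup>2\<close> norm
  (\<open>Vfun_curve_derivative\<close>). Applied to straight lines this gives the control Lyapunov property, and
  applied to solutions it gives \<open>V' \<le> - c V\<close>, from which exponential decay follows.
\<close>

section \<open>The weighted space of square integrable functions\<close>

text \<open>Over this measure, membership in \<open>L2w r\<close> and the form \<open>L2ip r\<close> become statements about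
  ordinary integrability and ordinary integrals, without indicator functions.\<close>

abbreviation I01 :: "real measure" where
  "I01 \<equiv> lebesgue_on {0..1}"

lemma borel_measurable_I01_continuous:
  fixes f :: "real \<Rightarrow> real"
  assumes "continuous_on {0..1} f"
  shows "f \<in> borel_measurable I01"
  using assms by (intro continuous_imp_measurable_on_sets_lebesgue) auto

lemma integrable_I01_continuous:
  fixes f :: "real \<Rightarrow> real"
  assumes "continuous_on {0..1} f"
  shows "integrable I01 f"
  using absolutely_integrable_continuous_real[OF assms]
  by (simp add: set_integrable_def integrable_restrict_space)

lemma L2w_iff:
  "u \<in> L2w r \<longleftrightarrow> u \<in> borel_measurable I01 \<and> integrable I01 (\<lambda>x. r x * (u x)\<^sup>2)"
  by (simp add: L2w_def set_borel_measurable_def set_integrable_def integrable_restrict_space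
      borel_measurable_restrict_space_iff)

lemma L2ip_eq: "L2ip r u v = (\<integral>x. r x * u x * v x \<partial>I01)"
  by (simp add: L2ip_def set_lebesgue_integral_def integral_restrict_space)

lemma L2ip_commute: "L2ip r u v = L2ip r v u"
  by (simp add: L2ip_def mult.commute mult.left_commute)

lemma L2ip_scale_right: "L2ip r u (\<lambda>x. c * v x) = c * L2ip r u v"
proof -
  have "(\<lambda>x. r x * u x * (c * v x)) = (\<lambda>x. c * (r x * u x * v x))" by (auto simp: algebra_simps)
  then show ?thesis unfolding L2ip_eq by simp
qed

lemma L2ip_cong_AE:
  assumes "u \<in> borel_measurable I01" "v \<in> borel_measurable I01" "f \<in> borel_measurable I01"
    and "r \<in> borel_measurable I01" and "AE x in I01. u x = v x"
  shows "L2ip r f u = L2ip r f v"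
  unfolding L2ip_eq using assms by (intro integral_cong_AE) auto

lemma AE_I01_iff: "(AE x in I01. P x) \<longleftrightarrow> (AE x in lebesgue. x \<in> {0..1} \<longrightarrow> P x)"
  by (simp add: AE_restrict_space_iff)

text \<open>The differential equation is required in the open interval only, whereas the inner
  product integrates over the closed one.\<close>

lemma AE_I01_open:
  assumes "AE x in lebesgue. x \<in> {0<..<1} \<longrightarrow> P x"
  shows "AE x in I01. P x"
proof -
  have "AE x in lebesgue. x \<notin> {0, 1::real}"
    by (rule AE_not_in) (simp add: countable_imp_null_set_lborel null_sets_completionI)
  with assms show ?thesis unfolding AE_I01_iff by eventually_elim auto
qed

locale weighted_L2 =
  fixes r :: "real \<Rightarrow> real"
  assumes r_cont: "continuous_on {0..1} r" and r_pos: "\<And>x. x \<in> {0..1} \<Longrightarrow> r x > 0"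
begin

lemma r_measurable [measurable]: "r \<in> borel_measurable I01"
  using r_cont by (rule borel_measurable_I01_continuous)

lemma L2wD: "u \<in> L2w r \<Longrightarrow> u \<in> borel_measurable I01"
  by (simp add: L2w_iff)

lemma L2w_continuous: "continuous_on {0..1} u \<Longrightarrow> u \<in> L2w r"
  unfolding L2w_iff
  by (intro conjI borel_measurable_I01_continuous integrable_I01_continuous continuous_intros r_cont)

lemma integrable_L2ip:
  assumes u: "u \<in> L2w r" and v: "v \<in> L2w r"
  shows "integrable I01 (\<lambda>x. r x * u x * v x)"
proof (rule Bochner_Integration.integrable_bound)
  show "integrable I01 (\<lambda>x. r x * (u x)\<^sup>2 + r x * (v x)\<^sup>2)"
    using u v by (auto simp: L2w_iff)
  show "(\<lambda>x. r x * u x * v x) \<in> borel_measurable I01"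
    using L2wD[OF u] L2wD[OF v] by measurable
  have "\<bar>a * b\<bar> \<le> a\<^sup>2 + b\<^sup>2" for a b :: real
    using sum_squares_bound[of a b] sum_squares_bound[of "- a" b] zero_le_power2[of a] zero_le_power2[of b]
    by (simp add: abs_le_iff)
  then have "r x * \<bar>u x * v x\<bar> \<le> r x * ((u x)\<^sup>2 + (v x)\<^sup>2)" if "x \<in> {0..1}" for x
    using r_pos[OF that] by (intro mult_left_mono) auto
  then have "norm (r x * u x * v x) \<le> norm (r x * (u x)\<^sup>2 + r x * (v x)\<^sup>2)" if "x \<in> {0..1}" for x
    using that r_pos[OF that] by (auto simp: abs_mult algebra_simps)
  then show "AE x in I01. norm (r x * u x * v x) \<le> norm (r x * (u x)\<^sup>2 + r x * (v x)\<^sup>2)"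
    by (intro AE_I2) auto
qed

lemma L2w_add: assumes u: "u \<in> L2w r" and v: "v \<in> L2w r" shows "(\<lambda>x. u x + v x) \<in> L2w r"
proof -
  have "(\<lambda>x. r x * (u x + v x)\<^sup>2) = (\<lambda>x. r x * (u x)\<^sup>2 + r x * (v x)\<^sup>2 + 2 * (r x * u x * v x))"
    by (auto simp: algebra_simps power2_eq_square)
  then show ?thesis using integrable_L2ip[OF u v] u v by (auto simp: L2w_iff)
qed

lemma L2w_scale: assumes "u \<in> L2w r" shows "(\<lambda>x. c * u x) \<in> L2w r"
proof -
  have "(\<lambda>x. r x * (c * u x)\<^sup>2) = (\<lambda>x. c\<^sup>2 * (r x * (u x)\<^sup>2))"
    by (simp only: power_mult_distrib ac_simps)
  moreover have "(\<lambda>x. c * u x) \<in> borel_measurable I01" using L2wD[OF assms] by measurable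
  moreover have "integrable I01 (\<lambda>x. c\<^sup>2 * (r x * (u x)\<^sup>2))" using assms unfolding L2w_iff
    by (intro integrable_mult_right) simp
  ultimately show ?thesis unfolding L2w_iff by simp
qed

lemma L2w_diff: "u \<in> L2w r \<Longrightarrow> v \<in> L2w r \<Longrightarrow> (\<lambda>x. u x - v x) \<in> L2w r"
  using L2w_add[of u "\<lambda>x. (-1) * v x"] L2w_scale[of v "-1"] by simp

lemma L2w_sum: "(\<And>i. i \<in> I \<Longrightarrow> u i \<in> L2w r) \<Longrightarrow> (\<lambda>x. \<Sum>i\<in>I. u i x) \<in> L2w r"
proof (induction I rule: infinite_finite_induct)
  case (insert i I)
  then show ?case using L2w_add[of "u i" "\<lambda>x. \<Sum>i\<in>I. u i x"] by simp
qed (auto intro: L2w_continuous)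

lemma L2ip_add_right:
  assumes "u \<in> L2w r" "v \<in> L2w r" "w \<in> L2w r"
  shows "L2ip r u (\<lambda>x. v x + w x) = L2ip r u v + L2ip r u w"
  unfolding L2ip_eq using assms by (simp add: distrib_left integrable_L2ip)

lemma L2ip_diff_right:
  assumes "u \<in> L2w r" "v \<in> L2w r" "w \<in> L2w r"
  shows "L2ip r u (\<lambda>x. v x - w x) = L2ip r u v - L2ip r u w"
  unfolding L2ip_eq using assms by (simp add: right_diff_distrib integrable_L2ip)

lemma L2ip_sum_right:
  assumes "u \<in> L2w r" "\<And>i. i \<in> I \<Longrightarrow> v i \<in> L2w r"
  shows "L2ip r u (\<lambda>x. \<Sum>i\<in>I. v i x) = (\<Sum>i\<in>I. L2ip r u (v i))"
  using assms(2)
proof (induction I rule: infinite_finite_induct)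
  case (insert i I)
  then show ?case using L2ip_add_right[OF assms(1), of "v i" "\<lambda>x. \<Sum>i\<in>I. v i x"]
    by (simp add: L2w_sum)
qed (auto simp: L2ip_eq)

lemma L2ip_add_left:
  assumes "u \<in> L2w r" "v \<in> L2w r" "w \<in> L2w r"
  shows "L2ip r (\<lambda>x. v x + w x) u = L2ip r v u + L2ip r w u"
  using L2ip_add_right[OF assms] by (simp add: L2ip_commute)

lemma L2ip_diff_left:
  assumes "u \<in> L2w r" "v \<in> L2w r" "w \<in> L2w r"
  shows "L2ip r (\<lambda>x. v x - w x) u = L2ip r v u - L2ip r w u"
  using L2ip_diff_right[OF assms] by (simp add: L2ip_commute)

lemma L2ip_lincomb_right:
  assumes "u \<in> L2w r" "\<And>i. i \<in> I \<Longrightarrow> v i \<in> L2w r"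
  shows "L2ip r u (\<lambda>x. \<Sum>i\<in>I. c i * v i x) = (\<Sum>i\<in>I. c i * L2ip r u (v i))"
  using assms by (simp add: L2ip_sum_right L2w_scale L2ip_scale_right)

lemma L2ip_nonneg: "L2ip r u u \<ge> 0"
  unfolding L2ip_eq
proof (rule integral_nonneg_AE, rule AE_I2)
  fix x assume "x \<in> space I01"
  then have "0 \<le> r x * (u x)\<^sup>2" using r_pos[of x] by (intro mult_nonneg_nonneg) auto
  then show "0 \<le> r x * u x * u x" by (simp add: power2_eq_square mult.assoc)
qed

lemma L2norm_nonneg [simp]: "L2norm r u \<ge> 0"
  by (simp add: L2norm_def L2ip_nonneg)

lemma L2norm_sq: "(L2norm r u)\<^sup>2 = L2ip r u u"
  by (simp add: L2norm_def L2ip_nonneg)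

lemma L2norm_sq_add:
  assumes u: "u \<in> L2w r" and v: "v \<in> L2w r"
  shows "(L2norm r (\<lambda>x. u x + v x))\<^sup>2 = (L2norm r u)\<^sup>2 + 2 * L2ip r u v + (L2norm r v)\<^sup>2"
proof -
  have "(L2norm r (\<lambda>x. u x + v x))\<^sup>2 = L2ip r (\<lambda>x. u x + v x) u + L2ip r (\<lambda>x. u x + v x) v"
    unfolding L2norm_sq by (rule L2ip_add_right[OF L2w_add[OF u v] u v])
  also have "\<dots> = (L2ip r u u + L2ip r v u) + (L2ip r u v + L2ip r v v)"
    by (simp only: L2ip_add_left[OF u u v] L2ip_add_left[OF v u v])
  also have "L2ip r v u = L2ip r u v" by (rule L2ip_commute)
  finally show ?thesis by (simp add: L2norm_sq)
qed

lemma L2norm_scale: "L2norm r (\<lambda>x. c * u x) = \<bar>c\<bar> * L2norm r u"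
proof -
  have "L2ip r (\<lambda>x. c * u x) (\<lambda>x. c * u x) = c\<^sup>2 * L2ip r u u"
    by (subst L2ip_scale_right, subst L2ip_commute, subst L2ip_scale_right)
       (simp add: power2_eq_square)
  then show ?thesis by (simp add: L2norm_def real_sqrt_mult)
qed

lemma L2norm_minus_commute: "L2norm r (\<lambda>x. u x - v x) = L2norm r (\<lambda>x. v x - u x)"
  using L2norm_scale[of "-1" "\<lambda>x. u x - v x"] by simp

text \<open>\<open>L2ip r\<close> is only semidefinite on representatives, so the case of a null vector \<open>v\<close> is
  treated separately: there the affine function \<open>t \<mapsto> \<parallel>u + t v\<parallel>\<^sup>2\<close> is nonnegative, hence constant.\<close>

lemma L2_Cauchy_Schwarz:
  assumes u: "u \<in> L2w r" and v: "v \<in> L2w r"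
  shows "\<bar>L2ip r u v\<bar> \<le> L2norm r u * L2norm r v"
proof -
  let ?a = "(L2norm r u)\<^sup>2" and ?b = "L2ip r u v" and ?c = "(L2norm r v)\<^sup>2"
  have q: "0 \<le> ?a + 2 * t * ?b + t\<^sup>2 * ?c" for t
  proof -
    have "0 \<le> (L2norm r (\<lambda>x. u x + t * v x))\<^sup>2" by simp
    also have "\<dots> = ?a + 2 * t * ?b + t\<^sup>2 * ?c"
      by (simp add: L2norm_sq_add u v L2w_scale L2ip_scale_right L2norm_scale power_mult_distrib)
    finally show ?thesis .
  qed
  have "?b\<^sup>2 \<le> ?a * ?c"
  proof (cases "?c = 0")
    case True
    have "?b = 0"
    proof (rule ccontr)
      assume "?b \<noteq> 0"
      then show False using q[of "- (?a + 1) / (2 * ?b)"] True by (simp add: field_simps)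
    qed
    then show ?thesis by simp
  next
    case False
    then have c: "?c > 0" by (simp add: less_le)
    have "0 \<le> ?a + 2 * (- ?b / ?c) * ?b + (- ?b / ?c)\<^sup>2 * ?c" by (rule q)
    also have "\<dots> = ?a - ?b\<^sup>2 / ?c" using c by (simp add: field_simps power2_eq_square)
    finally show ?thesis using c by (simp add: field_simps)
  qed
  then have "\<bar>?b\<bar>\<^sup>2 \<le> (L2norm r u * L2norm r v)\<^sup>2" by (simp add: power_mult_distrib)
  then show ?thesis by (rule power2_le_imp_le) simp
qed

lemma L2norm_triangle:
  assumes u: "u \<in> L2w r" and v: "v \<in> L2w r"
  shows "L2norm r (\<lambda>x. u x + v x) \<le> L2norm r u + L2norm r v"
proof (rule power2_le_imp_le)
  show "(L2norm r (\<lambda>x. u x + v x))\<^sup>2 \<le> (L2norm r u + L2norm r v)\<^sup>2"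
    using L2_Cauchy_Schwarz[OF u v] unfolding L2norm_sq_add[OF u v]
    by (simp add: power2_sum)
qed simp

lemma L2norm_diff_le:
  assumes u: "u \<in> L2w r" and v: "v \<in> L2w r"
  shows "\<bar>L2norm r u - L2norm r v\<bar> \<le> L2norm r (\<lambda>x. u x - v x)"
proof -
  have "L2norm r u \<le> L2norm r (\<lambda>x. u x - v x) + L2norm r v"
    using L2norm_triangle[OF L2w_diff[OF u v] v] by simp
  moreover have "L2norm r v \<le> L2norm r (\<lambda>x. v x - u x) + L2norm r u"
    using L2norm_triangle[OF L2w_diff[OF v u] u] by simp
  ultimately show ?thesis using L2norm_minus_commute[of u v] by linarith
qed

lemma L2norm_sq_orth_sum:
  assumes "\<And>i. i \<in> I \<Longrightarrow> v i \<in> L2w r" "finite I"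
    and orth: "\<And>i j. i \<in> I \<Longrightarrow> j \<in> I \<Longrightarrow> i \<noteq> j \<Longrightarrow> L2ip r (v i) (v j) = 0"
  shows "(L2norm r (\<lambda>x. \<Sum>i\<in>I. c i * v i x))\<^sup>2 = (\<Sum>i\<in>I. (c i)\<^sup>2 * (L2norm r (v i))\<^sup>2)"
proof -
  have m: "(\<lambda>x. \<Sum>i\<in>I. c i * v i x) \<in> L2w r" using assms(1) by (intro L2w_sum L2w_scale)
  have "L2ip r (\<lambda>x. \<Sum>i\<in>I. c i * v i x) (v j) = c j * (L2norm r (v j))\<^sup>2" if j: "j \<in> I" for j
  proof -
    have "L2ip r (\<lambda>x. \<Sum>i\<in>I. c i * v i x) (v j) = (\<Sum>i\<in>I. c i * L2ip r (v j) (v i))"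
      using assms(1) j by (subst L2ip_commute) (simp add: L2ip_lincomb_right)
    also have "\<dots> = (\<Sum>i\<in>I. if i = j then c j * (L2norm r (v j))\<^sup>2 else 0)"
      using orth j by (intro sum.cong) (auto simp: L2norm_sq)
    finally show ?thesis using j assms(2) by simp
  qed
  then show ?thesis unfolding L2norm_sq[of "\<lambda>x. \<Sum>i\<in>I. c i * v i x"]
    by (subst L2ip_lincomb_right[OF m assms(1)]) (auto simp: power2_eq_square algebra_simps intro: sum.cong)
qed

text \<open>Young's inequality applied to the mixed term. Used with \<open>\<epsilon> = \<kappa> N\<close>, it is the origin of the
  factors \<open>1 + \<kappa> N\<close> and \<open>1 + 1 / \<kappa>\<close>, the latter as a bound of \<open>1 + 1 / (\<kappa> N)\<close>.\<close>

lemma L2norm_sq_add_weighted: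
  assumes u: "u \<in> L2w r" and v: "v \<in> L2w r" and "\<epsilon> > 0"
  shows "(L2norm r (\<lambda>x. u x + v x))\<^sup>2 \<le> (1 + \<epsilon>) * (L2norm r u)\<^sup>2 + (1 + 1 / \<epsilon>) * (L2norm r v)\<^sup>2"
proof -
  have "0 \<le> (sqrt \<epsilon> * L2norm r u - L2norm r v / sqrt \<epsilon>)\<^sup>2" by simp
  also have "\<dots> = \<epsilon> * (L2norm r u)\<^sup>2 - 2 * L2norm r u * L2norm r v + (L2norm r v)\<^sup>2 / \<epsilon>"
    using \<open>\<epsilon> > 0\<close> by (simp add: power2_diff power_mult_distrib power_divide)
  finally show ?thesis
    using L2_Cauchy_Schwarz[OF u v] unfolding L2norm_sq_add[OF u v] by (simp add: algebra_simps)
qed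

end

section \<open>Projection onto finitely many orthonormal functions\<close>

locale orthonormal_L2 = weighted_L2 +
  fixes \<phi> :: "nat \<Rightarrow> real \<Rightarrow> real"
  assumes phi_L2: "\<And>n. n \<ge> 1 \<Longrightarrow> \<phi> n \<in> L2w r"
    and phi_norm: "\<And>n. n \<ge> 1 \<Longrightarrow> L2norm r (\<phi> n) = 1"
    and phi_orth: "\<And>n m. n \<ge> 1 \<Longrightarrow> m \<ge> 1 \<Longrightarrow> n \<noteq> m \<Longrightarrow> L2ip r (\<phi> n) (\<phi> m) = 0"
begin

lemma proj_L2: "proj r \<phi> N w \<in> L2w r"
  unfolding proj_def by (intro L2w_sum L2w_scale phi_L2) auto

lemma tail_L2: "w \<in> L2w r \<Longrightarrow> (\<lambda>x. w x - proj r \<phi> N w x) \<in> L2w r"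
  by (intro L2w_diff proj_L2)

lemma L2ip_proj:
  assumes "w \<in> L2w r"
  shows "L2ip r w (proj r \<phi> N u) = (\<Sum>n=1..N. L2ip r (\<phi> n) u * L2ip r (\<phi> n) w)"
  unfolding proj_def using assms
  by (subst L2ip_lincomb_right) (auto simp: phi_L2 L2ip_commute intro!: sum.cong)

lemma L2ip_phi_proj:
  assumes "m \<in> {1..N}"
  shows "L2ip r (\<phi> m) (proj r \<phi> N w) = L2ip r (\<phi> m) w"
proof -
  have "L2ip r (\<phi> m) (proj r \<phi> N w) = (\<Sum>n=1..N. L2ip r (\<phi> n) w * L2ip r (\<phi> n) (\<phi> m))"
    using assms by (intro L2ip_proj phi_L2) simp
  also have "\<dots> = (\<Sum>n=1..N. if n = m then L2ip r (\<phi> n) w else 0)"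
    using assms phi_orth[of _ m] phi_norm[of m] L2norm_sq[of "\<phi> m"] by (intro sum.cong) auto
  finally show ?thesis using assms by simp
qed

lemma L2ip_phi_tail:
  assumes "m \<in> {1..N}" "w \<in> L2w r"
  shows "L2ip r (\<phi> m) (\<lambda>x. w x - proj r \<phi> N w x) = 0"
  using assms by (simp add: L2ip_diff_right phi_L2 proj_L2 L2ip_phi_proj)

lemma L2ip_tail_proj:
  assumes "w \<in> L2w r"
  shows "L2ip r (\<lambda>x. w x - proj r \<phi> N w x) (proj r \<phi> N u) = 0"
  using assms by (subst L2ip_proj) (auto simp: tail_L2 L2ip_phi_tail)

text \<open>\<open>w - P w\<close> is orthogonal to the range of \<open>P\<close>, so the projection in the second argument can
  be dropped.\<close>

lemma L2ip_tail_tail: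
  assumes "w \<in> L2w r" "u \<in> L2w r"
  shows "L2ip r (\<lambda>x. w x - proj r \<phi> N w x) (\<lambda>x. u x - proj r \<phi> N u x)
       = L2ip r (\<lambda>x. w x - proj r \<phi> N w x) u"
  using assms by (simp add: L2ip_diff_right tail_L2 proj_L2 L2ip_tail_proj)

lemma L2ip_tail:
  assumes "w \<in> L2w r" "u \<in> L2w r"
  shows "L2ip r (\<lambda>x. w x - proj r \<phi> N w x) u
       = L2ip r w u - (\<Sum>n=1..N. L2ip r (\<phi> n) w * L2ip r (\<phi> n) u)"
  using assms L2ip_proj[of u N w]
  by (simp add: L2ip_diff_left proj_L2 L2ip_commute[of r "proj r \<phi> N w" u])

lemma L2norm_sq_tail:
  assumes "w \<in> L2w r"
  shows "(L2norm r (\<lambda>x. w x - proj r \<phi> N w x))\<^sup>2 = (L2norm r w)\<^sup>2 - (\<Sum>n=1..N. (L2ip r (\<phi> n) w)\<^sup>2)"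
  unfolding L2norm_sq using assms
  by (simp add: L2ip_tail_tail L2ip_tail power2_eq_square)

end

section \<open>Weak derivatives on the unit interval\<close>

lemma Ck1_has_derivative:
  assumes "Ck_on 1 {0..1} f" "x \<in> {0..1}"
  shows "(f has_real_derivative D1 f x) (at x within {0..1})"
proof -
  have "f differentiable (at x within {0..1})"
    using assms by (simp add: differentiable_on_def)
  then show ?thesis
    by (simp add: vector_derivative_works deriv_in_def has_real_derivative_iff_has_vector_derivative)
qed

lemma Ck1_continuous: "Ck_on 1 S f \<Longrightarrow> continuous_on S f"
  by (simp add: differentiable_imp_continuous_on)

lemma Ck1_deriv_continuous: "Ck_on 1 S f \<Longrightarrow> continuous_on S (deriv_in S f)"
  by simp

lemma Ck1_has_integral:
  assumes "Ck_on 1 {0..1} f" "0 \<le> x" "x \<le> y" "y \<le> 1"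
  shows "(D1 f has_integral f y - f x) {x..y}"
  using assms
  by (intro fundamental_theorem_of_calculus)
     (auto simp flip: has_real_derivative_iff_has_vector_derivative
       intro: has_field_derivative_subset[OF Ck1_has_derivative])

lemma Ck1_Lipschitz:
  assumes f: "Ck_on 1 {0..1} f" and C: "\<And>s. s \<in> {0..1} \<Longrightarrow> \<bar>D1 f s\<bar> \<le> C"
    and "0 \<le> x" "x \<le> y" "y \<le> 1"
  shows "\<bar>f y - f x\<bar> \<le> C * (y - x)"
proof -
  have "norm (f y - f x) \<le> C * norm (y - x)"
    using assms by (intro field_differentiable_bound[OF convex_real_interval(5)[of 0 1] Ck1_has_derivative]) auto
  then show ?thesis using assms by simp
qed

text \<open>The Henstock-Kurzweil integral gives access to the library on indefinite integrals.\<close>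

lemma has_weak_deriv_iff:
  "has_weak_deriv h g \<longleftrightarrow> g absolutely_integrable_on {0..1} \<and>
     (\<forall>x\<in>{0..1}. h x = h 0 + integral {0..x} g)"
proof -
  have "(LINT s:{0..x}|lebesgue. g s) = integral {0..x} g"
    if "g absolutely_integrable_on {0..1}" "x \<in> {0..1}" for x
    using that by (intro set_lebesgue_integral_eq_integral set_integrable_subset[OF that(1)]) auto
  then show ?thesis unfolding has_weak_deriv_def by auto
qed

lemma has_weak_deriv_continuous:
  assumes "has_weak_deriv h g"
  shows "continuous_on {0..1} h"
proof -
  have "continuous_on {0..1} (\<lambda>x. h 0 + integral {0..x} g)"
    using assms unfolding has_weak_deriv_iff
    by (intro continuous_intros indefinite_integral_continuous_1)
       (auto intro: set_lebesgue_integral_eq_integral)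
  then show ?thesis using assms unfolding has_weak_deriv_iff by (metis (no_types, lifting) continuous_on_cong)
qed

text \<open>The function \<open>h\<close> is only absolutely continuous, so no pointwise product rule is at hand.
  Instead, the defect \<open>\<Psi>(x) = h(x) k(x) - \<integral>\<^sub>0\<^sup>x (g k + h k')\<close> satisfies, on an interval \<open>[x, y]\<close>,
  \<open>\<Psi>(y) - \<Psi>(x) = \<integral>\<^sub>x\<^sup>y g(s) (k(y) - k(s)) ds - \<integral>\<^sub>x\<^sup>y (h(s) - h(x)) k'(s) ds\<close>. Both integrals are at
  most \<open>C (y - x) \<integral>\<^sub>x\<^sup>y \<bar>g\<bar>\<close> with \<open>C\<close> a bound of \<open>\<bar>k'\<bar>\<close>, and the last factor tends to 0 with the length
  of the interval. Thus \<open>\<Psi>\<close> has derivative 0 at every point and is constant.\<close>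

lemma has_weak_deriv_mult:
  assumes h: "has_weak_deriv h g" and k: "Ck_on 1 {0..1} k"
  shows "has_weak_deriv (\<lambda>x. h x * k x) (\<lambda>s. g s * k s + h s * D1 k s)"
proof -
  let ?f = "\<lambda>s. g s * k s + h s * D1 k s"
  have g: "g absolutely_integrable_on {0..1}" and hg: "\<And>x. x \<in> {0..1} \<Longrightarrow> h x = h 0 + integral {0..x} g"
    using h unfolding has_weak_deriv_iff by blast+
  note kc = Ck1_continuous[OF k] and k'c = Ck1_deriv_continuous[OF k]
  note hc = has_weak_deriv_continuous[OF h]
  have "(\<lambda>s. k s * g s) absolutely_integrable_on {0..1}"
    using compact_continuous_image[OF kc] g borel_measurable_I01_continuous[OF kc]
    by (intro absolutely_integrable_bounded_measurable_product_real) (auto simp: compact_imp_bounded)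
  moreover have "(\<lambda>s. h s * D1 k s) absolutely_integrable_on {0..1}"
    by (intro absolutely_integrable_continuous_real continuous_intros hc k'c)
  ultimately have f: "?f absolutely_integrable_on {0..1}"
    by (auto simp: mult.commute intro: set_integral_add)
  have gi: "g integrable_on {0..1}" and fi: "?f integrable_on {0..1}"
    using g f by (auto intro: set_lebesgue_integral_eq_integral)
  define ag where "ag s = \<bar>g s\<bar>" for s
  have agi: "ag integrable_on {0..1}"
    using g unfolding ag_def absolutely_integrable_on_def by simp
  have int_sub: "u integrable_on {x..y}" if "u integrable_on {0..1}" "0 \<le> x" "y \<le> 1" for u :: "real \<Rightarrow> real" and x y
    using integrable_subinterval_real[OF that(1)] that(2,3) by auto
  have comb: "integral {0..y} u - integral {0..x} u = integral {x..y} u"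
    if "u integrable_on {0..1}" "0 \<le> x" "x \<le> y" "y \<le> 1" for u :: "real \<Rightarrow> real" and x y
    using Henstock_Kurzweil_Integration.integral_combine[of 0 x y u] int_sub[OF that(1), of 0 y] that by simp
  have hdiff: "h y - h x = integral {x..y} g" if xy: "0 \<le> x" "x \<le> y" "y \<le> 1" for x y
  proof -
    have "x \<in> {0..1}" "y \<in> {0..1}" using xy by auto
    then show ?thesis using comb[OF gi xy] hg[of x] hg[of y] by linarith
  qed
  obtain C where C: "\<And>s. s \<in> {0..1} \<Longrightarrow> \<bar>D1 k s\<bar> \<le> C"
  proof -
    have "bounded (D1 k ` {0..1})" using k'c by (intro compact_imp_bounded compact_continuous_image) auto
    then show thesis using that unfolding bounded_iff by (metis imageI real_norm_def)
  qed
  have C0: "C \<ge> 0" using C[of 0] by simp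
  define G where "G x = integral {0..x} ag" for x
  have Gc: "continuous_on {0..1} G"
    unfolding G_def using agi by (rule indefinite_integral_continuous_1)
  define \<Psi> where "\<Psi> x = h x * k x - integral {0..x} ?f" for x
  have est: "\<bar>\<Psi> y - \<Psi> x\<bar> \<le> 2 * C * (y - x) * (G y - G x)" if xy: "0 \<le> x" "x \<le> y" "y \<le> 1" for x y
  proof -
    have Gxy: "integral {x..y} ag = G y - G x"
      unfolding G_def by (rule comb[OF agi xy, symmetric])
    note hxy = hdiff[OF xy]
    have I: "((\<lambda>s. k y * g s - ?f s + h x * D1 k s) has_integral
        k y * (h y - h x) - integral {x..y} ?f + h x * (k y - k x)) {x..y}"
      unfolding hxy
      by (intro has_integral_add has_integral_diff has_integral_mult_right integrable_integral
          int_sub[OF gi] int_sub[OF fi] Ck1_has_integral k xy)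
    have B: "((\<lambda>s. C * (y - x) * ag s + C * (G y - G x)) has_integral
        C * (y - x) * (G y - G x) + (y - x) *\<^sub>R (C * (G y - G x))) {x..y}"
      unfolding Gxy[symmetric]
      using has_integral_const_real[of "C * integral {x..y} ag" x y] xy
      by (intro has_integral_add has_integral_mult_right integrable_integral int_sub[OF agi]) auto
    have "norm (integral {x..y} (\<lambda>s. k y * g s - ?f s + h x * D1 k s))
        \<le> integral {x..y} (\<lambda>s. C * (y - x) * ag s + C * (G y - G x))"
    proof (rule integral_norm_bound_integral)
      fix s assume s: "s \<in> {x..y}"
      then have s01: "0 \<le> s" "s \<le> 1" using xy by auto
      have "\<bar>k y - k s\<bar> \<le> C * (y - s)"
        using s s01 xy by (intro Ck1_Lipschitz[OF k C]) auto
      also have "\<dots> \<le> C * (y - x)" using s C0 by (intro mult_left_mono) auto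
      finally have 1: "ag s * \<bar>k y - k s\<bar> \<le> ag s * (C * (y - x))"
        by (intro mult_left_mono) (auto simp: ag_def)
      have "h s - h x = integral {x..s} g"
        using xy s by (intro hdiff) auto
      also have "\<bar>\<dots>\<bar> \<le> integral {x..s} ag"
        using xy s s01 int_sub[OF gi, of x s] int_sub[OF agi, of x s]
        by (subst real_norm_def[symmetric], intro integral_norm_bound_integral) (auto simp: ag_def)
      also have "\<dots> \<le> integral {x..y} ag"
        using xy s s01 by (intro integral_subset_le int_sub[OF agi]) (auto simp: ag_def)
      finally have "\<bar>h s - h x\<bar> \<le> G y - G x" unfolding Gxy .
      then have 2: "\<bar>h s - h x\<bar> * \<bar>D1 k s\<bar> \<le> (G y - G x) * C"
        using C[of s] s01 by (intro mult_mono) auto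
      have "k y * g s - ?f s + h x * D1 k s = g s * (k y - k s) - (h s - h x) * D1 k s"
        by (simp add: algebra_simps)
      also have "\<bar>\<dots>\<bar> \<le> ag s * \<bar>k y - k s\<bar> + \<bar>h s - h x\<bar> * \<bar>D1 k s\<bar>"
        unfolding ag_def abs_mult[symmetric] by (rule abs_triangle_ineq4)
      finally show "norm (k y * g s - ?f s + h x * D1 k s) \<le> C * (y - x) * ag s + C * (G y - G x)"
        using 1 2 by (simp add: mult.commute mult.left_commute)
    qed (use I B in \<open>auto simp: integrable_on_def\<close>)
    moreover have "\<Psi> y - \<Psi> x = k y * (h y - h x) - integral {x..y} ?f + h x * (k y - k x)"
      unfolding \<Psi>_def using comb[OF fi xy] by (simp add: algebra_simps)
    ultimately show ?thesis
      unfolding integral_unique[OF I] integral_unique[OF B] by (simp add: algebra_simps)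
  qed
  have "\<exists>c. \<forall>x\<in>{0..1}. \<Psi> x = c"
  proof (rule has_field_derivative_zero_constant)
    fix x :: real assume x: "x \<in> {0..1}"
    have q: "\<bar>(\<Psi> y - \<Psi> x) / (y - x)\<bar> \<le> 2 * C * \<bar>G y - G x\<bar>" if y: "y \<in> {0..1}" "y \<noteq> x" for y
    proof -
      have "\<bar>\<Psi> y - \<Psi> x\<bar> \<le> 2 * C * \<bar>y - x\<bar> * \<bar>G y - G x\<bar>"
      proof (cases "x \<le> y")
        case True
        have "\<bar>\<Psi> y - \<Psi> x\<bar> \<le> 2 * C * (y - x) * (G y - G x)" using est[of x y] True x y by simp
        also have "\<dots> \<le> 2 * C * (y - x) * \<bar>G y - G x\<bar>" using C0 True by (intro mult_left_mono) auto
        finally show ?thesis using True by simp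
      next
        case False
        have "\<bar>\<Psi> y - \<Psi> x\<bar> \<le> 2 * C * (x - y) * (G x - G y)" using est[of y x] False x y by simp
        also have "\<dots> \<le> 2 * C * (x - y) * \<bar>G y - G x\<bar>" using C0 False by (intro mult_left_mono) auto
        finally show ?thesis using False by simp
      qed
      then show ?thesis using y by (simp add: abs_divide field_simps)
    qed
    have "((\<lambda>y. 2 * C * \<bar>G y - G x\<bar>) \<longlongrightarrow> 0) (at x within {0..1})"
    proof -
      have "((\<lambda>y. 2 * C * \<bar>G y - G x\<bar>) \<longlongrightarrow> 2 * C * \<bar>G x - G x\<bar>) (at x within {0..1})"
        using Gc x unfolding continuous_on_def by (intro tendsto_intros) auto
      then show ?thesis by simp
    qed
    moreover have "\<forall>\<^sub>F y in at x within {0..1}. norm ((\<Psi> y - \<Psi> x) / (y - x)) \<le> 2 * C * \<bar>G y - G x\<bar>"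
      unfolding eventually_at_filter real_norm_def using q by (intro always_eventually allI impI)
    ultimately have "((\<lambda>y. (\<Psi> y - \<Psi> x) / (y - x)) \<longlongrightarrow> 0) (at x within {0..1})"
      by (rule Lim_null_comparison[rotated])
    then show "(\<Psi> has_field_derivative 0) (at x within {0..1})"
      by (simp add: has_field_derivative_iff)
  qed simp
  then obtain c where c: "\<And>x. x \<in> {0..1} \<Longrightarrow> \<Psi> x = c" by blast
  have "h x * k x = h 0 * k 0 + integral {0..x} ?f" if x: "x \<in> {0..1}" for x
    using c[OF x] c[of 0] by (simp add: \<Psi>_def)
  then show ?thesis unfolding has_weak_deriv_iff using f by blast
qed

text \<open>The sets over which \<open>d\<close> integrates to 0 contain all intervals and are closed under
  complements and disjoint unions, hence they include all Borel sets. Then the density \<open>d\<close> is null.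
  The Lebesgue measurable \<open>d\<close> is first replaced by a Borel measurable function, because the induction
  over sets reaches Borel sets only.\<close>

lemma AE_zero_if_integrals_vanish:
  assumes d: "d absolutely_integrable_on {0..1::real}"
    and zero: "\<And>x. x \<in> {0..1} \<Longrightarrow> integral {0..x} d = 0"
  shows "AE x in I01. d x = (0::real)"
proof -
  let ?f = "\<lambda>x. indicator {0..1} x * d x"
  have f: "integrable lebesgue ?f" using d by (simp add: set_integrable_def)
  obtain f' where f'm: "f' \<in> borel_measurable lborel" and f': "AE x in lborel. ?f x = f' x"
    using completion_ex_borel_measurable_real[of ?f lborel] f by auto
  have AE: "AE x in lebesgue. ?f x = f' x" using f' by (rule AE_completion)
  have f'L: "f' \<in> borel_measurable lebesgue" using f'm by (rule measurable_completion)
  have "integrable lebesgue f'" using f AE f'L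
    by (subst integrable_cong_AE[symmetric]) auto
  then have f'i: "integrable lborel f'" using f'm by (simp add: integrable_completion)
  have di: "d integrable_on {0..1}" using d by (auto intro: set_lebesgue_integral_eq_integral)
  have sub: "integral {a..b} d = 0" if "0 \<le> a" "a \<le> b" "b \<le> 1" for a b
    using Henstock_Kurzweil_Integration.integral_combine[of 0 a b d] zero[of a] zero[of b] that
      integrable_subinterval_real[OF di, of 0 b] by simp
  have int: "set_lebesgue_integral lborel {a..b} f' = 0" for a b
  proof -
    have "set_lebesgue_integral lborel {a..b} f' = (\<integral>x. indicator {a..b} x * f' x \<partial>lebesgue)"
      using f'm unfolding set_lebesgue_integral_def
      by (subst integral_completion) auto
    also have "\<dots> = (\<integral>x. indicator {a..b} x * ?f x \<partial>lebesgue)"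
    proof (rule integral_cong_AE)
      show "(\<lambda>x. indicator {a..b} x * f' x) \<in> borel_measurable lebesgue"
        using f'L
        by (intro borel_measurable_times borel_measurable_indicator) auto
      show "(\<lambda>x. indicator {a..b} x * ?f x) \<in> borel_measurable lebesgue"
        by (rule borel_measurable_times[OF borel_measurable_indicator borel_measurable_integrable[OF f]]) simp
      show "AE x in lebesgue. indicator {a..b} x * f' x = indicator {a..b} x * ?f x"
        using AE by eventually_elim simp
    qed
    also have "\<dots> = (LINT x:{max a 0..min b 1}|lebesgue. d x)"
      unfolding set_lebesgue_integral_def by (intro Bochner_Integration.integral_cong) (auto simp: indicator_def)
    also have "\<dots> = integral {max a 0..min b 1} d"
      using d by (intro set_lebesgue_integral_eq_integral set_integrable_subset[OF d]) auto
    also have "\<dots> = 0" using sub[of "max a 0" "min b 1"]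
      by (cases "max a 0 \<le> min b 1") auto
    finally show ?thesis .
  qed
  have f'iA: "set_integrable lborel A f'" if "A \<in> sets borel" for A
    using f'i that unfolding set_integrable_def by (intro integrable_mult_indicator) auto
  have UN: "set_lebesgue_integral lborel UNIV f' = 0"
  proof -
    have "set_lebesgue_integral lborel UNIV f' = (\<integral>x. f' x \<partial>lebesgue)"
      using f'm unfolding set_lebesgue_integral_def by (simp add: integral_completion)
    also have "\<dots> = (\<integral>x. ?f x \<partial>lebesgue)"
      using f AE f'L by (intro integral_cong_AE) auto
    also have "\<dots> = (LINT x:{0..1}|lebesgue. d x)" by (simp add: set_lebesgue_integral_def)
    also have "\<dots> = 0" using d zero[of 1] by (simp add: set_lebesgue_integral_eq_integral)
    finally show ?thesis .
  qed
  have "set_lebesgue_integral lborel A f' = 0" if "A \<in> sets borel" for A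
    using that
  proof (induction rule: borel_set_induct)
    case (compl A)
    have "set_lebesgue_integral lborel (A \<union> - A) f' = set_lebesgue_integral lborel A f' + set_lebesgue_integral lborel (- A) f'"
      using compl(1) by (intro set_integral_Un f'iA) auto
    then show ?case using UN compl by (simp add: Un_commute Compl_partition)
  next
    case (union A)
    have "set_lebesgue_integral lborel (\<Union>i. A i) f' = (\<Sum>i. set_lebesgue_integral lborel (A i) f')"
      using union f'iA by (intro lebesgue_integral_countable_add) (auto simp: disjoint_family_on_def)
    then show ?case using union by simp
  qed (use int in \<open>auto simp: set_lebesgue_integral_def\<close>)
  then have "AE x in lborel. f' x = 0" using f'i by (intro sigma_finite_measure.density_zero[OF lborel.sigma_finite_measure_axioms]) auto
  with f' have "AE x in lborel. ?f x = 0" by eventually_elim simp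
  then have "AE x in lebesgue. ?f x = 0" by (rule AE_completion)
  then show ?thesis unfolding AE_I01_iff by eventually_elim auto
qed

text \<open>\<open>weak_deriv\<close> is a choice among representatives. Uniqueness shows that the choice inherits
  square integrability from any other representative.\<close>

lemma has_weak_deriv_unique:
  assumes "has_weak_deriv h g1" "has_weak_deriv h g2"
  shows "AE x in I01. g1 x = g2 x"
proof -
  have g: "g1 absolutely_integrable_on {0..1}" "g2 absolutely_integrable_on {0..1}"
    using assms unfolding has_weak_deriv_iff by blast+
  have i: "g1 integrable_on {0..1}" "g2 integrable_on {0..1}"
    using g by (auto intro: set_lebesgue_integral_eq_integral)
  have "AE x in I01. g1 x - g2 x = 0"
  proof (rule AE_zero_if_integrals_vanish)
    fix x :: real assume x: "x \<in> {0..1}"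
    have "g1 integrable_on {0..x}" "g2 integrable_on {0..x}"
      using x integrable_subinterval_real[OF i(1), of 0 x] integrable_subinterval_real[OF i(2), of 0 x] by auto
    moreover have "h x = h 0 + integral {0..x} g1" "h x = h 0 + integral {0..x} g2"
      using assms x unfolding has_weak_deriv_iff by blast+
    ultimately show "integral {0..x} (\<lambda>x. g1 x - g2 x) = 0"
      by (simp add: Henstock_Kurzweil_Integration.integral_diff)
  qed (use g in \<open>auto intro: set_integral_diff\<close>)
  then show ?thesis by eventually_elim simp
qed

section \<open>The Sturm-Liouville operator\<close>

lemma integrable_I01_mult_continuous:
  fixes f c :: "real \<Rightarrow> real"
  assumes f: "integrable I01 f" and c: "continuous_on {0..1} c"
  shows "integrable I01 (\<lambda>x. c x * f x)"
proof -
  have "f absolutely_integrable_on {0..1}"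
    using f by (simp add: set_integrable_def integrable_restrict_space)
  then have "(\<lambda>x. c x * f x) absolutely_integrable_on {0..1}"
    using compact_continuous_image[OF c] borel_measurable_I01_continuous[OF c]
    by (intro absolutely_integrable_bounded_measurable_product_real) (auto simp: compact_imp_bounded)
  then show ?thesis by (simp add: set_integrable_def integrable_restrict_space)
qed

lemma has_weak_deriv_integrable: "has_weak_deriv h g \<Longrightarrow> integrable I01 g"
  unfolding has_weak_deriv_def by (simp add: set_integrable_def integrable_restrict_space)

lemma has_weak_deriv_increment:
  assumes "has_weak_deriv h g"
  shows "(\<integral>x. g x \<partial>I01) = h 1 - h 0"
proof -
  have "\<forall>x\<in>{0..1}. h x = h 0 + (LINT s:{0..x}|lebesgue. g s)"
    using assms unfolding has_weak_deriv_def by blast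
  then have "h 1 = h 0 + (LINT s:{0..1}|lebesgue. g s)"
    by (rule bspec) simp
  then show ?thesis by (simp add: set_lebesgue_integral_def integral_restrict_space)
qed

lemma has_weak_deriv_weak_deriv: "has_weak_deriv h g \<Longrightarrow> has_weak_deriv h (weak_deriv h)"
  unfolding weak_deriv_def by (rule someI[of "has_weak_deriv h"])

interpretation unweighted: weighted_L2 "\<lambda>_. 1"
  by unfold_locales auto

lemma L2w_one_iff: "u \<in> L2w (\<lambda>_. 1) \<longleftrightarrow> u \<in> borel_measurable I01 \<and> integrable I01 (\<lambda>x. (u x)\<^sup>2)"
  by (simp add: L2w_iff)

lemma L2w_one_mult_continuous:
  assumes u: "u \<in> L2w (\<lambda>_. 1)" and c: "continuous_on {0..1} c"
  shows "(\<lambda>x. c x * u x) \<in> L2w (\<lambda>_. 1)"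
  unfolding L2w_one_iff power_mult_distrib
proof
  show "(\<lambda>x. c x * u x) \<in> borel_measurable I01"
    using u unfolding L2w_one_iff by (intro borel_measurable_times[OF borel_measurable_I01_continuous[OF c]]) auto
  show "integrable I01 (\<lambda>x. (c x)\<^sup>2 * (u x)\<^sup>2)"
    using u c unfolding L2w_one_iff by (intro integrable_I01_mult_continuous continuous_intros) auto
qed

lemma (in weighted_L2) L2w_one_subset: "u \<in> L2w (\<lambda>_. 1) \<Longrightarrow> u \<in> L2w r"
  unfolding L2w_iff using integrable_I01_mult_continuous[OF _ r_cont] by simp

lemma L2w_one_cong_AE:
  assumes "u \<in> L2w (\<lambda>_. 1)" "v \<in> borel_measurable I01" "AE x in I01. v x = u x"
  shows "v \<in> L2w (\<lambda>_. 1)"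
proof -
  have u: "u \<in> borel_measurable I01" "integrable I01 (\<lambda>x. (u x)\<^sup>2)" using assms(1) by (auto simp: L2w_one_iff)
  have "AE x in I01. (v x)\<^sup>2 = (u x)\<^sup>2" using assms(3) by eventually_elim simp
  then have "integrable I01 (\<lambda>x. (v x)\<^sup>2) \<longleftrightarrow> integrable I01 (\<lambda>x. (u x)\<^sup>2)"
    using u(1) assms(2) by (intro integrable_cong_AE borel_measurable_power) auto
  then show ?thesis using u(2) assms(2) unfolding L2w_one_iff by simp
qed

lemma H2D:
  assumes "w \<in> H2"
  shows "Ck_on 1 {0..1} w" "\<exists>g\<in>L2w (\<lambda>_. 1). has_weak_deriv (D1 w) g"
  using assms unfolding H2_def by blast+

lemma H2_continuous: "w \<in> H2 \<Longrightarrow> continuous_on {0..1} w"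
  by (intro Ck1_continuous H2D)

lemma SL_domD:
  assumes "w \<in> SL_dom a1 a2 b1 b2"
  shows "w \<in> H2" "b1 * w 0 + b2 * D1 w 0 = 0" "a1 * w 1 + a2 * D1 w 1 = 0"
  using assms unfolding SL_dom_def by blast+

text \<open>Two vectors that are orthogonal to the same nonzero vector \<open>(c1, c2)\<close> of the plane are
  parallel. This makes the boundary terms in Green's formula vanish.\<close>

lemma boundary_wronskian_zero:
  fixes c1 c2 u u' v v' :: real
  assumes "c1\<^sup>2 + c2\<^sup>2 = 1" "c1 * u + c2 * u' = 0" "c1 * v + c2 * v' = 0"
  shows "u * v' = v * u'"
proof -
  have "u * v' - v * u' = (c1\<^sup>2 + c2\<^sup>2) * (u * v' - v * u')" using assms(1) by simp
  also have "\<dots> = (c1 * u + c2 * u') * (c1 * v' - c2 * v) - (c1 * v + c2 * v') * (c1 * u' - c2 * u)"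
    by (simp add: algebra_simps power2_eq_square)
  finally show ?thesis using assms by simp
qed

locale sturm_liouville = weighted_L2 r for r :: "real \<Rightarrow> real" +
  fixes p q :: "real \<Rightarrow> real" and a1 a2 b1 b2 :: real
  assumes p_C1: "Ck_on 1 {0..1} p" and q_cont: "continuous_on {0..1} q"
    and a_norm: "a1\<^sup>2 + a2\<^sup>2 = 1" and b_norm: "b1\<^sup>2 + b2\<^sup>2 = 1"
begin

abbreviation flux_deriv :: "(real \<Rightarrow> real) \<Rightarrow> real \<Rightarrow> real" where
  "flux_deriv w \<equiv> weak_deriv (\<lambda>s. p s * D1 w s)"

text \<open>For \<open>w \<in> H\<^sup>2\<close> the product rule produces the weak derivative \<open>p w'' + p' w'\<close> of the flux \<open>p w'\<close>,
  which is visibly square integrable; the chosen representative agrees with it almost everywhere.\<close>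

lemma flux_weak_deriv:
  assumes "w \<in> H2"
  shows "has_weak_deriv (\<lambda>s. p s * D1 w s) (flux_deriv w)" "flux_deriv w \<in> L2w (\<lambda>_. 1)"
proof -
  obtain g where g: "g \<in> L2w (\<lambda>_. 1)" "has_weak_deriv (D1 w) g" using H2D(2)[OF assms] by blast
  have hw: "has_weak_deriv (\<lambda>s. p s * D1 w s) (\<lambda>s. p s * g s + D1 w s * D1 p s)"
    using has_weak_deriv_mult[OF g(2) p_C1] by (simp add: mult.commute)
  then show wd: "has_weak_deriv (\<lambda>s. p s * D1 w s) (flux_deriv w)"
    by (rule has_weak_deriv_weak_deriv)
  have "(\<lambda>s. D1 w s * D1 p s) \<in> L2w (\<lambda>_. 1)"
    using Ck1_deriv_continuous[OF p_C1] Ck1_deriv_continuous[OF H2D(1)[OF assms]]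
    by (intro unweighted.L2w_continuous continuous_intros)
  then have "(\<lambda>s. p s * g s + D1 w s * D1 p s) \<in> L2w (\<lambda>_. 1)"
    by (rule unweighted.L2w_add[OF L2w_one_mult_continuous[OF g(1) Ck1_continuous[OF p_C1]]])
  then show "flux_deriv w \<in> L2w (\<lambda>_. 1)"
    by (rule L2w_one_cong_AE[OF _ _ has_weak_deriv_unique[OF wd hw]])
       (rule borel_measurable_integrable[OF has_weak_deriv_integrable[OF wd]])
qed

lemma SL_op_L2:
  assumes "w \<in> H2"
  shows "SL_op p q r w \<in> L2w r"
proof -
  have r0: "\<forall>x\<in>{0..1}. r x \<noteq> 0" using r_pos by (metis less_irrefl)
  have "continuous_on {0..1} (\<lambda>x. - (1 / r x))" "continuous_on {0..1} (\<lambda>x. q x / r x * w x)"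
    by (intro continuous_intros r_cont q_cont H2_continuous[OF assms] r0)+
  then have "(\<lambda>x. (- (1 / r x)) * flux_deriv w x + q x / r x * w x) \<in> L2w (\<lambda>_. 1)"
    by (intro unweighted.L2w_add[OF L2w_one_mult_continuous[OF flux_weak_deriv(2)[OF assms]]]
        unweighted.L2w_continuous)
  then show ?thesis unfolding SL_op_def by (intro L2w_one_subset)
qed

lemma L2ip_SL_op:
  assumes f: "f \<in> H2" and w: "w \<in> H2"
  shows "L2ip r f (SL_op p q r w) = (\<integral>x. q x * f x * w x \<partial>I01) - (\<integral>x. f x * flux_deriv w x \<partial>I01)"
proof -
  have "L2ip r f (SL_op p q r w) = (\<integral>x. q x * f x * w x - f x * flux_deriv w x \<partial>I01)"
    unfolding L2ip_eq SL_op_def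
  proof (intro Bochner_Integration.integral_cong refl)
    fix x assume "x \<in> space I01"
    then have "r x \<noteq> 0" using r_pos[of x] by auto
    then show "r x * f x * (- (1 / r x) * flux_deriv w x + q x / r x * w x) = q x * f x * w x - f x * flux_deriv w x"
      by (simp add: field_simps)
  qed
  also have "\<dots> = (\<integral>x. q x * f x * w x \<partial>I01) - (\<integral>x. f x * flux_deriv w x \<partial>I01)"
    by (intro Bochner_Integration.integral_diff integrable_I01_continuous continuous_intros q_cont H2_continuous f w
        integrable_I01_mult_continuous has_weak_deriv_integrable[OF flux_weak_deriv(1)])
  finally show ?thesis .
qed

lemma integral_flux_by_parts:
  assumes f: "f \<in> H2" and w: "w \<in> H2"
  shows "(\<integral>x. f x * flux_deriv w x \<partial>I01)
    = p 1 * f 1 * D1 w 1 - p 0 * f 0 * D1 w 0 - (\<integral>x. p x * D1 f x * D1 w x \<partial>I01)"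
proof -
  note pc = Ck1_continuous[OF p_C1]
  have wd: "has_weak_deriv (\<lambda>x. p x * D1 w x * f x) (\<lambda>s. flux_deriv w s * f s + p s * D1 w s * D1 f s)"
    by (rule has_weak_deriv_mult[OF flux_weak_deriv(1)[OF w] H2D(1)[OF f]])
  have "p 1 * D1 w 1 * f 1 - p 0 * D1 w 0 * f 0 = (\<integral>s. flux_deriv w s * f s + p s * D1 w s * D1 f s \<partial>I01)"
    using has_weak_deriv_increment[OF wd] by simp
  also have "\<dots> = (\<integral>s. f s * flux_deriv w s + p s * D1 f s * D1 w s \<partial>I01)"
    by (simp add: mult.commute mult.left_commute)
  also have "\<dots> = (\<integral>x. f x * flux_deriv w x \<partial>I01) + (\<integral>x. p x * D1 f x * D1 w x \<partial>I01)"
  proof (rule Bochner_Integration.integral_add)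
    show "integrable I01 (\<lambda>x. f x * flux_deriv w x)"
      by (intro integrable_I01_mult_continuous has_weak_deriv_integrable[OF flux_weak_deriv(1)] w H2_continuous f)
    have "continuous_on {0..1} (D1 f)" "continuous_on {0..1} (D1 w)"
      by (rule Ck1_deriv_continuous[OF H2D(1)[OF f]], rule Ck1_deriv_continuous[OF H2D(1)[OF w]])
    then show "integrable I01 (\<lambda>x. p x * D1 f x * D1 w x)"
      by (intro integrable_I01_continuous continuous_intros pc)
  qed
  finally show ?thesis by (simp add: mult.commute mult.left_commute)
qed

text \<open>One integration by parts turns both sides into the same symmetric form plus boundary terms
  \<open>p (f w' - w f')\<close>, and these vanish under separated boundary conditions.\<close>

lemma SL_op_symmetric:
  assumes f: "f \<in> SL_dom a1 a2 b1 b2" and w: "w \<in> SL_dom a1 a2 b1 b2"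
  shows "L2ip r f (SL_op p q r w) = L2ip r w (SL_op p q r f)"
proof -
  note fH = SL_domD(1)[OF f] and wH = SL_domD(1)[OF w]
  have "f 1 * D1 w 1 = w 1 * D1 f 1"
    by (rule boundary_wronskian_zero[OF a_norm SL_domD(3)[OF f] SL_domD(3)[OF w]])
  moreover have "f 0 * D1 w 0 = w 0 * D1 f 0"
    by (rule boundary_wronskian_zero[OF b_norm SL_domD(2)[OF f] SL_domD(2)[OF w]])
  ultimately have "(\<integral>x. f x * flux_deriv w x \<partial>I01) = (\<integral>x. w x * flux_deriv f x \<partial>I01)"
    unfolding integral_flux_by_parts[OF fH wH] integral_flux_by_parts[OF wH fH] mult.assoc
    by (simp only: mult.commute[of "D1 f _"])
  then show ?thesis
    unfolding L2ip_SL_op[OF fH wH] L2ip_SL_op[OF wH fH] mult.assoc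
    by (simp only: mult.commute[of "f _"])
qed

end

text \<open>Monotone eigenvalues and completeness are the spectral input to the lower bound of
  \<open>\<langle>T, A w\<rangle>\<close>; the regularity of the eigenfunctions is contained in their membership in the domain.\<close>

locale sturm_liouville_basis = sturm_liouville r p q a1 a2 b1 b2 + orthonormal_L2 r \<phi>
  for r p q :: "real \<Rightarrow> real" and a1 a2 b1 b2 :: real and \<phi> :: "nat \<Rightarrow> real \<Rightarrow> real" +
  fixes lam :: "nat \<Rightarrow> real"
  assumes lam_mono: "\<And>m n. 1 \<le> m \<Longrightarrow> m \<le> n \<Longrightarrow> lam m \<le> lam n"
    and phi_dom: "\<And>n. n \<ge> 1 \<Longrightarrow> \<phi> n \<in> SL_dom a1 a2 b1 b2"
    and phi_eigen: "\<And>n. n \<ge> 1 \<Longrightarrow> AE x in I01. SL_op p q r (\<phi> n) x = lam n * \<phi> n x"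
    and phi_complete: "\<And>f. f \<in> L2w r \<Longrightarrow> (\<lambda>k. L2norm r (\<lambda>x. f x - proj r \<phi> k f x)) \<longlonglongrightarrow> 0"
begin

lemma L2ip_phi_SL_op:
  assumes n: "n \<ge> 1" and w: "w \<in> SL_dom a1 a2 b1 b2"
  shows "L2ip r (\<phi> n) (SL_op p q r w) = lam n * L2ip r (\<phi> n) w"
proof -
  have wL: "w \<in> L2w r" using w by (intro L2w_continuous H2_continuous SL_domD)
  have "L2ip r (\<phi> n) (SL_op p q r w) = L2ip r w (SL_op p q r (\<phi> n))"
    by (rule SL_op_symmetric[OF phi_dom[OF n] w])
  also have "\<dots> = L2ip r w (\<lambda>x. lam n * \<phi> n x)"
    using phi_eigen[OF n] n wL
    by (intro L2ip_cong_AE L2wD[OF SL_op_L2] SL_domD(1)[OF phi_dom] L2wD[OF L2w_scale] phi_L2)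
       (auto intro: L2wD)
  finally show ?thesis by (simp add: L2ip_scale_right L2ip_commute[of r w])
qed

text \<open>Formally this is \<open>\<Sum>\<^sub>n\<^sub>>\<^sub>N \<lambda>\<^sub>n c\<^sub>n\<^sup>2 \<ge> \<lambda>\<^sub>N\<^sub>+\<^sub>1 \<Sum>\<^sub>n\<^sub>>\<^sub>N c\<^sub>n\<^sup>2\<close>. The series for \<open>\<langle>w, A w\<rangle>\<close> need not be summed:
  the finite sums over \<open>N < n \<le> k\<close> are differences of two tails, and the tail for \<open>k\<close> disappears in
  the limit because \<open>A w\<close> is square integrable.\<close>

lemma L2ip_tail_SL_op:
  assumes w: "w \<in> SL_dom a1 a2 b1 b2"
  shows "lam (N + 1) * (L2norm r (\<lambda>x. w x - proj r \<phi> N w x))\<^sup>2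
       \<le> L2ip r (\<lambda>x. w x - proj r \<phi> N w x) (SL_op p q r w)"
proof -
  let ?A = "SL_op p q r w" and ?c = "\<lambda>n. L2ip r (\<phi> n) w"
  let ?T = "\<lambda>k x. w x - proj r \<phi> k w x"
  have wL: "w \<in> L2w r" using w by (intro L2w_continuous H2_continuous SL_domD)
  have AL: "?A \<in> L2w r" using w by (intro SL_op_L2 SL_domD)
  have split: "L2ip r (?T k) ?A = L2ip r w ?A - (\<Sum>n=1..k. lam n * (?c n)\<^sup>2)" for k
    unfolding L2ip_tail[OF wL AL]
    by (intro arg_cong2[of _ _ _ _ minus] refl sum.cong) (auto simp: L2ip_phi_SL_op w power2_eq_square)
  have tail: "(L2norm r (?T k))\<^sup>2 = (L2norm r w)\<^sup>2 - (\<Sum>n=1..k. (?c n)\<^sup>2)" for k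
    by (rule L2norm_sq_tail[OF wL])
  have mono: "lam (N + 1) * ((L2norm r (?T N))\<^sup>2 - (L2norm r (?T k))\<^sup>2) \<le> L2ip r (?T N) ?A - L2ip r (?T k) ?A"
    if "k \<ge> N" for k
  proof -
    have eq: "(\<Sum>n=1..k. f n) - (\<Sum>n=1..N. f n) = (\<Sum>n=N+1..k. f n)" for f :: "nat \<Rightarrow> real"
    proof -
      have "{1..k} = {1..N} \<union> {N+1..k}" using that by auto
      then show ?thesis by (simp add: sum.union_disjoint)
    qed
    have "lam (N + 1) * (\<Sum>n=N+1..k. (?c n)\<^sup>2) \<le> (\<Sum>n=N+1..k. lam n * (?c n)\<^sup>2)"
      unfolding sum_distrib_left by (intro sum_mono mult_right_mono lam_mono) auto
    then show ?thesis unfolding split tail eq[symmetric] by (simp add: algebra_simps)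
  qed
  have T0: "(\<lambda>k. L2norm r (?T k)) \<longlonglongrightarrow> 0" by (rule phi_complete[OF wL])
  have "(\<lambda>k. L2ip r (?T k) ?A) \<longlonglongrightarrow> 0"
  proof (rule Lim_null_comparison)
    show "\<forall>\<^sub>F k in sequentially. norm (L2ip r (?T k) ?A) \<le> L2norm r (?T k) * L2norm r ?A"
      using L2_Cauchy_Schwarz[OF tail_L2[OF wL] AL] by (intro always_eventually) simp
    show "(\<lambda>k. L2norm r (?T k) * L2norm r ?A) \<longlonglongrightarrow> 0"
      using tendsto_mult_left_zero[OF T0] .
  qed
  then have "(\<lambda>k. L2ip r (?T N) ?A - L2ip r (?T k) ?A) \<longlonglongrightarrow> L2ip r (?T N) ?A - 0"
    by (intro tendsto_intros)
  moreover have "(\<lambda>k. lam (N + 1) * ((L2norm r (?T N))\<^sup>2 - (L2norm r (?T k))\<^sup>2)) \<longlonglongrightarrow> lam (N + 1) * ((L2norm r (?T N))\<^sup>2 - 0\<^sup>2)"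
    by (intro tendsto_intros T0)
  ultimately show ?thesis
    using mono by (intro LIMSEQ_le[of _ "lam (N + 1) * (L2norm r (?T N))\<^sup>2" _ "L2ip r (?T N) ?A"]) auto
qed

end

section \<open>The quadratic functional and its derivative along curves\<close>

context weighted_L2
begin

lemma L2ip_curve_derivative:
  assumes \<psi>: "\<psi> \<in> L2w r" and u: "\<forall>\<^sub>F s in at t. u s \<in> L2w r" and ut: "u t \<in> L2w r" and v: "v \<in> L2w r"
    and lim: "((\<lambda>s. L2norm r (\<lambda>x. (u s x - u t x) / (s - t) - v x)) \<longlongrightarrow> 0) (at t)"
  shows "((\<lambda>s. L2ip r \<psi> (u s)) has_real_derivative L2ip r \<psi> v) (at t)"
  unfolding has_field_derivative_iff
proof (rule LIM_zero_cancel)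
  let ?e = "\<lambda>s x. (u s x - u t x) / (s - t) - v x"
  show "((\<lambda>s. (L2ip r \<psi> (u s) - L2ip r \<psi> (u t)) / (s - t) - L2ip r \<psi> v) \<longlongrightarrow> 0) (at t)"
  proof (rule Lim_null_comparison)
    show "((\<lambda>s. L2norm r \<psi> * L2norm r (?e s)) \<longlongrightarrow> 0) (at t)"
      by (rule tendsto_mult_right_zero[OF lim])
    show "\<forall>\<^sub>F s in at t. norm ((L2ip r \<psi> (u s) - L2ip r \<psi> (u t)) / (s - t) - L2ip r \<psi> v)
        \<le> L2norm r \<psi> * L2norm r (?e s)"
      using u
    proof eventually_elim
      case (elim s)
      let ?d = "\<lambda>x. (1 / (s - t)) * (u s x - u t x)"
      have d: "?d \<in> L2w r" by (rule L2w_scale[OF L2w_diff[OF elim ut]])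
      have "L2ip r \<psi> ?d = (L2ip r \<psi> (u s) - L2ip r \<psi> (u t)) / (s - t)"
        unfolding L2ip_scale_right L2ip_diff_right[OF \<psi> elim ut] by simp
      then have "L2ip r \<psi> (\<lambda>x. ?d x - v x) = (L2ip r \<psi> (u s) - L2ip r \<psi> (u t)) / (s - t) - L2ip r \<psi> v"
        by (simp only: L2ip_diff_right[OF \<psi> d v])
      moreover have "\<bar>L2ip r \<psi> (\<lambda>x. ?d x - v x)\<bar> \<le> L2norm r \<psi> * L2norm r (\<lambda>x. ?d x - v x)"
        by (rule L2_Cauchy_Schwarz[OF \<psi> L2w_diff[OF d v]])
      ultimately show ?case by simp
    qed
  qed
qed

text \<open>With \<open>d\<^sub>s = (u(s) - u(t)) / (s - t)\<close> the difference quotient of \<open>\<parallel>u\<parallel>\<^sup>2\<close> equals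
  \<open>2 \<langle>u(t), d\<^sub>s\<rangle> + (s - t) \<parallel>d\<^sub>s\<parallel>\<^sup>2\<close>, and \<open>\<parallel>d\<^sub>s\<parallel>\<close> stays bounded since it converges.\<close>

lemma L2norm_sq_curve_derivative:
  assumes u: "\<forall>\<^sub>F s in at t. u s \<in> L2w r" and ut: "u t \<in> L2w r" and v: "v \<in> L2w r"
    and lim: "((\<lambda>s. L2norm r (\<lambda>x. (u s x - u t x) / (s - t) - v x)) \<longlongrightarrow> 0) (at t)"
  shows "((\<lambda>s. (L2norm r (u s))\<^sup>2) has_real_derivative 2 * L2ip r (u t) v) (at t)"
  unfolding has_field_derivative_iff
proof (rule Lim_transform_eventually)
  let ?d = "\<lambda>s x. (1 / (s - t)) * (u s x - u t x)"
  let ?ip = "\<lambda>s. (L2ip r (u t) (u s) - L2ip r (u t) (u t)) / (s - t)"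
  have ip: "(?ip \<longlongrightarrow> L2ip r (u t) v) (at t)"
    using L2ip_curve_derivative[OF ut u ut v lim] by (simp add: has_field_derivative_iff)
  have "((\<lambda>s. L2norm r (?d s) - L2norm r v) \<longlongrightarrow> 0) (at t)"
  proof (rule Lim_null_comparison[OF _ lim])
    show "\<forall>\<^sub>F s in at t. norm (L2norm r (?d s) - L2norm r v) \<le> L2norm r (\<lambda>x. (u s x - u t x) / (s - t) - v x)"
      using u
    proof eventually_elim
      case (elim s)
      show ?case using L2norm_diff_le[OF L2w_scale[OF L2w_diff[OF elim ut], of "1 / (s - t)"] v] by simp
    qed
  qed
  then have "((\<lambda>s. L2norm r (?d s)) \<longlongrightarrow> L2norm r v) (at t)" by (rule LIM_zero_cancel)
  then have "((\<lambda>s. 2 * ?ip s + (s - t) * (L2norm r (?d s))\<^sup>2) \<longlongrightarrow> 2 * L2ip r (u t) v + (t - t) * (L2norm r v)\<^sup>2) (at t)"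
    by (intro tendsto_intros ip)
  then show "((\<lambda>s. 2 * ?ip s + (s - t) * (L2norm r (?d s))\<^sup>2) \<longlongrightarrow> 2 * L2ip r (u t) v) (at t)" by simp
  have "\<forall>\<^sub>F s in at t. s \<noteq> t" by (simp add: eventually_at_filter)
  with u show "\<forall>\<^sub>F s in at t. 2 * ?ip s + (s - t) * (L2norm r (?d s))\<^sup>2
      = ((L2norm r (u s))\<^sup>2 - (L2norm r (u t))\<^sup>2) / (s - t)"
  proof eventually_elim
    case (elim s)
    have "(L2norm r (u s))\<^sup>2 = (L2norm r (\<lambda>x. u t x + (u s x - u t x)))\<^sup>2" by simp
    also have "\<dots> = (L2norm r (u t))\<^sup>2 + 2 * L2ip r (u t) (\<lambda>x. u s x - u t x) + (L2norm r (\<lambda>x. u s x - u t x))\<^sup>2"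
      by (rule L2norm_sq_add[OF ut L2w_diff[OF elim(1) ut]])
    also have "L2ip r (u t) (\<lambda>x. u s x - u t x) = (s - t) * ?ip s"
      using elim by (simp add: L2ip_diff_right ut)
    also have "(L2norm r (\<lambda>x. u s x - u t x))\<^sup>2 = (s - t)\<^sup>2 * (L2norm r (?d s))\<^sup>2"
      using elim unfolding L2norm_scale by (simp add: power_mult_distrib power_divide)
    finally have "(L2norm r (u s))\<^sup>2 - (L2norm r (u t))\<^sup>2
        = (s - t) * (2 * ?ip s + (s - t) * (L2norm r (?d s))\<^sup>2)"
      by (simp only:) (simp only: power2_eq_square ring_distribs mult.assoc mult.left_commute add_diff_cancel_left')
    then show ?case using elim by simp
  qed
qed

lemma state_norm_sq: "(state_norm r N w y)\<^sup>2 = (L2norm r w)\<^sup>2 + (\<Sum>i=1..N. (y i)\<^sup>2)"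
  unfolding state_norm_def by (rule real_sqrt_pow2) (intro add_nonneg_nonneg sum_nonneg; simp)

lemma state_norm_nonneg: "0 \<le> state_norm r N w y"
  unfolding state_norm_def by (intro real_sqrt_ge_zero add_nonneg_nonneg sum_nonneg) auto

lemma L2norm_le_state_norm: "L2norm r w \<le> state_norm r N w y"
proof (rule power2_le_imp_le)
  show "(L2norm r w)\<^sup>2 \<le> (state_norm r N w y)\<^sup>2" unfolding state_norm_sq by (simp add: sum_nonneg)
qed (rule state_norm_nonneg)

lemma component_le_state_norm:
  assumes "i \<in> {1..N}"
  shows "\<bar>y i\<bar> \<le> state_norm r N w y"
proof (rule power2_le_imp_le)
  have "(y i)\<^sup>2 \<le> (\<Sum>i=1..N. (y i)\<^sup>2)" using assms by (intro member_le_sum) auto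
  also have "\<dots> \<le> (state_norm r N w y)\<^sup>2" unfolding state_norm_sq by simp
  finally show "\<bar>y i\<bar>\<^sup>2 \<le> (state_norm r N w y)\<^sup>2" by simp
qed (rule state_norm_nonneg)

end

context orthonormal_L2
begin

text \<open>By Pythagoras the functional depends on \<open>w\<close> only through \<open>\<parallel>w\<parallel>\<close> and the first \<open>N\<close>
  coefficients. Continuity and differentiability are read off from this form.\<close>

lemma Vfun_eq:
  assumes "w \<in> L2w r"
  shows "Vfun r \<phi> N R \<gamma> \<omega> w y = R / 2 * (\<Sum>m=1..N. (L2ip r (\<phi> m) w)\<^sup>2)
     + \<gamma> / 2 * ((L2norm r w)\<^sup>2 - (\<Sum>m=1..N. (L2ip r (\<phi> m) w)\<^sup>2)) + 1 / 2 * (\<Sum>i=1..N. \<omega> i * (y i)\<^sup>2)"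
  unfolding Vfun_def L2norm_sq_tail[OF assms] ..

text \<open>The common source of the two statements on derivatives: for straight lines it yields the
  directional derivative in the definition of a control Lyapunov functional, for solutions of the
  closed loop the derivative in time.\<close>

lemma Vfun_curve_derivative:
  assumes w: "\<forall>\<^sub>F s in at t. w s \<in> L2w r" and wt: "w t \<in> L2w r" and wd: "wd \<in> L2w r"
    and lim: "((\<lambda>s. L2norm r (\<lambda>x. (w s x - w t x) / (s - t) - wd x)) \<longlongrightarrow> 0) (at t)"
    and y: "\<And>i. i \<in> {1..N} \<Longrightarrow> ((\<lambda>s. y s i) has_real_derivative - \<mu> i * y t i + v i) (at t)"
  shows "((\<lambda>s. Vfun r \<phi> N R \<gamma> \<omega> (w s) (y s)) has_real_derivative
            Vdot r \<phi> N \<mu> R \<gamma> \<omega> (w t) (y t) wd v) (at t)"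
proof -
  let ?c = "\<lambda>n s. L2ip r (\<phi> n) (w s)" and ?cd = "\<lambda>n. L2ip r (\<phi> n) wd"
  let ?Q = "\<lambda>s. R / 2 * (\<Sum>m=1..N. (?c m s)\<^sup>2) + \<gamma> / 2 * ((L2norm r (w s))\<^sup>2 - (\<Sum>m=1..N. (?c m s)\<^sup>2))
      + 1 / 2 * (\<Sum>i=1..N. \<omega> i * (y s i)\<^sup>2)"
  have c: "(?c n has_real_derivative ?cd n) (at t)" if "n \<in> {1..N}" for n
    using that by (intro L2ip_curve_derivative[OF phi_L2 w wt wd lim]) simp
  have c2: "((\<lambda>s. (?c n s)\<^sup>2) has_real_derivative 2 * (?c n t * ?cd n)) (at t)" if "n \<in> {1..N}" for n
    using DERIV_power[OF c[OF that], of 2] by (simp add: mult.commute)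
  have y2: "((\<lambda>s. \<omega> i * (y s i)\<^sup>2) has_real_derivative \<omega> i * (2 * (y t i * (- \<mu> i * y t i + v i)))) (at t)"
    if "i \<in> {1..N}" for i
    using DERIV_cmult[OF DERIV_power[OF y[OF that], of 2], of "\<omega> i"] by (simp add: mult.commute)
  have C: "((\<lambda>s. \<Sum>m=1..N. (?c m s)\<^sup>2) has_real_derivative (\<Sum>m=1..N. 2 * (?c m t * ?cd m))) (at t)"
    by (rule DERIV_sum) (rule c2)
  have Y: "((\<lambda>s. \<Sum>i=1..N. \<omega> i * (y s i)\<^sup>2) has_real_derivative
      (\<Sum>i=1..N. \<omega> i * (2 * (y t i * (- \<mu> i * y t i + v i))))) (at t)"
    by (rule DERIV_sum) (rule y2)
  note W = L2norm_sq_curve_derivative[OF w wt wd lim]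
  have "(?Q has_real_derivative
      R / 2 * (\<Sum>m=1..N. 2 * (?c m t * ?cd m)) + \<gamma> / 2 * (2 * L2ip r (w t) wd - (\<Sum>m=1..N. 2 * (?c m t * ?cd m)))
      + 1 / 2 * (\<Sum>i=1..N. \<omega> i * (2 * (y t i * (- \<mu> i * y t i + v i))))) (at t)"
    by (intro DERIV_add DERIV_cmult DERIV_diff C Y W)
  moreover have "R / 2 * (\<Sum>m=1..N. 2 * (?c m t * ?cd m)) + \<gamma> / 2 * (2 * L2ip r (w t) wd - (\<Sum>m=1..N. 2 * (?c m t * ?cd m)))
      + 1 / 2 * (\<Sum>i=1..N. \<omega> i * (2 * (y t i * (- \<mu> i * y t i + v i))))
      = Vdot r \<phi> N \<mu> R \<gamma> \<omega> (w t) (y t) wd v"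
  proof -
    have 1: "(\<Sum>m=1..N. 2 * (?c m t * ?cd m)) = 2 * (\<Sum>m=1..N. ?c m t * ?cd m)"
      by (rule sum_distrib_left[symmetric])
    have "(\<Sum>i=1..N. \<omega> i * (2 * (y t i * (- \<mu> i * y t i + v i))))
        = (\<Sum>i=1..N. 2 * (\<omega> i * y t i * v i) - 2 * (\<mu> i * \<omega> i * (y t i)\<^sup>2))"
      by (intro sum.cong refl) (simp add: algebra_simps power2_eq_square)
    then have 2: "(\<Sum>i=1..N. \<omega> i * (2 * (y t i * (- \<mu> i * y t i + v i))))
        = 2 * (\<Sum>i=1..N. \<omega> i * y t i * v i) - 2 * (\<Sum>i=1..N. \<mu> i * \<omega> i * (y t i)\<^sup>2)"
      by (simp only: sum_subtractf sum_distrib_left)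
    show ?thesis unfolding Vdot_def 1 2 L2ip_tail_tail[OF wt wd] L2ip_tail[OF wt wd]
      by (simp add: algebra_simps)
  qed
  ultimately have "(?Q has_real_derivative Vdot r \<phi> N \<mu> R \<gamma> \<omega> (w t) (y t) wd v) (at t)" by simp
  moreover have ev: "\<forall>\<^sub>F s in nhds t. ?Q s = Vfun r \<phi> N R \<gamma> \<omega> (w s) (y s)"
    unfolding eventually_nhds_conv_at using w wt by (auto simp: Vfun_eq elim!: eventually_mono)
  ultimately show ?thesis using DERIV_cong_ev[OF refl ev refl] by blast
qed

text \<open>The coefficients, the norm of \<open>w\<close> and the \<open>y\<^sub>i\<close> are Lipschitz with constant 1 in the norm of the
  state, and the functional is a polynomial in them.\<close>

lemma Vfun_continuous:
  assumes w: "w \<in> L2w r" and "\<epsilon> > 0"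
  shows "\<exists>\<delta>>0. \<forall>w'\<in>L2w r. \<forall>y'. state_norm r N (\<lambda>x. w' x - w x) (\<lambda>i. y' i - y i) < \<delta> \<longrightarrow>
           \<bar>Vfun r \<phi> N R \<gamma> \<omega> w' y' - Vfun r \<phi> N R \<gamma> \<omega> w y\<bar> < \<epsilon>"
proof -
  let ?d = "\<lambda>z. state_norm r N (\<lambda>x. fst z x - w x) (\<lambda>i. snd z i - y i)"
  \<comment> \<open>The filter of states of \<open>L2w r \<times> UNIV\<close> approaching \<open>(w, y)\<close>; with it the limit rules for polynomials apply.\<close>
  define \<F> where "\<F> = inf (filtercomap ?d (nhds 0)) (principal (L2w r \<times> UNIV))"
  have d: "(?d \<longlongrightarrow> 0) \<F>"
    unfolding \<F>_def by (rule tendsto_mono[OF inf_le1 filterlim_filtercomap])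
  have mem: "\<forall>\<^sub>F z in \<F>. fst z \<in> L2w r"
    unfolding \<F>_def eventually_inf_principal by (auto intro!: always_eventually)
  have lip: "(f \<longlongrightarrow> c) \<F>" if "\<And>z. fst z \<in> L2w r \<Longrightarrow> \<bar>f z - c\<bar> \<le> ?d z" for f :: "_ \<Rightarrow> real" and c
  proof (rule LIM_zero_cancel, rule Lim_null_comparison[OF _ d])
    show "\<forall>\<^sub>F z in \<F>. norm (f z - c) \<le> ?d z"
      using mem that by (auto elim!: eventually_mono)
  qed
  have c: "((\<lambda>z. L2ip r (\<phi> m) (fst z)) \<longlongrightarrow> L2ip r (\<phi> m) w) \<F>" if m: "m \<in> {1..N}" for m
  proof (rule lip)
    fix z :: "(real \<Rightarrow> real) \<times> (nat \<Rightarrow> real)" assume z: "fst z \<in> L2w r"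
    have phi: "\<phi> m \<in> L2w r" "L2norm r (\<phi> m) = 1" using m by (auto intro: phi_L2 phi_norm)
    have "\<bar>L2ip r (\<phi> m) (fst z) - L2ip r (\<phi> m) w\<bar> = \<bar>L2ip r (\<phi> m) (\<lambda>x. fst z x - w x)\<bar>"
      by (simp only: L2ip_diff_right[OF phi(1) z w])
    also have "\<dots> \<le> L2norm r (\<lambda>x. fst z x - w x)"
      using L2_Cauchy_Schwarz[OF phi(1) L2w_diff[OF z w]] by (simp add: phi(2))
    also have "\<dots> \<le> ?d z" by (rule L2norm_le_state_norm)
    finally show "\<bar>L2ip r (\<phi> m) (fst z) - L2ip r (\<phi> m) w\<bar> \<le> ?d z" .
  qed
  have n: "((\<lambda>z. L2norm r (fst z)) \<longlongrightarrow> L2norm r w) \<F>"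
    by (rule lip) (rule order_trans[OF L2norm_diff_le[OF _ w] L2norm_le_state_norm])
  have y: "((\<lambda>z. snd z i) \<longlongrightarrow> y i) \<F>" if i: "i \<in> {1..N}" for i
    by (rule lip) (rule component_le_state_norm[OF i])
  have "((\<lambda>z. R / 2 * (\<Sum>m=1..N. (L2ip r (\<phi> m) (fst z))\<^sup>2)
     + \<gamma> / 2 * ((L2norm r (fst z))\<^sup>2 - (\<Sum>m=1..N. (L2ip r (\<phi> m) (fst z))\<^sup>2)) + 1 / 2 * (\<Sum>i=1..N. \<omega> i * (snd z i)\<^sup>2))
     \<longlongrightarrow> Vfun r \<phi> N R \<gamma> \<omega> w y) \<F>"
    unfolding Vfun_eq[OF w] by (intro tendsto_intros c n y)
  then have "((\<lambda>z. Vfun r \<phi> N R \<gamma> \<omega> (fst z) (snd z)) \<longlongrightarrow> Vfun r \<phi> N R \<gamma> \<omega> w y) \<F>"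
    by (rule Lim_transform_eventually) (use mem in \<open>auto simp: Vfun_eq elim!: eventually_mono\<close>)
  then have "\<forall>\<^sub>F z in \<F>. dist (Vfun r \<phi> N R \<gamma> \<omega> (fst z) (snd z)) (Vfun r \<phi> N R \<gamma> \<omega> w y) < \<epsilon>"
    using \<open>\<epsilon> > 0\<close> by (rule tendstoD)
  then have "\<forall>\<^sub>F z in filtercomap ?d (nhds 0). z \<in> L2w r \<times> UNIV \<longrightarrow>
      dist (Vfun r \<phi> N R \<gamma> \<omega> (fst z) (snd z)) (Vfun r \<phi> N R \<gamma> \<omega> w y) < \<epsilon>"
    unfolding \<F>_def eventually_inf_principal .
  then obtain P where P: "eventually P (nhds 0)"
      "\<And>z. P (?d z) \<Longrightarrow> z \<in> L2w r \<times> UNIV \<Longrightarrow> dist (Vfun r \<phi> N R \<gamma> \<omega> (fst z) (snd z)) (Vfun r \<phi> N R \<gamma> \<omega> w y) < \<epsilon>"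
    unfolding eventually_filtercomap by blast
  then obtain \<delta> where \<delta>: "\<delta> > 0" "\<And>s. dist s 0 < \<delta> \<Longrightarrow> P s" unfolding eventually_nhds_metric by blast
  show ?thesis
  proof (intro exI conjI ballI allI impI)
    show "\<delta> > 0" by fact
    fix w' y' assume w': "w' \<in> L2w r" and less: "state_norm r N (\<lambda>x. w' x - w x) (\<lambda>i. y' i - y i) < \<delta>"
    have "P (?d (w', y'))" using less by (intro \<delta>(2)) (simp add: dist_norm state_norm_nonneg)
    from P(2)[OF this] w' show "\<bar>Vfun r \<phi> N R \<gamma> \<omega> w' y' - Vfun r \<phi> N R \<gamma> \<omega> w y\<bar> < \<epsilon>"
      by (simp add: dist_real_def)
  qed
qed

lemma Vfun_bounds:
  assumes "R > 0" "\<gamma> > 0" "\<And>i. i \<in> {1..N} \<Longrightarrow> \<omega> i > 0"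
  shows "\<exists>a>0. \<exists>b>0. \<forall>w\<in>L2w r. \<forall>y. a * (state_norm r N w y)\<^sup>2 \<le> Vfun r \<phi> N R \<gamma> \<omega> w y
      \<and> Vfun r \<phi> N R \<gamma> \<omega> w y \<le> b * (state_norm r N w y)\<^sup>2"
proof -
  let ?S = "{R, \<gamma>} \<union> \<omega> ` {1..N}"
  define a b where "a = Min ?S / 2" and "b = Max ?S / 2"
  have S: "finite ?S" "?S \<noteq> {}" by auto
  have "\<forall>s\<in>?S. s > 0" using assms by auto
  then have "a > 0" unfolding a_def using S by (simp add: Min_gr_iff)
  have "2 * a \<le> s \<and> s \<le> 2 * b" if "s \<in> ?S" for s
    unfolding a_def b_def using Min_le[OF S(1) that] Max_ge[OF S(1) that] by simp
  then have ab: "2 * a \<le> R" "2 * a \<le> \<gamma>" "R \<le> 2 * b" "\<gamma> \<le> 2 * b"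
      "\<And>i. i \<in> {1..N} \<Longrightarrow> 2 * a \<le> \<omega> i \<and> \<omega> i \<le> 2 * b" by auto
  have "b > 0" using \<open>R > 0\<close> ab by simp
  moreover {
    fix w y assume w: "w \<in> L2w r"
    let ?k = "\<Sum>m=1..N. (L2ip r (\<phi> m) w)\<^sup>2" and ?e = "(L2norm r (\<lambda>x. w x - proj r \<phi> N w x))\<^sup>2"
    have sn: "(state_norm r N w y)\<^sup>2 = ?k + ?e + (\<Sum>i=1..N. (y i)\<^sup>2)"
      unfolding state_norm_sq L2norm_sq_tail[OF w] by simp
    have k: "?k \<ge> 0" by (rule sum_nonneg) simp
    have e: "?e \<ge> 0" by simp
    have "2 * a * ?k \<le> R * ?k" "2 * a * ?e \<le> \<gamma> * ?e" "R * ?k \<le> 2 * b * ?k" "\<gamma> * ?e \<le> 2 * b * ?e"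
      using ab(1-4) k e by (simp_all only: mult_right_mono)
    moreover have "2 * a * (\<Sum>i=1..N. (y i)\<^sup>2) \<le> (\<Sum>i=1..N. \<omega> i * (y i)\<^sup>2)"
        "(\<Sum>i=1..N. \<omega> i * (y i)\<^sup>2) \<le> 2 * b * (\<Sum>i=1..N. (y i)\<^sup>2)"
      unfolding sum_distrib_left using ab(5) by (auto intro!: sum_mono mult_right_mono)
    ultimately have "a * (state_norm r N w y)\<^sup>2 \<le> Vfun r \<phi> N R \<gamma> \<omega> w y \<and> Vfun r \<phi> N R \<gamma> \<omega> w y \<le> b * (state_norm r N w y)\<^sup>2"
      unfolding sn Vfun_def by (simp add: algebra_simps)
  }
  ultimately show ?thesis using \<open>a > 0\<close> by blast
qed

end

section \<open>Exponential decay\<close>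

lemma exponential_decay:
  fixes f :: "real \<Rightarrow> real"
  assumes cont: "continuous_on {0..} f"
    and der: "\<And>t. t > 0 \<Longrightarrow> \<exists>d. (f has_real_derivative d) (at t) \<and> d \<le> - c * f t"
    and "t \<ge> 0"
  shows "f t \<le> exp (- c * t) * f 0"
proof -
  have "exp (c * t) * f t \<le> exp (c * 0) * f 0"
  proof (rule DERIV_nonpos_imp_decreasing_open[OF \<open>t \<ge> 0\<close>])
    fix x :: real assume "0 < x" "x < t"
    then obtain d where d: "(f has_real_derivative d) (at x)" "d \<le> - c * f x" using der by blast
    have "((\<lambda>t. exp (c * t) * f t) has_real_derivative exp (c * x) * (c * f x + d)) (at x)"
      using d(1) by (auto intro!: derivative_eq_intros simp: algebra_simps)
    moreover have "exp (c * x) * (c * f x + d) \<le> 0" using d(2) by (intro mult_nonneg_nonpos) auto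
    ultimately show "\<exists>y. ((\<lambda>t. exp (c * t) * f t) has_real_derivative y) (at x) \<and> y \<le> 0" by blast
  next
    show "continuous_on {0..t} (\<lambda>t. exp (c * t) * f t)"
      by (intro continuous_intros continuous_on_subset[OF cont]) auto
  qed
  then have "exp (- c * t) * (exp (c * t) * f t) \<le> exp (- c * t) * f 0"
    by (intro mult_left_mono) auto
  moreover have "exp (- c * t) * exp (c * t) = 1" by (simp flip: exp_add)
  ultimately show ?thesis by (simp only: mult.assoc[symmetric] mult_1_left)
qed

section \<open>The coupling through the nonlinearity\<close>

lemma sum_sq_le_card_sum_sq:
  fixes z :: "nat \<Rightarrow> real"
  shows "(\<Sum>i=1..N. z i)\<^sup>2 \<le> real N * (\<Sum>i=1..N. (z i)\<^sup>2)"
  using Cauchy_Schwarz_ineq_sum[of "\<lambda>_. 1" z "{1..N}"] by simp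

lemma sum_mult_le_sqrt:
  fixes a c :: "nat \<Rightarrow> real"
  shows "\<bar>\<Sum>m=1..N. a m * c m\<bar> \<le> sqrt (\<Sum>m=1..N. (a m)\<^sup>2) * sqrt (\<Sum>m=1..N. (c m)\<^sup>2)"
proof -
  have "\<bar>\<Sum>m=1..N. a m * c m\<bar> = sqrt ((\<Sum>m=1..N. a m * c m)\<^sup>2)" by simp
  also have "\<dots> \<le> sqrt ((\<Sum>m=1..N. (a m)\<^sup>2) * (\<Sum>m=1..N. (c m)\<^sup>2))"
    by (intro real_sqrt_le_mono Cauchy_Schwarz_ineq_sum)
  finally show ?thesis by (simp add: real_sqrt_mult)
qed

text \<open>The left-hand side is \<open>e a + X b\<close> with \<open>X = e sqrt S + \<Sum>\<^sub>i \<omega>\<^sub>i \<bar>y\<^sub>i\<bar> G\<^sub>i\<close>, hence at most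
  \<open>sqrt (e\<^sup>2 + X\<^sup>2) sqrt (a\<^sup>2 + b\<^sup>2)\<close>. The estimate keeps \<open>a\<close> and \<open>b\<close> apart: bounding each of them by
  \<open>sqrt (a\<^sup>2 + b\<^sup>2)\<close> separately loses, in general, more than the gap conditions leave. From
  \<open>X\<^sup>2 \<le> 2 S e\<^sup>2 + 2 N \<Sum>\<^sub>i \<omega>\<^sub>i\<^sup>2 y\<^sub>i\<^sup>2 G\<^sub>i\<^sup>2\<close> the two gap conditions give, term by term,
  \<open>\<alpha> L\<^sup>2 (e\<^sup>2 + X\<^sup>2) \<le> \<nu>\<^sup>2 l\<^sup>2 E\<close>. The choice of \<open>\<omega>\<close> is the one for which the two conditions contribute with
  the proportions in which \<open>e\<^sup>2\<close> and \<open>\<Phi>\<^sub>i\<^sup>2 y\<^sub>i\<^sup>2\<close> occur in \<open>E\<close>.\<close>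

lemma coupling_estimate:
  fixes \<Phi> G \<mu> \<omega> y :: "nat \<Rightarrow> real"
  assumes "N \<ge> 1" and pos: "l > 0" "\<alpha> > 0" "\<beta> > 0" "\<nu> > 0" and nonneg: "e \<ge> 0" "K \<ge> 0"
    and \<mu>: "\<And>i. i \<in> {1..N} \<Longrightarrow> \<mu> i > 0"
    and \<omega>: "\<And>i. i \<in> {1..N} \<Longrightarrow> \<omega> i = l * \<beta> * (\<Phi> i)\<^sup>2 / (\<alpha> * \<mu> i)"
    and S: "S = (\<Sum>i=1..N. (\<Phi> i)\<^sup>2 * (G i)\<^sup>2)"
    and E: "E = e\<^sup>2 + \<beta> / \<alpha> * (\<Sum>i=1..N. (\<Phi> i)\<^sup>2 * (y i)\<^sup>2)"
    and gap_lam: "\<alpha> * L\<^sup>2 * (1 + 2 * real N * S) \<le> \<nu>\<^sup>2 * l\<^sup>2"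
    and gap_mu: "\<And>i. i \<in> {1..N} \<Longrightarrow> 2 * real N * L\<^sup>2 * \<beta> * (\<Phi> i)\<^sup>2 * (G i)\<^sup>2 \<le> \<nu>\<^sup>2 * (\<mu> i)\<^sup>2"
    and ab: "a\<^sup>2 + b\<^sup>2 \<le> L\<^sup>2 * \<alpha> * (E + K)"
  shows "e * a + (e * sqrt S + (\<Sum>i=1..N. \<omega> i * \<bar>y i\<bar> * G i)) * b \<le> \<nu> * l * (E + K / 2)"
proof -
  define X where "X = e * sqrt S + (\<Sum>i=1..N. \<omega> i * \<bar>y i\<bar> * G i)"
  have S0: "S \<ge> 0" unfolding S by (intro sum_nonneg) simp
  have E0: "E \<ge> 0" unfolding E using pos by (intro add_nonneg_nonneg mult_nonneg_nonneg sum_nonneg) auto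
  have "X\<^sup>2 \<le> 2 * (e * sqrt S)\<^sup>2 + 2 * (\<Sum>i=1..N. \<omega> i * \<bar>y i\<bar> * G i)\<^sup>2"
    unfolding X_def using sum_squares_bound[of "e * sqrt S" "\<Sum>i=1..N. \<omega> i * \<bar>y i\<bar> * G i"]
    by (simp add: power2_sum)
  also have "(e * sqrt S)\<^sup>2 = S * e\<^sup>2" using S0 by (simp add: power_mult_distrib)
  also have "(\<Sum>i=1..N. \<omega> i * \<bar>y i\<bar> * G i)\<^sup>2 \<le> real N * (\<Sum>i=1..N. (\<omega> i * \<bar>y i\<bar> * G i)\<^sup>2)"
    by (rule sum_sq_le_card_sum_sq)
  finally have X2: "X\<^sup>2 \<le> 2 * S * e\<^sup>2 + (\<Sum>i=1..N. 2 * real N * (\<omega> i * \<bar>y i\<bar> * G i)\<^sup>2)"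
    by (simp add: sum_distrib_left mult.assoc)
  have "\<alpha> * L\<^sup>2 * (e\<^sup>2 + X\<^sup>2) \<le> \<alpha> * L\<^sup>2 * ((1 + 2 * S) * e\<^sup>2 + (\<Sum>i=1..N. 2 * real N * (\<omega> i * \<bar>y i\<bar> * G i)\<^sup>2))"
    using X2 pos by (intro mult_left_mono) (auto simp: algebra_simps)
  also have "\<dots> = \<alpha> * L\<^sup>2 * (1 + 2 * S) * e\<^sup>2 + (\<Sum>i=1..N. \<alpha> * L\<^sup>2 * (2 * real N * (\<omega> i * \<bar>y i\<bar> * G i)\<^sup>2))"
    by (subst distrib_left) (simp only: sum_distrib_left mult.assoc)
  also have "\<dots> \<le> \<nu>\<^sup>2 * l\<^sup>2 * e\<^sup>2 + (\<Sum>i=1..N. \<nu>\<^sup>2 * l\<^sup>2 * (\<beta> / \<alpha> * ((\<Phi> i)\<^sup>2 * (y i)\<^sup>2)))"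
  proof (intro add_mono sum_mono mult_right_mono)
    have "1 * S \<le> real N * S" using \<open>N \<ge> 1\<close> S0 by (intro mult_right_mono) auto
    then have "\<alpha> * L\<^sup>2 * (1 + 2 * S) \<le> \<alpha> * L\<^sup>2 * (1 + 2 * real N * S)"
      using pos by (intro mult_left_mono) auto
    then show "\<alpha> * L\<^sup>2 * (1 + 2 * S) \<le> \<nu>\<^sup>2 * l\<^sup>2" using gap_lam by simp
    fix i assume i: "i \<in> {1..N}"
    let ?r = "l\<^sup>2 * (\<beta> / \<alpha>) * ((\<Phi> i)\<^sup>2 * (y i)\<^sup>2) / (\<mu> i)\<^sup>2"
    have "\<alpha> * L\<^sup>2 * (2 * real N * (\<omega> i * \<bar>y i\<bar> * G i)\<^sup>2)
        = (2 * real N * L\<^sup>2 * \<beta> * (\<Phi> i)\<^sup>2 * (G i)\<^sup>2) * ?r"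
      unfolding \<omega>[OF i] using \<mu>[OF i] pos by (simp add: field_simps power2_eq_square)
    also have "\<dots> \<le> (\<nu>\<^sup>2 * (\<mu> i)\<^sup>2) * ?r"
      using pos by (intro mult_right_mono gap_mu i) auto
    also have "\<dots> = \<nu>\<^sup>2 * l\<^sup>2 * (\<beta> / \<alpha> * ((\<Phi> i)\<^sup>2 * (y i)\<^sup>2))"
      using \<mu>[OF i] by (simp add: field_simps)
    finally show "\<alpha> * L\<^sup>2 * (2 * real N * (\<omega> i * \<bar>y i\<bar> * G i)\<^sup>2)
        \<le> \<nu>\<^sup>2 * l\<^sup>2 * (\<beta> / \<alpha> * ((\<Phi> i)\<^sup>2 * (y i)\<^sup>2))" .
  qed auto
  also have "\<dots> = \<nu>\<^sup>2 * l\<^sup>2 * E"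
    unfolding E by (simp only: distrib_left sum_distrib_left)
  finally have gain: "\<alpha> * L\<^sup>2 * (e\<^sup>2 + X\<^sup>2) \<le> \<nu>\<^sup>2 * l\<^sup>2 * E" .
  have "(e * a + X * b)\<^sup>2 \<le> (e\<^sup>2 + X\<^sup>2) * (a\<^sup>2 + b\<^sup>2)"
  proof -
    have "(e\<^sup>2 + X\<^sup>2) * (a\<^sup>2 + b\<^sup>2) - (e * a + X * b)\<^sup>2 = (e * b - X * a)\<^sup>2"
      by (simp add: power2_eq_square algebra_simps)
    then show ?thesis by (metis diff_ge_0_iff_ge zero_le_power2)
  qed
  also have "\<dots> \<le> (e\<^sup>2 + X\<^sup>2) * (L\<^sup>2 * \<alpha> * (E + K))" by (intro mult_left_mono ab) simp
  also have "\<dots> = \<alpha> * L\<^sup>2 * (e\<^sup>2 + X\<^sup>2) * (E + K)" by (simp add: mult.commute mult.left_commute)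
  also have "\<dots> \<le> \<nu>\<^sup>2 * l\<^sup>2 * E * (E + K)" using E0 nonneg by (intro mult_right_mono gain) simp
  also have "\<dots> = \<nu>\<^sup>2 * l\<^sup>2 * (E * (E + K))" by simp
  also have "\<dots> \<le> \<nu>\<^sup>2 * l\<^sup>2 * (E + K / 2)\<^sup>2"
  proof (rule mult_left_mono)
    have "(E + K / 2)\<^sup>2 = E * (E + K) + (K / 2)\<^sup>2" by (simp add: power2_eq_square algebra_simps)
    then show "E * (E + K) \<le> (E + K / 2)\<^sup>2" by simp
  qed simp
  finally have "(e * a + X * b)\<^sup>2 \<le> (\<nu> * l * (E + K / 2))\<^sup>2" by (simp add: power_mult_distrib)
  then show ?thesis unfolding X_def[symmetric]
    by (rule power2_le_imp_le) (use pos E0 nonneg in simp)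
qed

text \<open>By continuity at \<open>\<nu> = 1\<close>; finiteness lets one \<open>\<nu>\<close> serve for all indices. It turns the strict
  inequalities of the hypotheses into a definite fraction of dissipation that is left over.\<close>

lemma uniform_gap:
  fixes X Y :: "nat \<Rightarrow> real"
  assumes "finite I" "\<And>i. i \<in> I \<Longrightarrow> X i < Y i"
  obtains \<nu> where "0 < \<nu>" "\<nu> < 1" "\<And>i. i \<in> I \<Longrightarrow> X i \<le> \<nu>\<^sup>2 * Y i"
proof -
  have "\<forall>\<^sub>F \<nu> in at_left (1::real). \<forall>i\<in>I. X i < \<nu>\<^sup>2 * Y i"
  proof (rule eventually_ball_finite[OF assms(1)], rule ballI)
    fix i assume "i \<in> I"
    have "((\<lambda>\<nu>::real. \<nu>\<^sup>2 * Y i) \<longlongrightarrow> 1\<^sup>2 * Y i) (at_left 1)" by (intro tendsto_intros)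
    then show "\<forall>\<^sub>F \<nu> in at_left (1::real). X i < \<nu>\<^sup>2 * Y i"
      by (rule order_tendstoD) (use assms(2)[OF \<open>i \<in> I\<close>] in simp)
  qed
  moreover have "\<forall>\<^sub>F \<nu> in at_left (1::real). \<nu> \<in> {0<..<1}"
    by (rule eventually_at_left_real) simp
  ultimately have "\<forall>\<^sub>F \<nu> in at_left (1::real). (\<forall>i\<in>I. X i < \<nu>\<^sup>2 * Y i) \<and> \<nu> \<in> {0<..<1}"
    by (rule eventually_conj)
  then obtain \<nu> where "\<forall>i\<in>I. X i < \<nu>\<^sup>2 * Y i" "\<nu> \<in> {0<..<1}"
    using eventually_happens'[of "at_left (1::real)"] by force
  then show thesis using that[of \<nu>] by (auto intro: less_imp_le)
qed

section \<open>The inverse matrix\<close>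

lemma mat_inverse_entries:
  fixes A :: "real mat"
  assumes A: "A \<in> carrier_mat n n" and det: "Determinant.det A \<noteq> 0"
  defines "C \<equiv> the (mat_inverse A)"
  assumes ij: "i < n" "j < n"
  shows "(\<Sum>k<n. A $$ (i, k) * C $$ (k, j)) = (if i = j then 1 else 0)"
    and "(\<Sum>k<n. C $$ (i, k) * A $$ (k, j)) = (if i = j then 1 else 0)"
    and "C \<in> carrier_mat n n"
proof -
  have "mat_inverse A \<noteq> None"
    using mat_inverse(1)[OF A, of "()"] det_non_zero_imp_unit[OF A det, of "()"] by blast
  then have "mat_inverse A = Some C" unfolding C_def by simp
  from mat_inverse(2)[OF A this] have AC: "A * C = 1\<^sub>m n" "C * A = 1\<^sub>m n" and C: "C \<in> carrier_mat n n" by auto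
  have entry: "(\<Sum>k<n. X $$ (i, k) * Y $$ (k, j)) = (X * Y) $$ (i, j)"
    if "X \<in> carrier_mat n n" "Y \<in> carrier_mat n n" for X Y :: "real mat"
    using that ij by (auto simp: scalar_prod_def atLeast0LessThan intro!: sum.cong)
  show "(\<Sum>k<n. A $$ (i, k) * C $$ (k, j)) = (if i = j then 1 else 0)"
    "(\<Sum>k<n. C $$ (i, k) * A $$ (k, j)) = (if i = j then 1 else 0)"
    unfolding entry[OF A C] entry[OF C A] AC using ij by simp_all
  show "C \<in> carrier_mat n n" by fact
qed

lemma Bmat_inverse:
  assumes det: "Determinant.det (Bmat r \<phi> vphi N) \<noteq> 0"
    and g: "\<forall>i\<in>{1..N}. \<forall>m\<in>{1..N}. g i m = (- the (mat_inverse (Bmat r \<phi> vphi N))) $$ (i - 1, m - 1)"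
    and ij: "i \<in> {1..N}" "j \<in> {1..N}"
  shows "(\<Sum>k=1..N. L2ip r (\<phi> i) (vphi k) * g k j) = (if i = j then 1 else 0)"
    and "(\<Sum>k=1..N. g i k * L2ip r (\<phi> k) (vphi j)) = (if i = j then 1 else 0)"
proof -
  let ?B = "Bmat r \<phi> vphi N"
  let ?C = "the (mat_inverse ?B)"
  have B: "?B \<in> carrier_mat N N" unfolding Bmat_def by simp
  have lt: "i - 1 < N" "j - 1 < N" using ij by auto
  note inv = mat_inverse_entries[OF B det lt]
  have B_row: "?B $$ (i - 1, k) = - L2ip r (\<phi> i) (vphi (k + 1))"
    and B_col: "?B $$ (k, j - 1) = - L2ip r (\<phi> (k + 1)) (vphi j)" if "k < N" for k
    using that ij lt by (simp_all add: Bmat_def L2ip_commute)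
  have g_col: "g (k + 1) j = - ?C $$ (k, j - 1)" and g_row: "g i (k + 1) = - ?C $$ (i - 1, k)" if "k < N" for k
    using g inv(3) that ij lt by simp_all
  have shift: "(\<Sum>k=1..N. f k) = (\<Sum>k<N. f (k + 1))" for f :: "nat \<Rightarrow> real"
    by (rule sum.reindex_bij_witness[of _ "\<lambda>k. k + 1" "\<lambda>k. k - 1"]) auto
  have eq: "i - 1 = j - 1 \<longleftrightarrow> i = j" using ij by auto
  have "(\<Sum>k=1..N. L2ip r (\<phi> i) (vphi k) * g k j) = (\<Sum>k<N. ?B $$ (i - 1, k) * ?C $$ (k, j - 1))"
    unfolding shift by (intro sum.cong refl) (simp only: B_row g_col lessThan_iff minus_mult_minus mult_minus_left mult_minus_right)
  then show "(\<Sum>k=1..N. L2ip r (\<phi> i) (vphi k) * g k j) = (if i = j then 1 else 0)"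
    unfolding inv(1) eq .
  have "(\<Sum>k=1..N. g i k * L2ip r (\<phi> k) (vphi j)) = (\<Sum>k<N. ?C $$ (i - 1, k) * ?B $$ (k, j - 1))"
    unfolding shift by (intro sum.cong refl) (simp only: B_col g_row lessThan_iff minus_mult_minus mult_minus_left mult_minus_right)
  then show "(\<Sum>k=1..N. g i k * L2ip r (\<phi> k) (vphi j)) = (if i = j then 1 else 0)"
    unfolding inv(2) eq .
qed

section \<open>The closed loop\<close>

text \<open>The matrix hypothesis enters through the two products of \<open>g\<close> with the matrix of the numbers
  \<open>\<langle>\<phi>\<^sub>n, vphi\<^sub>i\<rangle>\<close>, which is \<open>- B\<close>.\<close>

locale closed_loop = sturm_liouville_basis r p q a1 a2 b1 b2 \<phi> lam
  for r p q :: "real \<Rightarrow> real" and a1 a2 b1 b2 :: real and \<phi> :: "nat \<Rightarrow> real \<Rightarrow> real" and lam :: "nat \<Rightarrow> real" +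
  fixes N :: nat and \<mu> :: "nat \<Rightarrow> real" and vphi :: "nat \<Rightarrow> real \<Rightarrow> real" and g :: "nat \<Rightarrow> nat \<Rightarrow> real"
    and F :: "(real \<Rightarrow> real) \<Rightarrow> (real \<Rightarrow> real)" and L \<sigma> \<kappa> :: real
  assumes N_pos: "N \<ge> 1" and lam_pos: "lam (N + 1) > 0"
    and mu_pos: "\<And>i. i \<in> {1..N} \<Longrightarrow> \<mu> i > 0"
    and vphi_L2: "\<And>i. i \<in> {1..N} \<Longrightarrow> vphi i \<in> L2w r"
    and vphi_orth: "\<And>i m. i \<in> {1..N} \<Longrightarrow> m \<in> {1..N} \<Longrightarrow> i \<noteq> m \<Longrightarrow> L2ip r (vphi i) (vphi m) = 0"
    and g_right_inverse: "\<And>n m. n \<in> {1..N} \<Longrightarrow> m \<in> {1..N} \<Longrightarrow>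
      (\<Sum>i=1..N. L2ip r (\<phi> n) (vphi i) * g i m) = (if n = m then 1 else 0)"
    and g_left_inverse: "\<And>i j. i \<in> {1..N} \<Longrightarrow> j \<in> {1..N} \<Longrightarrow>
      (\<Sum>m=1..N. g i m * L2ip r (\<phi> m) (vphi j)) = (if i = j then 1 else 0)"
    and F_L2: "\<And>u. u \<in> L2w r \<Longrightarrow> F u \<in> L2w r"
    and F_bound: "\<And>u. u \<in> L2w r \<Longrightarrow> L2norm r (F u) \<le> L * L2norm r u"
    and sigma_pos: "\<sigma> > 0" and kappa_pos: "\<kappa> > 0"
    and cond_mu: "\<And>i. i \<in> {1..N} \<Longrightarrow>
      2 * real N * L\<^sup>2 * (1 + 1 / \<kappa>) * (L2norm r (vphi i))\<^sup>2 * (\<Sum>m=1..N. (g i m)\<^sup>2) < (\<mu> i)\<^sup>2"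
    and cond_lam: "L\<^sup>2 * (1 + \<kappa> * real N) *
      (1 + 2 * real N * (\<Sum>i=1..N. \<Sum>m=1..N. (L2norm r (vphi i))\<^sup>2 * (g i m)\<^sup>2)) < (lam (N + 1))\<^sup>2"
begin

definition \<alpha> :: real where "\<alpha> = 1 + \<kappa> * real N"
definition \<beta> :: real where "\<beta> = 1 + 1 / \<kappa>"
definition Phi :: "nat \<Rightarrow> real" where "Phi i = L2norm r (vphi i)"
definition gain :: "nat \<Rightarrow> real" where "gain i = sqrt (\<Sum>m=1..N. (g i m)\<^sup>2)"
text \<open>The coefficients \<open>\<omega>\<^sub>i\<close> of the functional. They are fixed by the requirement that the dissipation of
  \<open>y\<close> be \<open>lam (N + 1)\<close> times the part of \<open>energy\<close> that depends on \<open>y\<close>.\<close>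

definition weight :: "nat \<Rightarrow> real" where "weight i = lam (N + 1) * \<beta> * (Phi i)\<^sup>2 / (\<alpha> * \<mu> i)"

text \<open>Up to \<open>\<parallel>P w\<parallel>\<^sup>2\<close> and the constant \<open>\<alpha>\<close>, this is the bound on \<open>\<parallel>w + \<Sum>\<^sub>i y\<^sub>i vphi\<^sub>i\<parallel>\<^sup>2\<close> which Young's
  inequality gives.\<close>

definition energy :: "(real \<Rightarrow> real) \<Rightarrow> (nat \<Rightarrow> real) \<Rightarrow> real" where
  "energy w y = (L2norm r (\<lambda>x. w x - proj r \<phi> N w x))\<^sup>2 + \<beta> / \<alpha> * (\<Sum>i=1..N. (Phi i)\<^sup>2 * (y i)\<^sup>2)"

abbreviation modes_sq :: "(real \<Rightarrow> real) \<Rightarrow> real" where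
  "modes_sq w \<equiv> \<Sum>m=1..N. (L2ip r (\<phi> m) w)\<^sup>2"

abbreviation control :: "(real \<Rightarrow> real) \<Rightarrow> (nat \<Rightarrow> real) \<Rightarrow> nat \<Rightarrow> real" where
  "control w y \<equiv> feedback r \<phi> lam N vphi F g \<sigma> w y"

abbreviation rate :: "(real \<Rightarrow> real) \<Rightarrow> (nat \<Rightarrow> real) \<Rightarrow> real \<Rightarrow> real" where
  "rate w y \<equiv> w_rate p q r N vphi F w y (control w y)"

lemma alpha_pos: "\<alpha> > 0"
  unfolding \<alpha>_def using kappa_pos by (intro add_pos_nonneg) auto

lemma beta_pos: "\<beta> > 0"
  unfolding \<beta>_def using kappa_pos by (intro add_pos_nonneg) auto

lemma gain_sq: "(gain i)\<^sup>2 = (\<Sum>m=1..N. (g i m)\<^sup>2)"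
  unfolding gain_def by (simp add: sum_nonneg)

text \<open>A null function \<open>vphi\<^sub>i\<close> would give \<open>B\<close> a zero column.\<close>

lemma Phi_pos:
  assumes i: "i \<in> {1..N}"
  shows "Phi i > 0"
proof (rule ccontr)
  assume "\<not> Phi i > 0"
  then have "L2norm r (vphi i) = 0" unfolding Phi_def using L2norm_nonneg[of "vphi i"] by linarith
  then have "L2ip r (\<phi> m) (vphi i) = 0" if "m \<in> {1..N}" for m
    using L2_Cauchy_Schwarz[OF phi_L2 vphi_L2[OF i], of m] that by auto
  then show False using g_left_inverse[OF i i] by simp
qed

lemma weight_pos: "i \<in> {1..N} \<Longrightarrow> weight i > 0"
  unfolding weight_def
  by (intro divide_pos_pos mult_pos_pos zero_less_power lam_pos beta_pos alpha_pos Phi_pos mu_pos)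

lemma modes_sq_nonneg: "modes_sq w \<ge> 0"
  by (rule sum_nonneg) simp

lemma L2norm_sq_split:
  "w \<in> L2w r \<Longrightarrow> (L2norm r w)\<^sup>2 = modes_sq w + (L2norm r (\<lambda>x. w x - proj r \<phi> N w x))\<^sup>2"
  by (simp add: L2norm_sq_tail)

lemma SL_dom_L2: "w \<in> SL_dom a1 a2 b1 b2 \<Longrightarrow> w \<in> L2w r"
  by (intro L2w_continuous H2_continuous SL_domD)

lemma vphi_sum_L2: "(\<lambda>x. \<Sum>i=1..N. c i * vphi i x) \<in> L2w r"
  by (intro L2w_sum L2w_scale vphi_L2)

lemma lift_eq: "lift N vphi w y = (\<lambda>x. w x + (\<Sum>i=1..N. y i * vphi i x))"
  by (simp add: lift_def fun_eq_iff mult.commute)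

lemma lift_L2: "w \<in> L2w r \<Longrightarrow> lift N vphi w y \<in> L2w r"
  unfolding lift_eq by (intro L2w_add vphi_sum_L2)

lemma vphi_sum_norm: "(L2norm r (\<lambda>x. \<Sum>i=1..N. c i * vphi i x))\<^sup>2 = (\<Sum>i=1..N. (c i)\<^sup>2 * (Phi i)\<^sup>2)"
  unfolding Phi_def by (intro L2norm_sq_orth_sum vphi_L2 vphi_orth) auto

lemma w_rate_L2:
  assumes "w \<in> SL_dom a1 a2 b1 b2"
  shows "w_rate p q r N vphi F w y v \<in> L2w r"
proof -
  have "(\<lambda>x. (F (lift N vphi w y) x - SL_op p q r w x) - (\<Sum>i=1..N. v i * vphi i x)) \<in> L2w r"
    using assms by (intro L2w_diff vphi_sum_L2 F_L2 lift_L2 SL_dom_L2 SL_op_L2 SL_domD)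
  moreover have "(\<lambda>x. (F (lift N vphi w y) x - SL_op p q r w x) - (\<Sum>i=1..N. v i * vphi i x)) = w_rate p q r N vphi F w y v"
    by (simp add: w_rate_def fun_eq_iff)
  ultimately show ?thesis by simp
qed

lemma L2ip_w_rate:
  assumes w: "w \<in> SL_dom a1 a2 b1 b2" and \<psi>: "\<psi> \<in> L2w r"
  shows "L2ip r \<psi> (w_rate p q r N vphi F w y v) = - L2ip r \<psi> (SL_op p q r w)
     - (\<Sum>i=1..N. v i * L2ip r \<psi> (vphi i)) + L2ip r \<psi> (F (lift N vphi w y))"
proof -
  have F: "F (lift N vphi w y) \<in> L2w r" using w by (intro F_L2 lift_L2 SL_dom_L2)
  have A: "SL_op p q r w \<in> L2w r" using w by (intro SL_op_L2 SL_domD)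
  have "w_rate p q r N vphi F w y v = (\<lambda>x. (F (lift N vphi w y) x - SL_op p q r w x) - (\<Sum>i=1..N. v i * vphi i x))"
    by (simp add: w_rate_def fun_eq_iff)
  then have "L2ip r \<psi> (w_rate p q r N vphi F w y v) = L2ip r \<psi> (F (lift N vphi w y))
      - L2ip r \<psi> (SL_op p q r w) - L2ip r \<psi> (\<lambda>x. \<Sum>i=1..N. v i * vphi i x)"
    by (simp only: L2ip_diff_right[OF \<psi> L2w_diff[OF F A] vphi_sum_L2] L2ip_diff_right[OF \<psi> F A])
  also have "L2ip r \<psi> (\<lambda>x. \<Sum>i=1..N. v i * vphi i x) = (\<Sum>i=1..N. v i * L2ip r \<psi> (vphi i))"
    by (intro L2ip_lincomb_right \<psi> vphi_L2)
  finally show ?thesis by simp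
qed

lemma control_eq:
  "control w y i = (\<Sum>m=1..N. g i m * ((\<sigma> - lam m) * L2ip r (\<phi> m) w))
     + (\<Sum>m=1..N. g i m * L2ip r (\<phi> m) (F (lift N vphi w y)))"
  by (simp add: feedback_def mult.assoc)

text \<open>The control is \<open>v = g z\<close> with \<open>z\<^sub>m = (\<sigma> - \<lambda>\<^sub>m) c\<^sub>m + \<langle>\<phi>\<^sub>m, F(u)\<rangle>\<close>, and \<open>\<Sum>\<^sub>i v\<^sub>i \<langle>\<phi>\<^sub>n, vphi\<^sub>i\<rangle> = z\<^sub>n\<close>. So
  \<open>- \<lambda>\<^sub>n c\<^sub>n - z\<^sub>n + \<langle>\<phi>\<^sub>n, F(u)\<rangle>\<close> collapses to \<open>- \<sigma> c\<^sub>n\<close>.\<close>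

lemma closed_loop_modes:
  assumes w: "w \<in> SL_dom a1 a2 b1 b2" and n: "n \<in> {1..N}"
  shows "L2ip r (\<phi> n) (rate w y) = - \<sigma> * L2ip r (\<phi> n) w"
proof -
  let ?c = "\<lambda>m. L2ip r (\<phi> m) w" and ?f = "\<lambda>m. L2ip r (\<phi> m) (F (lift N vphi w y))"
  let ?z = "\<lambda>m. (\<sigma> - lam m) * ?c m + ?f m"
  have v: "control w y i = (\<Sum>m=1..N. g i m * ?z m)" for i
    unfolding control_eq by (simp add: distrib_left sum.distrib)
  have "(\<Sum>i=1..N. control w y i * L2ip r (\<phi> n) (vphi i))
      = (\<Sum>i=1..N. \<Sum>m=1..N. (L2ip r (\<phi> n) (vphi i) * g i m) * ?z m)"
    unfolding v sum_distrib_right by (intro sum.cong refl) (simp only: ac_simps)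
  also have "\<dots> = (\<Sum>m=1..N. (\<Sum>i=1..N. L2ip r (\<phi> n) (vphi i) * g i m) * ?z m)"
    unfolding sum_distrib_right by (rule sum.swap)
  also have "\<dots> = (\<Sum>m=1..N. if n = m then ?z n else 0)"
    using n g_right_inverse by (intro sum.cong) auto
  also have "\<dots> = ?z n" using n by simp
  finally have "(\<Sum>i=1..N. control w y i * L2ip r (\<phi> n) (vphi i)) = ?z n" .
  moreover have "L2ip r (\<phi> n) (SL_op p q r w) = lam n * ?c n"
    using n by (intro L2ip_phi_SL_op w) simp
  moreover have "\<phi> n \<in> L2w r" using n by (intro phi_L2) simp
  ultimately show ?thesis by (simp add: L2ip_w_rate[OF w] algebra_simps)
qed

lemma F_lift_bound:
  assumes w: "w \<in> L2w r"
  shows "(L2norm r (F (lift N vphi w y)))\<^sup>2 \<le> L\<^sup>2 * \<alpha> * (energy w y + modes_sq w)"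
proof -
  let ?Y = "\<Sum>i=1..N. (Phi i)\<^sup>2 * (y i)\<^sup>2"
  have kN: "\<kappa> * real N > 0" using kappa_pos N_pos by simp
  have "(L2norm r (lift N vphi w y))\<^sup>2 \<le> (1 + \<kappa> * real N) * (L2norm r w)\<^sup>2
      + (1 + 1 / (\<kappa> * real N)) * (L2norm r (\<lambda>x. \<Sum>i=1..N. y i * vphi i x))\<^sup>2"
    unfolding lift_eq by (rule L2norm_sq_add_weighted[OF w vphi_sum_L2 kN])
  also have "(L2norm r (\<lambda>x. \<Sum>i=1..N. y i * vphi i x))\<^sup>2 = ?Y"
    unfolding vphi_sum_norm by (simp add: mult.commute)
  also have "(1 + 1 / (\<kappa> * real N)) * ?Y \<le> \<beta> * ?Y"
  proof (rule mult_right_mono)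
    have "\<kappa> * 1 \<le> \<kappa> * real N" using kappa_pos N_pos by (intro mult_left_mono) auto
    then show "1 + 1 / (\<kappa> * real N) \<le> \<beta>" unfolding \<beta>_def using kappa_pos by (simp add: frac_le)
  qed (simp add: sum_nonneg)
  finally have "(L2norm r (lift N vphi w y))\<^sup>2 \<le> \<alpha> * (L2norm r w)\<^sup>2 + \<beta> * ?Y"
    by (simp add: \<alpha>_def)
  also have "\<dots> = \<alpha> * (energy w y + modes_sq w)"
    unfolding energy_def L2norm_sq_split[OF w] using alpha_pos by (simp add: field_simps)
  finally have "L\<^sup>2 * (L2norm r (lift N vphi w y))\<^sup>2 \<le> L\<^sup>2 * (\<alpha> * (energy w y + modes_sq w))"
    by (intro mult_left_mono) auto
  moreover have "(L2norm r (F (lift N vphi w y)))\<^sup>2 \<le> (L * L2norm r (lift N vphi w y))\<^sup>2"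
    by (intro power_mono F_bound lift_L2 w L2norm_nonneg)
  ultimately show ?thesis by (simp add: power_mult_distrib)
qed

lemma energy_nonneg: "energy w y \<ge> 0"
  unfolding energy_def using alpha_pos beta_pos
  by (intro add_nonneg_nonneg mult_nonneg_nonneg sum_nonneg) auto

lemma tail_le_energy: "L2norm r (\<lambda>x. w x - proj r \<phi> N w x) \<le> sqrt (energy w y)"
  unfolding energy_def using alpha_pos beta_pos
  by (intro real_le_rsqrt) (simp add: sum_nonneg)

lemma component_le_energy:
  assumes i: "i \<in> {1..N}"
  shows "\<bar>y i\<bar> \<le> sqrt (energy w y) / (sqrt (\<beta> / \<alpha>) * Phi i)"
proof -
  have "(Phi i)\<^sup>2 * (y i)\<^sup>2 \<le> (\<Sum>i=1..N. (Phi i)\<^sup>2 * (y i)\<^sup>2)"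
    using i by (intro member_le_sum[of i "{1..N}" "\<lambda>i. (Phi i)\<^sup>2 * (y i)\<^sup>2"]) auto
  then have "\<beta> / \<alpha> * ((Phi i)\<^sup>2 * (y i)\<^sup>2) \<le> \<beta> / \<alpha> * (\<Sum>i=1..N. (Phi i)\<^sup>2 * (y i)\<^sup>2)"
    using alpha_pos beta_pos by (intro mult_left_mono) auto
  also have "\<dots> \<le> energy w y" unfolding energy_def by simp
  finally have "(sqrt (\<beta> / \<alpha>) * Phi i * \<bar>y i\<bar>)\<^sup>2 \<le> energy w y"
    using alpha_pos beta_pos by (simp add: power_mult_distrib mult.assoc)
  then have "sqrt (\<beta> / \<alpha>) * Phi i * \<bar>y i\<bar> \<le> sqrt (energy w y)" by (rule real_le_rsqrt)
  moreover have "sqrt (\<beta> / \<alpha>) * Phi i > 0" using alpha_pos beta_pos Phi_pos[OF i] by simp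
  ultimately show ?thesis by (simp add: pos_le_divide_eq mult.commute)
qed

text \<open>The part of the feedback that is linear in the modes contributes products of \<open>\<parallel>P w\<parallel>\<close> with
  \<open>\<parallel>T\<parallel>\<close> or \<open>\<bar>y\<^sub>i\<bar>\<close>. The size of the constant is irrelevant, as \<open>R\<close> is chosen after it.\<close>

lemma linear_coupling_bound:
  obtains C where "\<And>w y. w \<in> L2w r \<Longrightarrow>
    (\<Sum>i=1..N. (\<Sum>m=1..N. g i m * ((\<sigma> - lam m) * L2ip r (\<phi> m) w)) *
        (weight i * y i - L2ip r (\<lambda>x. w x - proj r \<phi> N w x) (vphi i)))
      \<le> C * sqrt (modes_sq w) * sqrt (energy w y)"
proof
  define H where "H i = sqrt (\<Sum>m=1..N. (g i m * (\<sigma> - lam m))\<^sup>2)" for i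
  define D where "D i = weight i / (sqrt (\<beta> / \<alpha>) * Phi i) + Phi i" for i
  fix w y assume w: "w \<in> L2w r"
  let ?T = "\<lambda>x. w x - proj r \<phi> N w x" and ?k = "sqrt (modes_sq w)" and ?s = "sqrt (energy w y)"
  let ?l = "\<lambda>i. \<Sum>m=1..N. g i m * ((\<sigma> - lam m) * L2ip r (\<phi> m) w)"
  have "?l i * (weight i * y i - L2ip r ?T (vphi i)) \<le> H i * D i * (?k * ?s)" if i: "i \<in> {1..N}" for i
  proof -
    have 1: "\<bar>?l i\<bar> \<le> H i * ?k"
      unfolding H_def mult.assoc[symmetric] by (rule sum_mult_le_sqrt)
    have "\<bar>weight i * y i\<bar> \<le> weight i * (?s / (sqrt (\<beta> / \<alpha>) * Phi i))"
      unfolding abs_mult abs_of_pos[OF weight_pos[OF i]]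
      using weight_pos[OF i] by (intro mult_left_mono component_le_energy[OF i]) simp
    moreover have "\<bar>L2ip r ?T (vphi i)\<bar> \<le> ?s * Phi i"
    proof -
      have "\<bar>L2ip r ?T (vphi i)\<bar> \<le> L2norm r ?T * Phi i"
        unfolding Phi_def by (rule L2_Cauchy_Schwarz[OF tail_L2[OF w] vphi_L2[OF i]])
      also have "\<dots> \<le> ?s * Phi i" using Phi_pos[OF i] by (intro mult_right_mono tail_le_energy) simp
      finally show ?thesis .
    qed
    ultimately have 2: "\<bar>weight i * y i - L2ip r ?T (vphi i)\<bar> \<le> D i * ?s"
      unfolding D_def using abs_triangle_ineq4[of "weight i * y i" "L2ip r ?T (vphi i)"]
      by (simp only: distrib_right times_divide_eq_left times_divide_eq_right mult.commute[of "Phi i" ?s])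
    have "?l i * (weight i * y i - L2ip r ?T (vphi i)) \<le> \<bar>?l i\<bar> * \<bar>weight i * y i - L2ip r ?T (vphi i)\<bar>"
      unfolding abs_mult[symmetric] by (rule abs_ge_self)
    also have "\<dots> \<le> (H i * ?k) * (D i * ?s)"
      by (rule mult_mono[OF 1 2]) (use order_trans[OF abs_ge_zero 1] in auto)
    finally show ?thesis by (simp only: ac_simps)
  qed
  then have "(\<Sum>i=1..N. ?l i * (weight i * y i - L2ip r ?T (vphi i))) \<le> (\<Sum>i=1..N. H i * D i * (?k * ?s))"
    by (rule sum_mono)
  then show "(\<Sum>i=1..N. ?l i * (weight i * y i - L2ip r ?T (vphi i))) \<le> (\<Sum>i=1..N. H i * D i) * ?k * ?s"
    by (simp only: sum_distrib_right mult.assoc)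
qed

text \<open>The three groups of terms that are estimated separately: dissipation, coupling linear in the
  modes, and coupling through \<open>F\<close>.\<close>

lemma Vdot_split:
  fixes y :: "nat \<Rightarrow> real"
  assumes w: "w \<in> SL_dom a1 a2 b1 b2"
  defines "T \<equiv> \<lambda>x. w x - proj r \<phi> N w x" and "f \<equiv> F (lift N vphi w y)"
  defines "s \<equiv> \<lambda>i. \<Sum>m=1..N. g i m * L2ip r (\<phi> m) f"
  shows "Vdot r \<phi> N \<mu> R 1 weight w y (rate w y) (control w y)
    = - (R * \<sigma> * modes_sq w) - (\<Sum>i=1..N. \<mu> i * weight i * (y i)\<^sup>2) - L2ip r T (SL_op p q r w)
      + (\<Sum>i=1..N. (\<Sum>m=1..N. g i m * ((\<sigma> - lam m) * L2ip r (\<phi> m) w)) * (weight i * y i - L2ip r T (vphi i)))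
      + (L2ip r T f - L2ip r T (\<lambda>x. \<Sum>i=1..N. s i * vphi i x) + (\<Sum>i=1..N. weight i * y i * s i))"
proof -
  note wL = SL_dom_L2[OF w]
  have T: "T \<in> L2w r" unfolding T_def by (rule tail_L2[OF wL])
  let ?l = "\<lambda>i. \<Sum>m=1..N. g i m * ((\<sigma> - lam m) * L2ip r (\<phi> m) w)"
  have v: "control w y i = ?l i + s i" for i unfolding control_eq s_def f_def ..
  have modes: "(\<Sum>n=1..N. L2ip r (\<phi> n) w * L2ip r (\<phi> n) (rate w y)) = - \<sigma> * modes_sq w"
    unfolding sum_distrib_left by (intro sum.cong refl) (simp add: closed_loop_modes[OF w] power2_eq_square)
  have tail: "L2ip r T (\<lambda>x. rate w y x - proj r \<phi> N (rate w y) x)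
      = - L2ip r T (SL_op p q r w) - (\<Sum>i=1..N. control w y i * L2ip r T (vphi i)) + L2ip r T f"
    unfolding T_def L2ip_tail_tail[OF wL w_rate_L2[OF w]]
    unfolding T_def[symmetric] f_def by (rule L2ip_w_rate[OF w T])
  have "(\<Sum>i=1..N. weight i * y i * control w y i) - (\<Sum>i=1..N. control w y i * L2ip r T (vphi i))
      = (\<Sum>i=1..N. ?l i * (weight i * y i - L2ip r T (vphi i))) + (\<Sum>i=1..N. weight i * y i * s i)
        - (\<Sum>i=1..N. s i * L2ip r T (vphi i))"
    unfolding v sum.distrib[symmetric] sum_subtractf[symmetric]
    by (intro sum.cong refl) (simp add: algebra_simps)
  moreover have "L2ip r T (\<lambda>x. \<Sum>i=1..N. s i * vphi i x) = (\<Sum>i=1..N. s i * L2ip r T (vphi i))"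
    by (intro L2ip_lincomb_right T vphi_L2)
  ultimately show ?thesis
    unfolding Vdot_def modes T_def[symmetric] tail by simp
qed

text \<open>The tail \<open>T\<close> sees \<open>F(u)\<close> directly only through \<open>F(u) - P F(u)\<close>, and sees the feedback only
  through \<open>P F(u)\<close>; orthogonality of the \<open>vphi\<^sub>i\<close> makes the norm of \<open>\<Sum>\<^sub>i s\<^sub>i vphi\<^sub>i\<close> Euclidean.\<close>

lemma nonlinear_coupling_bound:
  assumes w: "w \<in> L2w r" and f: "f \<in> L2w r"
  defines "T \<equiv> \<lambda>x. w x - proj r \<phi> N w x"
  defines "s \<equiv> \<lambda>i. \<Sum>m=1..N. g i m * L2ip r (\<phi> m) f"
  shows "L2ip r T f - L2ip r T (\<lambda>x. \<Sum>i=1..N. s i * vphi i x) + (\<Sum>i=1..N. weight i * y i * s i)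
    \<le> L2norm r T * L2norm r (\<lambda>x. f x - proj r \<phi> N f x)
      + (L2norm r T * sqrt (\<Sum>i=1..N. (Phi i)\<^sup>2 * (gain i)\<^sup>2) + (\<Sum>i=1..N. weight i * \<bar>y i\<bar> * gain i)) * sqrt (modes_sq f)"
proof -
  let ?b = "sqrt (modes_sq f)"
  have T: "T \<in> L2w r" unfolding T_def by (rule tail_L2[OF w])
  have s: "\<bar>s i\<bar> \<le> gain i * ?b" for i unfolding s_def gain_def by (rule sum_mult_le_sqrt)
  have "L2ip r T f = L2ip r T (\<lambda>x. f x - proj r \<phi> N f x)"
    unfolding T_def by (rule L2ip_tail_tail[OF w f, symmetric])
  also have "\<dots> \<le> L2norm r T * L2norm r (\<lambda>x. f x - proj r \<phi> N f x)"
    using L2_Cauchy_Schwarz[OF T tail_L2[OF f]] by (rule order_trans[OF abs_ge_self])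
  finally have 1: "L2ip r T f \<le> L2norm r T * L2norm r (\<lambda>x. f x - proj r \<phi> N f x)" .
  have "(L2norm r (\<lambda>x. \<Sum>i=1..N. s i * vphi i x))\<^sup>2 = (\<Sum>i=1..N. \<bar>s i\<bar>\<^sup>2 * (Phi i)\<^sup>2)"
    unfolding vphi_sum_norm by simp
  also have "\<dots> \<le> (\<Sum>i=1..N. (gain i * ?b)\<^sup>2 * (Phi i)\<^sup>2)"
    by (intro sum_mono mult_right_mono power_mono s) auto
  also have "\<dots> = (sqrt (\<Sum>i=1..N. (Phi i)\<^sup>2 * (gain i)\<^sup>2) * ?b)\<^sup>2"
    by (simp add: power_mult_distrib sum_nonneg modes_sq_nonneg sum_distrib_right sum_distrib_left mult.commute mult.left_commute)
  finally have 2: "L2norm r (\<lambda>x. \<Sum>i=1..N. s i * vphi i x) \<le> sqrt (\<Sum>i=1..N. (Phi i)\<^sup>2 * (gain i)\<^sup>2) * ?b"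
    by (rule power2_le_imp_le) (simp add: sum_nonneg modes_sq_nonneg)
  have "- L2ip r T (\<lambda>x. \<Sum>i=1..N. s i * vphi i x) \<le> L2norm r T * L2norm r (\<lambda>x. \<Sum>i=1..N. s i * vphi i x)"
    using L2_Cauchy_Schwarz[OF T vphi_sum_L2, of s] by linarith
  also have "\<dots> \<le> L2norm r T * (sqrt (\<Sum>i=1..N. (Phi i)\<^sup>2 * (gain i)\<^sup>2) * ?b)"
    by (intro mult_left_mono 2 L2norm_nonneg)
  finally have 3: "- L2ip r T (\<lambda>x. \<Sum>i=1..N. s i * vphi i x) \<le> L2norm r T * (sqrt (\<Sum>i=1..N. (Phi i)\<^sup>2 * (gain i)\<^sup>2) * ?b)" .
  have "(\<Sum>i=1..N. weight i * y i * s i) \<le> (\<Sum>i=1..N. weight i * \<bar>y i\<bar> * gain i * ?b)"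
  proof (rule sum_mono)
    fix i assume i: "i \<in> {1..N}"
    have "weight i * y i * s i = weight i * (y i * s i)" by simp
    also have "\<dots> \<le> weight i * (\<bar>y i\<bar> * (gain i * ?b))"
    proof (rule mult_left_mono)
      have "y i * s i \<le> \<bar>y i\<bar> * \<bar>s i\<bar>" unfolding abs_mult[symmetric] by (rule abs_ge_self)
      also have "\<dots> \<le> \<bar>y i\<bar> * (gain i * ?b)" by (intro mult_left_mono s) simp
      finally show "y i * s i \<le> \<bar>y i\<bar> * (gain i * ?b)" .
    qed (use weight_pos[OF i] in simp)
    finally show "weight i * y i * s i \<le> weight i * \<bar>y i\<bar> * gain i * ?b" by (simp only: mult.assoc)
  qed
  then have 4: "(\<Sum>i=1..N. weight i * y i * s i) \<le> (\<Sum>i=1..N. weight i * \<bar>y i\<bar> * gain i) * ?b"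
    by (simp only: sum_distrib_right)
  from 1 3 4 show ?thesis by (simp only: distrib_right mult.assoc)
qed

lemma mu_weight_energy:
  "(\<Sum>i=1..N. \<mu> i * weight i * (y i)\<^sup>2) = lam (N + 1) * (\<beta> / \<alpha> * (\<Sum>i=1..N. (Phi i)\<^sup>2 * (y i)\<^sup>2))"
  unfolding sum_distrib_left
proof (intro sum.cong refl)
  fix i assume "i \<in> {1..N}"
  then show "\<mu> i * weight i * (y i)\<^sup>2 = lam (N + 1) * (\<beta> / \<alpha> * ((Phi i)\<^sup>2 * (y i)\<^sup>2))"
    using mu_pos[of i] alpha_pos unfolding weight_def by (simp add: field_simps)
qed

lemma energy_coercive:
  obtains m where "m > 0" "\<And>w y. w \<in> L2w r \<Longrightarrow>
    m * ((L2norm r w)\<^sup>2 + (\<Sum>i=1..N. (y i)\<^sup>2)) \<le> energy w y + modes_sq w"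
proof
  let ?S = "insert 1 ((\<lambda>i. \<beta> / \<alpha> * (Phi i)\<^sup>2) ` {1..N})"
  define m where "m = Min ?S"
  have "\<beta> / \<alpha> * (Phi i)\<^sup>2 > 0" if "i \<in> {1..N}" for i
    by (intro mult_pos_pos divide_pos_pos zero_less_power alpha_pos beta_pos Phi_pos that)
  then have "\<forall>s\<in>?S. s > 0" by auto
  then show m0: "m > 0" unfolding m_def by (simp add: Min_gr_iff)
  have m: "m \<le> s" if "s \<in> ?S" for s unfolding m_def using that by (intro Min_le) auto
  fix w y assume w: "w \<in> L2w r"
  let ?e = "(L2norm r (\<lambda>x. w x - proj r \<phi> N w x))\<^sup>2"
  have "m * (modes_sq w + ?e) \<le> 1 * (modes_sq w + ?e)"
    using m[of 1] by (intro mult_right_mono add_nonneg_nonneg modes_sq_nonneg) auto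
  moreover have "m * (\<Sum>i=1..N. (y i)\<^sup>2) \<le> \<beta> / \<alpha> * (\<Sum>i=1..N. (Phi i)\<^sup>2 * (y i)\<^sup>2)"
    unfolding sum_distrib_left mult.assoc[symmetric]
    by (intro sum_mono mult_right_mono m) auto
  ultimately show "m * ((L2norm r w)\<^sup>2 + (\<Sum>i=1..N. (y i)\<^sup>2)) \<le> energy w y + modes_sq w"
    unfolding L2norm_sq_split[OF w] energy_def by (simp add: distrib_left)
qed

lemma gap:
  obtains \<nu> where "0 < \<nu>" "\<nu> < 1"
    "\<alpha> * L\<^sup>2 * (1 + 2 * real N * (\<Sum>i=1..N. (Phi i)\<^sup>2 * (gain i)\<^sup>2)) \<le> \<nu>\<^sup>2 * (lam (N + 1))\<^sup>2"
    "\<And>i. i \<in> {1..N} \<Longrightarrow> 2 * real N * L\<^sup>2 * \<beta> * (Phi i)\<^sup>2 * (gain i)\<^sup>2 \<le> \<nu>\<^sup>2 * (\<mu> i)\<^sup>2"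
proof -
  let ?X = "\<lambda>i. if i = 0 then \<alpha> * L\<^sup>2 * (1 + 2 * real N * (\<Sum>i=1..N. (Phi i)\<^sup>2 * (gain i)\<^sup>2))
    else 2 * real N * L\<^sup>2 * \<beta> * (Phi i)\<^sup>2 * (gain i)\<^sup>2"
  let ?Y = "\<lambda>i. if i = 0 then (lam (N + 1))\<^sup>2 else (\<mu> i)\<^sup>2"
  have "?X 0 < ?Y 0"
    using cond_lam by (simp add: Phi_def gain_sq \<alpha>_def sum_distrib_left mult.commute)
  moreover have "?X i < ?Y i" if "i \<in> {1..N}" for i
    using cond_mu[OF that] that by (simp add: Phi_def gain_sq \<beta>_def)
  ultimately have lt: "?X i < ?Y i" if "i \<in> {0..N}" for i
    using that by (cases "i = 0") auto
  obtain \<nu> where \<nu>: "0 < \<nu>" "\<nu> < 1" "\<And>i. i \<in> {0..N} \<Longrightarrow> ?X i \<le> \<nu>\<^sup>2 * ?Y i"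
    using uniform_gap[of "{0..N}" ?X ?Y, OF finite_atLeastAtMost lt] by blast
  show thesis
  proof (rule that[OF \<nu>(1,2)])
    show "\<alpha> * L\<^sup>2 * (1 + 2 * real N * (\<Sum>i=1..N. (Phi i)\<^sup>2 * (gain i)\<^sup>2)) \<le> \<nu>\<^sup>2 * (lam (N + 1))\<^sup>2"
      using \<nu>(3)[of 0] by simp
    show "2 * real N * L\<^sup>2 * \<beta> * (Phi i)\<^sup>2 * (gain i)\<^sup>2 \<le> \<nu>\<^sup>2 * (\<mu> i)\<^sup>2" if "i \<in> {1..N}" for i
      using \<nu>(3)[of i] that by simp
  qed
qed

text \<open>With \<open>l = lam (N + 1)\<close> and \<open>K = \<parallel>P w\<parallel>\<^sup>2\<close>, the estimates leave
  \<open>- R \<sigma> K - l E + C sqrt K sqrt E + \<nu> l (E + K / 2)\<close>. Half of the remaining dissipation \<open>(1 - \<nu>) l E\<close>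
  absorbs the mixed term; the terms in \<open>K\<close> that this produces are absorbed by \<open>R\<close>.\<close>

proposition Vdot_negative:
  obtains R \<theta> where "R > 0" "\<theta> > 0"
    "\<And>w y. w \<in> SL_dom a1 a2 b1 b2 \<Longrightarrow> Vdot r \<phi> N \<mu> R 1 weight w y (rate w y) (control w y)
        \<le> - \<theta> * ((L2norm r w)\<^sup>2 + (\<Sum>i=1..N. (y i)\<^sup>2))"
proof -
  let ?l1 = "lam (N + 1)" and ?S = "\<Sum>i=1..N. (Phi i)\<^sup>2 * (gain i)\<^sup>2"
  obtain \<nu> where \<nu>: "0 < \<nu>" "\<nu> < 1" and gap_lam: "\<alpha> * L\<^sup>2 * (1 + 2 * real N * ?S) \<le> \<nu>\<^sup>2 * ?l1\<^sup>2"
    and gap_mu: "\<And>i. i \<in> {1..N} \<Longrightarrow> 2 * real N * L\<^sup>2 * \<beta> * (Phi i)\<^sup>2 * (gain i)\<^sup>2 \<le> \<nu>\<^sup>2 * (\<mu> i)\<^sup>2"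
    using gap by blast
  obtain C where C: "\<And>w y. w \<in> L2w r \<Longrightarrow>
    (\<Sum>i=1..N. (\<Sum>m=1..N. g i m * ((\<sigma> - lam m) * L2ip r (\<phi> m) w)) *
        (weight i * y i - L2ip r (\<lambda>x. w x - proj r \<phi> N w x) (vphi i)))
      \<le> C * sqrt (modes_sq w) * sqrt (energy w y)"
    by (rule linear_coupling_bound) blast
  obtain m where m: "m > 0" "\<And>w y. w \<in> L2w r \<Longrightarrow>
    m * ((L2norm r w)\<^sup>2 + (\<Sum>i=1..N. (y i)\<^sup>2)) \<le> energy w y + modes_sq w"
    by (rule energy_coercive) blast
  \<comment> \<open>One half of the dissipation that the nonlinear coupling leaves over.\<close>
  define \<delta> where "\<delta> = (1 - \<nu>) * ?l1 / 2"
  have \<delta>: "\<delta> > 0" unfolding \<delta>_def using \<nu> lam_pos by simp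
  \<comment> \<open>The three summands pay for the nonlinear coupling, for the mixed term, and for decay in \<open>\<parallel>P w\<parallel>\<^sup>2\<close>.\<close>
  define R where "R = (\<nu> * ?l1 / 2 + C\<^sup>2 / (4 * \<delta>) + \<delta>) / \<sigma>"
  have R\<sigma>: "R * \<sigma> = \<nu> * ?l1 / 2 + C\<^sup>2 / (4 * \<delta>) + \<delta>" unfolding R_def using sigma_pos by simp
  have "\<nu> * ?l1 / 2 + C\<^sup>2 / (4 * \<delta>) + \<delta> > 0"
    using \<nu> lam_pos \<delta> by (intro add_nonneg_pos add_nonneg_nonneg) auto
  then have "R > 0" unfolding R_def using sigma_pos by simp
  moreover have "\<delta> * m > 0" using \<delta> m by simp
  moreover have "Vdot r \<phi> N \<mu> R 1 weight w y (rate w y) (control w y)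
      \<le> - (\<delta> * m) * ((L2norm r w)\<^sup>2 + (\<Sum>i=1..N. (y i)\<^sup>2))" if w: "w \<in> SL_dom a1 a2 b1 b2" for w y
  proof -
    note wL = SL_dom_L2[OF w]
    define T where "T = (\<lambda>x. w x - proj r \<phi> N w x)"
    define f where "f = F (lift N vphi w y)"
    define s where "s = (\<lambda>i. \<Sum>m=1..N. g i m * L2ip r (\<phi> m) f)"
    define E where "E = energy w y"
    define K where "K = modes_sq w"
    have f: "f \<in> L2w r" unfolding f_def by (intro F_L2 lift_L2 wL)
    have E0: "E \<ge> 0" and K0: "K \<ge> 0" unfolding E_def K_def by (rule energy_nonneg, rule modes_sq_nonneg)
    have "(L2norm r (\<lambda>x. f x - proj r \<phi> N f x))\<^sup>2 + (sqrt (modes_sq f))\<^sup>2 = (L2norm r f)\<^sup>2"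
      unfolding L2norm_sq_split[OF f] real_sqrt_pow2[OF modes_sq_nonneg] by simp
    then have ab: "(L2norm r (\<lambda>x. f x - proj r \<phi> N f x))\<^sup>2 + (sqrt (modes_sq f))\<^sup>2 \<le> L\<^sup>2 * \<alpha> * (E + K)"
      unfolding E_def K_def f_def using F_lift_bound[OF wL] by simp
    have nl: "L2ip r T f - L2ip r T (\<lambda>x. \<Sum>i=1..N. s i * vphi i x) + (\<Sum>i=1..N. weight i * y i * s i)
        \<le> \<nu> * ?l1 * (E + K / 2)"
      unfolding T_def s_def
      by (rule order_trans[OF nonlinear_coupling_bound[OF wL f]],
          rule coupling_estimate[OF N_pos lam_pos alpha_pos beta_pos \<nu>(1) L2norm_nonneg K0 mu_pos
            weight_def refl _ gap_lam gap_mu ab])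
         (simp_all add: E_def energy_def)
    have lin: "(\<Sum>i=1..N. (\<Sum>m=1..N. g i m * ((\<sigma> - lam m) * L2ip r (\<phi> m) w)) * (weight i * y i - L2ip r T (vphi i)))
        \<le> C * sqrt K * sqrt E"
      unfolding T_def K_def E_def by (rule C[OF wL])
    have "0 \<le> (C * sqrt K / (2 * sqrt \<delta>) - sqrt \<delta> * sqrt E)\<^sup>2" by simp
    also have "\<dots> = C\<^sup>2 * K / (4 * \<delta>) + \<delta> * E - C * sqrt K * sqrt E"
      using \<delta> E0 K0 by (simp add: power2_diff power_mult_distrib power_divide)
    finally have young: "C * sqrt K * sqrt E \<le> C\<^sup>2 * K / (4 * \<delta>) + \<delta> * E" by simp
    have diss: "?l1 * E \<le> (\<Sum>i=1..N. \<mu> i * weight i * (y i)\<^sup>2) + L2ip r T (SL_op p q r w)"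
      using L2ip_tail_SL_op[OF w, of N] unfolding mu_weight_energy E_def energy_def T_def distrib_left by linarith
    have "Vdot r \<phi> N \<mu> R 1 weight w y (rate w y) (control w y)
        \<le> - (R * \<sigma> * K) - ?l1 * E + (C\<^sup>2 * K / (4 * \<delta>) + \<delta> * E) + \<nu> * ?l1 * (E + K / 2)"
      using Vdot_split[OF w, of R y] lin young diss nl
      unfolding T_def s_def f_def K_def by linarith
    also have "\<dots> = - \<delta> * (E + K)"
      unfolding R\<sigma> using \<delta> by (simp add: \<delta>_def field_simps)
    also have "\<dots> \<le> - \<delta> * (m * ((L2norm r w)\<^sup>2 + (\<Sum>i=1..N. (y i)\<^sup>2)))"
      using m(2)[OF wL, of y] \<delta> unfolding E_def K_def by simp
    finally show ?thesis by simp
  qed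
  ultimately show thesis using that by blast
qed

end

section \<open>The Lyapunov functional and the decay of solutions\<close>

lemma class_Kinf_square:
  assumes "a > 0"
  shows "class_Kinf (\<lambda>s. a * s\<^sup>2)"
  unfolding class_Kinf_def
proof (intro conjI)
  show "continuous_on {0..} (\<lambda>s. a * s\<^sup>2)" by (intro continuous_intros)
  show "strict_mono_on {0..} (\<lambda>s. a * s\<^sup>2)"
    using assms by (intro strict_mono_onI) (simp add: power_strict_mono)
  show "filterlim (\<lambda>s. a * s\<^sup>2) at_top at_top"
    using assms by (intro filterlim_tendsto_pos_mult_at_top[OF tendsto_const] filterlim_pow_at_top filterlim_ident) auto
qed simp

text \<open>The time derivative of a solution and the right-hand side of the equation are the same element
  of the weighted \<open>L\<^sup>2\<close> space, but different representatives.\<close>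

lemma (in orthonormal_L2) Vdot_cong_AE:
  assumes w: "w \<in> L2w r" and wd: "wd \<in> L2w r" "wd' \<in> L2w r" and eq: "AE x in I01. wd x = wd' x"
  shows "Vdot r \<phi> N \<mu> R \<gamma> \<omega> w y wd v = Vdot r \<phi> N \<mu> R \<gamma> \<omega> w y wd' v"
proof -
  have ip: "L2ip r \<psi> wd = L2ip r \<psi> wd'" if "\<psi> \<in> L2w r" for \<psi>
    using wd that eq by (intro L2ip_cong_AE L2wD r_measurable)
  have "L2ip r (\<phi> n) wd = L2ip r (\<phi> n) wd'" if "n \<in> {1..N}" for n
    using that by (intro ip phi_L2) simp
  then have "(\<Sum>n=1..N. L2ip r (\<phi> n) w * L2ip r (\<phi> n) wd) = (\<Sum>n=1..N. L2ip r (\<phi> n) w * L2ip r (\<phi> n) wd')"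
    by (intro sum.cong refl) simp
  moreover have "L2ip r (\<lambda>x. w x - proj r \<phi> N w x) wd = L2ip r (\<lambda>x. w x - proj r \<phi> N w x) wd'"
    by (rule ip[OF tail_L2[OF w]])
  ultimately show ?thesis
    unfolding Vdot_def by (simp only: L2ip_tail_tail[OF w wd(1)] L2ip_tail_tail[OF w wd(2)])
qed

context closed_loop
begin

lemma Vfun_weight_bounds:
  assumes "R > 0"
  shows "\<exists>a>0. \<exists>b>0. \<forall>w\<in>L2w r. \<forall>y. a * (state_norm r N w y)\<^sup>2 \<le> Vfun r \<phi> N R 1 weight w y
      \<and> Vfun r \<phi> N R 1 weight w y \<le> b * (state_norm r N w y)\<^sup>2"
  by (rule Vfun_bounds[OF assms]) (simp, rule weight_pos)

lemma control_Lyapunov_functional_Vfun: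
  assumes "R > 0" "\<theta> > 0"
    and neg: "\<And>w y. w \<in> SL_dom a1 a2 b1 b2 \<Longrightarrow> Vdot r \<phi> N \<mu> R 1 weight w y (rate w y) (control w y)
        \<le> - \<theta> * ((L2norm r w)\<^sup>2 + (\<Sum>i=1..N. (y i)\<^sup>2))"
  shows "control_Lyapunov_functional p q r a1 a2 b1 b2 N \<mu> vphi F (Vfun r \<phi> N R 1 weight)"
  unfolding control_Lyapunov_functional_def
proof (intro conjI)
  show "\<forall>w\<in>L2w r. \<forall>y. \<forall>\<epsilon>>0. \<exists>\<delta>>0. \<forall>w'\<in>L2w r. \<forall>y'.
      state_norm r N (\<lambda>x. w' x - w x) (\<lambda>i. y' i - y i) < \<delta> \<longrightarrow>
      \<bar>Vfun r \<phi> N R 1 weight w' y' - Vfun r \<phi> N R 1 weight w y\<bar> < \<epsilon>"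
    by (intro ballI allI impI) (rule Vfun_continuous)
  obtain a b where ab: "a > 0" "b > 0"
    "\<And>w y. w \<in> L2w r \<Longrightarrow> a * (state_norm r N w y)\<^sup>2 \<le> Vfun r \<phi> N R 1 weight w y"
    "\<And>w y. w \<in> L2w r \<Longrightarrow> Vfun r \<phi> N R 1 weight w y \<le> b * (state_norm r N w y)\<^sup>2"
    using Vfun_weight_bounds[OF \<open>R > 0\<close>] by blast
  show "\<exists>\<alpha>1 \<alpha>2. class_Kinf \<alpha>1 \<and> class_Kinf \<alpha>2 \<and> (\<forall>w\<in>L2w r. \<forall>y.
      \<alpha>1 (state_norm r N w y) \<le> Vfun r \<phi> N R 1 weight w y \<and> Vfun r \<phi> N R 1 weight w y \<le> \<alpha>2 (state_norm r N w y))"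
    using ab by (intro exI[of _ "\<lambda>s. a * s\<^sup>2"] exI[of _ "\<lambda>s. b * s\<^sup>2"]) (auto intro: class_Kinf_square)
  show "\<exists>\<alpha>3. continuous_on {0..} \<alpha>3 \<and> \<alpha>3 0 = 0 \<and> (\<forall>s>0. \<alpha>3 s > 0) \<and>
      (\<forall>w\<in>SL_dom a1 a2 b1 b2. \<forall>y. \<exists>v d.
         ((\<lambda>h. Vfun r \<phi> N R 1 weight (\<lambda>x. w x + h * w_rate p q r N vphi F w y v x) (\<lambda>i. y i + h * y_rate \<mu> y v i))
            has_real_derivative d) (at 0) \<and> d \<le> - \<alpha>3 (state_norm r N w y))"
  proof (intro exI[of _ "\<lambda>s. \<theta> * s\<^sup>2"] conjI allI impI ballI)
    show "continuous_on {0..} (\<lambda>s. \<theta> * s\<^sup>2)" by (intro continuous_intros)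
    show "0 < \<theta> * s\<^sup>2" if "0 < s" for s :: real using that \<open>\<theta> > 0\<close> by simp
    fix w y assume w: "w \<in> SL_dom a1 a2 b1 b2"
    note wL = SL_dom_L2[OF w]
    let ?v = "control w y" and ?w = "\<lambda>h x. w x + h * rate w y x" and ?y = "\<lambda>h i. y i + h * y_rate \<mu> y (control w y) i"
    have "((\<lambda>h. Vfun r \<phi> N R 1 weight (?w h) (?y h)) has_real_derivative
        Vdot r \<phi> N \<mu> R 1 weight (?w 0) (?y 0) (rate w y) ?v) (at 0)"
    proof (rule Vfun_curve_derivative[where w = ?w and y = ?y and t = 0])
      have mem: "?w h \<in> L2w r" for h by (intro L2w_add wL L2w_scale w_rate_L2 w)
      then show "\<forall>\<^sub>F h in at 0. ?w h \<in> L2w r" by simp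
      show "?w 0 \<in> L2w r" by (rule mem)
      show "rate w y \<in> L2w r" by (rule w_rate_L2[OF w])
      have "L2norm r (\<lambda>x. (?w h x - ?w 0 x) / (h - 0) - rate w y x) = 0" if "h \<noteq> 0" for h
        using that by (simp add: L2norm_def L2ip_eq)
      then have "\<forall>\<^sub>F h in at 0. L2norm r (\<lambda>x. (?w h x - ?w 0 x) / (h - 0) - rate w y x) = 0"
        unfolding eventually_at_filter by (intro always_eventually) blast
      then show "((\<lambda>h. L2norm r (\<lambda>x. (?w h x - ?w 0 x) / (h - 0) - rate w y x)) \<longlongrightarrow> 0) (at 0)"
        by (rule tendsto_eventually)
      show "((\<lambda>h. ?y h i) has_real_derivative - \<mu> i * ?y 0 i + ?v i) (at 0)" if "i \<in> {1..N}" for i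
        unfolding y_rate_def by (auto intro!: derivative_eq_intros)
    qed
    then have "((\<lambda>h. Vfun r \<phi> N R 1 weight (?w h) (?y h)) has_real_derivative
        Vdot r \<phi> N \<mu> R 1 weight w y (rate w y) ?v) (at 0)" by simp
    moreover have "Vdot r \<phi> N \<mu> R 1 weight w y (rate w y) ?v \<le> - (\<theta> * (state_norm r N w y)\<^sup>2)"
      using neg[OF w, of y] by (simp add: state_norm_sq)
    ultimately show "\<exists>v d. ((\<lambda>h. Vfun r \<phi> N R 1 weight (\<lambda>x. w x + h * w_rate p q r N vphi F w y v x)
        (\<lambda>i. y i + h * y_rate \<mu> y v i)) has_real_derivative d) (at 0) \<and> d \<le> - (\<theta> * (state_norm r N w y)\<^sup>2)"
      by blast
  qed simp
qed

lemma Vfun_decreasing_along_solutions: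
  assumes sol: "is_solution p q r a1 a2 b1 b2 N \<mu> vphi F w y (\<lambda>t. control (w t) (y t))"
    and neg: "\<And>w y. w \<in> SL_dom a1 a2 b1 b2 \<Longrightarrow> Vdot r \<phi> N \<mu> R 1 weight w y (rate w y) (control w y)
        \<le> - \<theta> * ((L2norm r w)\<^sup>2 + (\<Sum>i=1..N. (y i)\<^sup>2))"
    and "t > 0"
  shows "\<exists>d. ((\<lambda>s. Vfun r \<phi> N R 1 weight (w s) (y s)) has_real_derivative d) (at t)
    \<and> d \<le> - \<theta> * (state_norm r N (w t) (y t))\<^sup>2"
proof -
  have C0: "L2_C0_on r {0..} w" and dom: "\<forall>t>0. w t \<in> SL_dom a1 a2 b1 b2"
    and yd: "\<forall>t>0. \<forall>i\<in>{1..N}. ((\<lambda>s. y s i) has_real_derivative - \<mu> i * y t i + control (w t) (y t) i) (at t)"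
    using sol unfolding is_solution_def by blast+
  obtain wt where wtC: "L2_C0_on r {0<..} wt" and wtd: "L2_has_deriv_on r {0<..} w wt"
    and eq: "\<forall>t>0. AE x in lebesgue. x \<in> {0<..<1} \<longrightarrow> wt t x + SL_op p q r (w t) x
             = F (lift N vphi (w t) (y t)) x - (\<Sum>i=1..N. vphi i x * control (w t) (y t) i)"
    using sol unfolding is_solution_def by blast
  have w: "w t \<in> SL_dom a1 a2 b1 b2" using dom \<open>t > 0\<close> by blast
  have wt: "wt t \<in> L2w r" using wtC \<open>t > 0\<close> unfolding L2_C0_on_def by simp
  have "AE x in lebesgue. x \<in> {0<..<1} \<longrightarrow> wt t x = rate (w t) (y t) x"
    using eq[rule_format, OF \<open>t > 0\<close>]
  proof eventually_elim
    case (elim x)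
    show ?case
    proof
      assume "x \<in> {0<..<1}"
      moreover have "(\<Sum>i=1..N. vphi i x * control (w t) (y t) i) = (\<Sum>i=1..N. control (w t) (y t) i * vphi i x)"
        by (simp add: mult.commute)
      ultimately show "wt t x = rate (w t) (y t) x" using elim unfolding w_rate_def by linarith
    qed
  qed
  then have "Vdot r \<phi> N \<mu> R 1 weight (w t) (y t) (wt t) (control (w t) (y t))
      = Vdot r \<phi> N \<mu> R 1 weight (w t) (y t) (rate (w t) (y t)) (control (w t) (y t))"
    by (intro Vdot_cong_AE SL_dom_L2 w wt w_rate_L2 AE_I01_open)
  moreover have "((\<lambda>s. Vfun r \<phi> N R 1 weight (w s) (y s)) has_real_derivative
      Vdot r \<phi> N \<mu> R 1 weight (w t) (y t) (wt t) (control (w t) (y t))) (at t)"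
  proof (rule Vfun_curve_derivative[where w = w and y = y and t = t])
    show "w t \<in> L2w r" "wt t \<in> L2w r" by (rule SL_dom_L2[OF w], rule wt)
    have "\<forall>\<^sub>F s in at t. s > 0" using \<open>t > 0\<close> by (intro order_tendstoD(1)[OF tendsto_ident_at])
    then show "\<forall>\<^sub>F s in at t. w s \<in> L2w r"
      by eventually_elim (use dom SL_dom_L2 in blast)
    have at: "at t within {0<..} = at t" using \<open>t > 0\<close> by (intro at_within_open) auto
    have "t \<in> {0<..}" using \<open>t > 0\<close> by simp
    then have "((\<lambda>s. L2norm r (\<lambda>x. (w s x - w t x) / (s - t) - wt t x)) \<longlongrightarrow> 0) (at t within {0<..})"
      using wtd unfolding L2_has_deriv_on_def by blast
    then show "((\<lambda>s. L2norm r (\<lambda>x. (w s x - w t x) / (s - t) - wt t x)) \<longlongrightarrow> 0) (at t)"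
      unfolding at .
    show "((\<lambda>s. y s i) has_real_derivative - \<mu> i * y t i + control (w t) (y t) i) (at t)" if "i \<in> {1..N}" for i
      using yd \<open>t > 0\<close> that by blast
  qed
  ultimately show ?thesis using neg[OF w, of "y t"] unfolding state_norm_sq by (intro exI conjI) simp_all
qed

lemma Vfun_continuous_along_solutions:
  assumes sol: "is_solution p q r a1 a2 b1 b2 N \<mu> vphi F w y v"
  shows "continuous_on {0..} (\<lambda>t. Vfun r \<phi> N R 1 weight (w t) (y t))"
  unfolding continuous_on_def
proof
  fix t :: real assume t: "t \<in> {0..}"
  have C0: "L2_C0_on r {0..} w" and yC: "\<forall>i\<in>{1..N}. Ck_on 1 {0..} (\<lambda>t. y t i)"
    using sol unfolding is_solution_def by blast+
  have wL: "w s \<in> L2w r" if "s \<in> {0..}" for s using C0 that unfolding L2_C0_on_def by blast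
  have wlim: "((\<lambda>s. L2norm r (\<lambda>x. w s x - w t x)) \<longlongrightarrow> 0) (at t within {0..})"
    using C0 t unfolding L2_C0_on_def by blast
  have ylim: "((\<lambda>s. y s i) \<longlongrightarrow> y t i) (at t within {0..})" if "i \<in> {1..N}" for i
    using Ck1_continuous[of "{0..}" "\<lambda>t. y t i"] yC that t unfolding continuous_on_def by blast
  have "((\<lambda>s. sqrt ((L2norm r (\<lambda>x. w s x - w t x))\<^sup>2 + (\<Sum>i=1..N. (y s i - y t i)\<^sup>2)))
      \<longlongrightarrow> sqrt (0\<^sup>2 + (\<Sum>i=1..N. (y t i - y t i)\<^sup>2))) (at t within {0..})"
    by (intro tendsto_intros wlim ylim)
  then have lim: "((\<lambda>s. state_norm r N (\<lambda>x. w s x - w t x) (\<lambda>i. y s i - y t i)) \<longlongrightarrow> 0) (at t within {0..})"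
    unfolding state_norm_def by simp
  show "((\<lambda>t. Vfun r \<phi> N R 1 weight (w t) (y t)) \<longlongrightarrow> Vfun r \<phi> N R 1 weight (w t) (y t)) (at t within {0..})"
  proof (rule tendstoI)
    fix \<epsilon> :: real assume "\<epsilon> > 0"
    from Vfun_continuous[OF wL[OF t] this] obtain \<delta> where \<delta>: "\<delta> > 0"
      "\<And>w' y'. w' \<in> L2w r \<Longrightarrow> state_norm r N (\<lambda>x. w' x - w t x) (\<lambda>i. y' i - y t i) < \<delta> \<Longrightarrow>
         \<bar>Vfun r \<phi> N R 1 weight w' y' - Vfun r \<phi> N R 1 weight (w t) (y t)\<bar> < \<epsilon>" by blast
    have "\<forall>\<^sub>F s in at t within {0..}. s \<in> {0..}"
      unfolding eventually_at_filter by (intro always_eventually) blast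
    moreover have "\<forall>\<^sub>F s in at t within {0..}. state_norm r N (\<lambda>x. w s x - w t x) (\<lambda>i. y s i - y t i) < \<delta>"
      using order_tendstoD(2)[OF lim \<delta>(1)] .
    ultimately show "\<forall>\<^sub>F s in at t within {0..}. dist (Vfun r \<phi> N R 1 weight (w s) (y s)) (Vfun r \<phi> N R 1 weight (w t) (y t)) < \<epsilon>"
      by eventually_elim (unfold dist_real_def, rule \<delta>(2)[OF wL])
  qed
qed

text \<open>Integrating \<open>V' \<le> - c V\<close> uses continuity of \<open>V\<close> at \<open>t = 0\<close>, where a solution need not be
  differentiable. The square roots of the bounds of \<open>V\<close> by the squared norm of the state account for
  \<open>K\<close> and for the rate \<open>c / 2\<close>; the factor 2 in \<open>K\<close> compares the sum of the two norms with the
  Euclidean one.\<close>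

lemma exponential_stability:
  "\<exists>K>0. \<exists>\<sigma>b>0. \<forall>w y.
     is_solution p q r a1 a2 b1 b2 N \<mu> vphi F w y (\<lambda>t. control (w t) (y t)) \<longrightarrow>
     (\<forall>t\<ge>0. L2norm r (w t) + L2_set (y t) {1..N}
        \<le> K * exp (- \<sigma>b * t) * (L2norm r (w 0) + L2_set (y 0) {1..N}))"
proof -
  obtain R \<theta> where R: "R > 0" and \<theta>: "\<theta> > 0" and
    neg: "\<And>w y. w \<in> SL_dom a1 a2 b1 b2 \<Longrightarrow> Vdot r \<phi> N \<mu> R 1 weight w y (rate w y) (control w y)
        \<le> - \<theta> * ((L2norm r w)\<^sup>2 + (\<Sum>i=1..N. (y i)\<^sup>2))"
    using Vdot_negative by blast
  obtain a b where ab: "a > 0" "b > 0"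
    "\<And>w y. w \<in> L2w r \<Longrightarrow> a * (state_norm r N w y)\<^sup>2 \<le> Vfun r \<phi> N R 1 weight w y"
    "\<And>w y. w \<in> L2w r \<Longrightarrow> Vfun r \<phi> N R 1 weight w y \<le> b * (state_norm r N w y)\<^sup>2"
    using Vfun_weight_bounds[OF R] by blast
  define c where "c = \<theta> / b"
  define K where "K = 2 * sqrt (b / a)"
  have Kc: "K > 0" "c / 2 > 0" unfolding K_def c_def using ab \<theta> by simp_all
  show ?thesis
  proof (rule exI[of _ K], rule conjI[OF Kc(1)], rule exI[of _ "c / 2"], rule conjI[OF Kc(2)], intro allI impI)
    fix w y and t :: real
    assume sol: "is_solution p q r a1 a2 b1 b2 N \<mu> vphi F w y (\<lambda>t. control (w t) (y t))" and t: "t \<ge> 0"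
    let ?V = "\<lambda>t. Vfun r \<phi> N R 1 weight (w t) (y t)" and ?s = "\<lambda>t. state_norm r N (w t) (y t)"
    let ?n = "\<lambda>t. L2norm r (w t) + L2_set (y t) {1..N}"
    have wL: "w s \<in> L2w r" if "s \<ge> 0" for s
      using sol that unfolding is_solution_def L2_C0_on_def by auto
    have "?V t \<le> exp (- c * t) * ?V 0"
    proof (rule exponential_decay[OF Vfun_continuous_along_solutions[OF sol] _ t])
      fix s :: real assume s: "s > 0"
      obtain d where d: "(?V has_real_derivative d) (at s)" "d \<le> - \<theta> * (?s s)\<^sup>2"
        using Vfun_decreasing_along_solutions[OF sol neg s] by blast
      have "c * ?V s \<le> c * (b * (?s s)\<^sup>2)"
        using ab \<theta> s unfolding c_def by (intro mult_left_mono ab wL) auto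
      also have "\<dots> = \<theta> * (?s s)\<^sup>2" unfolding c_def using ab by simp
      finally show "\<exists>d. (?V has_real_derivative d) (at s) \<and> d \<le> - c * ?V s" using d by force
    qed
    also have "\<dots> \<le> exp (- c * t) * (b * (?s 0)\<^sup>2)" by (intro mult_left_mono ab wL) auto
    finally have "a * (?s t)\<^sup>2 \<le> exp (- c * t) * (b * (?s 0)\<^sup>2)"
      using ab(3)[OF wL[OF t], of "y t"] by linarith
    then have "(?s t)\<^sup>2 \<le> b / a * exp (- c * t) * (?s 0)\<^sup>2"
      using ab by (simp add: field_simps)
    also have "exp (- c * t) = (exp (- (c / 2) * t))\<^sup>2" by (simp flip: exp_double)
    also have "b / a * (exp (- (c / 2) * t))\<^sup>2 * (?s 0)\<^sup>2 = (sqrt (b / a) * exp (- (c / 2) * t) * ?s 0)\<^sup>2"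
      using ab by (simp add: power_mult_distrib)
    finally have decay: "?s t \<le> sqrt (b / a) * exp (- (c / 2) * t) * ?s 0"
      by (rule power2_le_imp_le) (use ab in \<open>simp add: state_norm_nonneg\<close>)
    have L2s: "(L2_set (y s) {1..N})\<^sup>2 = (\<Sum>i=1..N. (y s i)\<^sup>2)" for s
      unfolding L2_set_def by (simp add: sum_nonneg)
    have "L2_set (y t) {1..N} \<le> ?s t"
      by (rule power2_le_imp_le) (simp_all add: L2s state_norm_sq state_norm_nonneg del: One_nat_def)
    then have "?n t \<le> 2 * ?s t" using L2norm_le_state_norm[of "w t" N "y t"] by simp
    also have "\<dots> \<le> 2 * (sqrt (b / a) * exp (- (c / 2) * t) * ?s 0)" using decay by simp
    also have "\<dots> = K * exp (- (c / 2) * t) * ?s 0" unfolding K_def by simp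
    also have "\<dots> \<le> K * exp (- (c / 2) * t) * ?n 0"
    proof (rule mult_left_mono)
      show "?s 0 \<le> ?n 0"
        unfolding state_norm_def L2s[symmetric]
        by (rule sqrt_sum_squares_le_sum) (auto simp: L2_set_nonneg)
      show "0 \<le> K * exp (- (c / 2) * t)" unfolding K_def using ab by simp
    qed
    finally show "?n t \<le> K * exp (- (c / 2) * t) * ?n 0" .
  qed
qed

end

theorem theorem3p1:
  fixes p q r :: "real \<Rightarrow> real" and a1 a2 b1 b2 :: real
    and lam :: "nat \<Rightarrow> real" and \<phi> :: "nat \<Rightarrow> real \<Rightarrow> real"
    and N :: nat and \<mu> :: "nat \<Rightarrow> real" and vphi :: "nat \<Rightarrow> real \<Rightarrow> real"
    and g :: "nat \<Rightarrow> nat \<Rightarrow> real"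
    and F :: "(real \<Rightarrow> real) \<Rightarrow> (real \<Rightarrow> real)" and L \<sigma> \<kappa> :: real
  assumes p: "Ck_on 1 {0..1} p" "\<forall>x\<in>{0..1}. p x > 0"
    and r: "continuous_on {0..1} r" "\<forall>x\<in>{0..1}. r x > 0"
    and q: "continuous_on {0..1} q"
    and ab: "a1\<^sup>2 + a2\<^sup>2 = 1" "b1\<^sup>2 + b2\<^sup>2 = 1"
    and eigensystem: "SL_eigensystem p q r a1 a2 b1 b2 lam \<phi>"
    and standing: "\<exists>N'>0. lam (N' + 1) > 0 \<and>
      summable (\<lambda>k. (SUP x\<in>{0..1}. \<bar>\<phi> (N' + 1 + k) x\<bar>) / lam (N' + 1 + k))"
    and N: "N \<ge> 1" "lam (N + 1) > 0"
    and \<mu>_pos: "\<forall>i\<in>{1..N}. \<mu> i > 0"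
    and vphi_C2: "\<forall>i\<in>{1..N}. Ck_on 2 {0..1} (vphi i)"
    and vphi_ode: "\<forall>i\<in>{1..N}. \<forall>x\<in>{0..1}.
      D1 (\<lambda>s. p s * D1 (vphi i) s) x - q x * vphi i x = - \<mu> i * r x * vphi i x"
    and vphi_bc: "\<forall>i\<in>{1..N}. b1 * vphi i 0 + b2 * D1 (vphi i) 0 = 0 \<and>
      a1 * vphi i 1 + a2 * D1 (vphi i) 1 = 1"
    and vphi_orth: "\<forall>i\<in>{1..N}. \<forall>m\<in>{1..N}. i \<noteq> m \<longrightarrow> L2ip r (vphi i) (vphi m) = 0"
    and B_det: "Determinant.det (Bmat r \<phi> vphi N) \<noteq> 0"
    and g: "\<forall>i\<in>{1..N}. \<forall>m\<in>{1..N}.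
      g i m = (- the (mat_inverse (Bmat r \<phi> vphi N))) $$ (i - 1, m - 1)"
    and F_maps: "\<forall>u\<in>L2w r. F u \<in> L2w r"
    and F_cont: "L2_continuous r F"
    and F_zero: "AE x in lebesgue. x \<in> {0..1} \<longrightarrow> F (\<lambda>_. 0) x = 0"
    and L: "L \<ge> 0" "\<forall>u\<in>L2w r. L2norm r (F u) \<le> L * L2norm r u"
    and \<sigma>: "\<sigma> > 0"
    and \<kappa>: "\<kappa> > 0"
    and cond_\<mu>: "\<forall>i\<in>{1..N}. (\<mu> i)\<^sup>2 >
      2 * real N * L\<^sup>2 * (1 + 1 / \<kappa>) * (L2norm r (vphi i))\<^sup>2 * (\<Sum>m=1..N. (g i m)\<^sup>2)"
    and cond_lam: "(lam (N + 1))\<^sup>2 > L\<^sup>2 * (1 + \<kappa> * real N) *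
      (1 + 2 * real N * (\<Sum>i=1..N. \<Sum>m=1..N. (L2norm r (vphi i))\<^sup>2 * (g i m)\<^sup>2))"
  shows
    "(\<exists>\<omega> \<gamma> R. (\<forall>i\<in>{1..N}. \<omega> i > 0) \<and> \<gamma> > 0 \<and> R > 0 \<and>
        control_Lyapunov_functional p q r a1 a2 b1 b2 N \<mu> vphi F (Vfun r \<phi> N R \<gamma> \<omega>) \<and>
        (\<exists>\<theta>>0. \<forall>w\<in>SL_dom a1 a2 b1 b2. \<forall>y.
           let v = feedback r \<phi> lam N vphi F g \<sigma> w y;
               wd = w_rate p q r N vphi F w y v
           in Vdot r \<phi> N \<mu> R \<gamma> \<omega> w y wd v
                \<le> - \<theta> * ((L2norm r w)\<^sup>2 + (\<Sum>i=1..N. (y i)\<^sup>2))))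
     \<and>
     (\<exists>K>0. \<exists>\<sigma>b>0. \<forall>w y.
        is_solution p q r a1 a2 b1 b2 N \<mu> vphi F w y
          (\<lambda>t. feedback r \<phi> lam N vphi F g \<sigma> (w t) (y t)) \<longrightarrow>
        (\<forall>t\<ge>0. L2norm r (w t) + L2_set (y t) {1..N}
           \<le> K * exp (- \<sigma>b * t) * (L2norm r (w 0) + L2_set (y 0) {1..N})))"
proof -
  interpret weighted_L2 r
    using r by unfold_locales auto
  have pairs: "SL_eigenpair p q r a1 a2 b1 b2 (lam n) (\<phi> n)" if "n \<ge> 1" for n
    using eigensystem that unfolding SL_eigensystem_def by blast
  have dom: "\<phi> n \<in> SL_dom a1 a2 b1 b2" if "n \<ge> 1" for n
    using pairs[OF that] unfolding SL_eigenpair_def by blast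
  interpret closed_loop r p q a1 a2 b1 b2 \<phi> lam N \<mu> vphi g F L \<sigma> \<kappa>
  proof unfold_locales
    fix n m :: nat assume n: "n \<ge> 1"
    show "\<phi> n \<in> L2w r" by (intro L2w_continuous H2_continuous SL_domD(1)[OF dom] n)
    show "L2norm r (\<phi> n) = 1" using eigensystem n unfolding SL_eigensystem_def by blast
    show "L2ip r (\<phi> n) (\<phi> m) = 0" if "m \<ge> 1" "n \<noteq> m"
      using eigensystem n that unfolding SL_eigensystem_def by blast
    show "\<phi> n \<in> SL_dom a1 a2 b1 b2" by (rule dom[OF n])
    show "AE x in I01. SL_op p q r (\<phi> n) x = lam n * \<phi> n x"
      using pairs[OF n] unfolding SL_eigenpair_def AE_I01_iff by blast
    have "strict_mono_on {1..} lam" using eigensystem unfolding SL_eigensystem_def by blast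
    then show "lam n \<le> lam m" if "n \<le> m"
      using that n by (metis atLeast_iff dual_order.trans le_less strict_mono_onD)
  next
    fix f assume "f \<in> L2w r"
    then have "(\<lambda>k. L2norm r (\<lambda>x. f x - (\<Sum>n=1..k. L2ip r (\<phi> n) f * \<phi> n x))) \<longlonglongrightarrow> 0"
      using eigensystem unfolding SL_eigensystem_def by blast
    then show "(\<lambda>k. L2norm r (\<lambda>x. f x - proj r \<phi> k f x)) \<longlonglongrightarrow> 0" by (simp only: proj_def)
  next
    fix i assume i: "i \<in> {1..N}"
    have "vphi i differentiable_on {0..1}" using vphi_C2 i by (simp add: numeral_2_eq_2)
    then show "vphi i \<in> L2w r" by (intro L2w_continuous differentiable_imp_continuous_on)
    show "0 < \<mu> i" using \<mu>_pos i by blast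
    show "2 * real N * L\<^sup>2 * (1 + 1 / \<kappa>) * (L2norm r (vphi i))\<^sup>2 * (\<Sum>m=1..N. (g i m)\<^sup>2) < (\<mu> i)\<^sup>2"
      using cond_\<mu> i by blast
    fix j assume j: "j \<in> {1..N}"
    show "(\<Sum>k=1..N. L2ip r (\<phi> i) (vphi k) * g k j) = (if i = j then 1 else 0)"
      "(\<Sum>k=1..N. g i k * L2ip r (\<phi> k) (vphi j)) = (if i = j then 1 else 0)"
      by (rule Bmat_inverse[OF B_det g i j])+
    show "L2ip r (vphi i) (vphi j) = 0" if "i \<noteq> j" using vphi_orth i j that by blast
  next
    fix u assume "u \<in> L2w r"
    then show "F u \<in> L2w r" "L2norm r (F u) \<le> L * L2norm r u" using F_maps L by blast+
  qed (use p q ab N L \<sigma> \<kappa> cond_lam in auto)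
  obtain R \<theta> where R: "R > 0" and \<theta>: "\<theta> > 0" and
    neg: "\<And>w y. w \<in> SL_dom a1 a2 b1 b2 \<Longrightarrow> Vdot r \<phi> N \<mu> R 1 weight w y (rate w y) (control w y)
        \<le> - \<theta> * ((L2norm r w)\<^sup>2 + (\<Sum>i=1..N. (y i)\<^sup>2))"
    using Vdot_negative by blast
  show ?thesis
  proof (rule conjI)
    show "\<exists>\<omega> \<gamma> R. (\<forall>i\<in>{1..N}. \<omega> i > 0) \<and> \<gamma> > 0 \<and> R > 0 \<and>
        control_Lyapunov_functional p q r a1 a2 b1 b2 N \<mu> vphi F (Vfun r \<phi> N R \<gamma> \<omega>) \<and>
        (\<exists>\<theta>>0. \<forall>w\<in>SL_dom a1 a2 b1 b2. \<forall>y.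
           let v = feedback r \<phi> lam N vphi F g \<sigma> w y;
               wd = w_rate p q r N vphi F w y v
           in Vdot r \<phi> N \<mu> R \<gamma> \<omega> w y wd v
                \<le> - \<theta> * ((L2norm r w)\<^sup>2 + (\<Sum>i=1..N. (y i)\<^sup>2)))"
      unfolding Let_def
    proof (rule exI[of _ weight], rule exI[of _ 1], rule exI[of _ R], intro conjI)
      show "\<forall>i\<in>{1..N}. weight i > 0" by (intro ballI weight_pos)
      show "control_Lyapunov_functional p q r a1 a2 b1 b2 N \<mu> vphi F (Vfun r \<phi> N R 1 weight)"
        by (rule control_Lyapunov_functional_Vfun[OF R \<theta> neg])
      show "\<exists>\<theta>>0. \<forall>w\<in>SL_dom a1 a2 b1 b2. \<forall>y. Vdot r \<phi> N \<mu> R 1 weight w y (rate w y) (control w y)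
          \<le> - \<theta> * ((L2norm r w)\<^sup>2 + (\<Sum>i=1..N. (y i)\<^sup>2))"
        by (rule exI[of _ \<theta>]) (intro conjI ballI allI \<theta> neg)
    qed (simp, rule R)
  next
    show "\<exists>K>0. \<exists>\<sigma>b>0. \<forall>w y.
        is_solution p q r a1 a2 b1 b2 N \<mu> vphi F w y
          (\<lambda>t. feedback r \<phi> lam N vphi F g \<sigma> (w t) (y t)) \<longrightarrow>
        (\<forall>t\<ge>0. L2norm r (w t) + L2_set (y t) {1..N}
           \<le> K * exp (- \<sigma>b * t) * (L2norm r (w 0) + L2_set (y 0) {1..N}))"
      by (rule exponential_stability)
  qed
qed

end
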